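(* Let $G$ be a connected graph that is $(\mathrm{bull}, E)$-free, i.e. $G$ contains neither the bull nor $E$ as an induced subgraph. Then at least one of the following holds: (i) $G$ contains an odd wheel; (ii) $G$ contains a (not necessarily induced) spindle graph $M_{3i+1}$ for some $i\geq 1$, i.e. $G$ has a subgraph isomorphic to $M_{3i+1}$; (iii) $G$ is $3$-colourable.
   Context: All graphs are finite, simple and undirected. The bull is the graph on vertices $v_1,\dots,v_5$ with edges $v_1v_2, v_2v_3, v_3v_4, v_4v_5, v_2v_4$. For integers $i,j,k\ge 1$, $S_{i,j,k}$ is the graph consisting of three induced paths of lengths $i$, $j$ and $k$ sharing a common initial vertex and otherwise disjoint, with no further edges; $E$ denotes $S_{1,2,2}$. An odd wheel $W_{2t+1}$ ($t\ge 1$) is the graph obtained from a cycle of length $2t+1$ by adding a vertex adjacent to all vertices of the cycle. For $p\ge 1$, a spindle graph $M_{3p+1}$ is a graph of order $3p+1$ containing a cycle $u_0u_1\cdots u_{3p}u_0$ (indices modulo $3p+1$) such that for each $i\in\{1,\dots,p\}$ one has $N(u_{3i})=\{u_{3i-2},u_{3i-1},u_{3i+1},u_{3i+2}\}$ and $N(u_{3i-1})\cap N(u_{3i-2})=\{u_{3i-3},u_{3i}\}$. (E.g. $M_4\cong K_4$, $M_7$ is the Moser spindle.)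
   Formalization: In the definition of M_{3p+1}, the condition on N(u_{3i}) is imposed only for 1 ≤ i < p; for i = p ≥ 2 it would add the edge u_{3p}u_1, so M_7 would not be the Moser spindle, which would itself be a counterexample to the claim. *)

theory Defs
  imports "Graph_Theory.Graph_Theory"
begin

text \<open>
  Finite simple undirected graphs are the symmetric loop-free pair digraphs of the locale
  \<^locale>\<open>pair_graph\<close>: an edge \<open>xy\<close> is the pair of arcs \<open>(x, y)\<close>, \<open>(y, x)\<close>.
\<close>

definition undirected :: "'a set \<Rightarrow> 'a rel \<Rightarrow> 'a pair_pre_digraph" where
  "undirected V E = \<lparr> pverts = V, parcs = E \<union> E\<inverse> \<rparr>"

definition bull :: "nat pair_pre_digraph" where
  "bull = undirected {1..5} {(1,2), (2,3), (3,4), (4,5), (2,4)}"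

text \<open>
  \<open>S_graph i j k\<close> for \<open>i, j, k \<ge> 1\<close>: the common initial vertex is \<open>(0, 0)\<close>, and \<open>(l, m)\<close> is
  the vertex at distance \<open>m \<ge> 1\<close> from it on the \<open>l\<close>-th path (\<open>l = 0, 1, 2\<close>).
\<close>

definition S_graph :: "nat \<Rightarrow> nat \<Rightarrow> nat \<Rightarrow> (nat \<times> nat) pair_pre_digraph" where
  "S_graph i j k = undirected
     ({(0, 0)} \<union> {(l, m). l < 3 \<and> 1 \<le> m \<and> m \<le> [i, j, k] ! l})
     ({((0, 0), (l, 1)) | l. l < 3} \<union>
      {((l, m), (l, m + 1)) | l m. l < 3 \<and> 1 \<le> m \<and> m < [i, j, k] ! l})"

text \<open>The wheel with rim \<open>0, \<dots>, n - 1\<close> (for \<open>n \<ge> 3\<close>) and hub \<open>n\<close>.\<close>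

definition wheel :: "nat \<Rightarrow> nat pair_pre_digraph" where
  "wheel n = undirected {..n} ({(i, (i + 1) mod n) | i. i < n} \<union> {(n, i) | i. i < n})"

definition contains_induced :: "'a pair_pre_digraph \<Rightarrow> 'b pair_pre_digraph \<Rightarrow> bool" where
  "contains_induced G H \<longleftrightarrow>
     (\<exists>H'. induced_subgraph (with_proj H') (with_proj G) \<and> digraph_iso (with_proj H') (with_proj H))"

definition nbh :: "'a pair_pre_digraph \<Rightarrow> 'a \<Rightarrow> 'a set" where
  "nbh G x = {y. (x, y) \<in> parcs G}"

text \<open>
  \<open>spindle p H\<close>: the graph \<open>H\<close> is a spindle graph of order \<open>3 * p + 1\<close>. The neighbourhood of
  \<open>u (3 * i)\<close> is prescribed for \<open>i < p\<close> only. For \<open>i = p \<ge> 2\<close>, with indices modulo \<open>3 * p + 1\<close>,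
  the same formula would add the edge between \<open>u (3 * p)\<close> and \<open>u (3 * p + 2) = u 1\<close>, and then
  the Moser spindle would not be a spindle graph of order 7.
  The conditions do not exclude further edges, but they all hold in the graph
  \<open>standard_spindle p\<close> below, and every spindle graph of order \<open>3 * p + 1\<close> has a copy of it as
  a spanning subgraph. So containing some spindle graph as a (not necessarily induced) subgraph
  means the same as containing \<open>standard_spindle p\<close>.
\<close>

definition spindle :: "nat \<Rightarrow> 'a pair_pre_digraph \<Rightarrow> bool" where
  "spindle p H \<longleftrightarrow> pair_graph H \<and>
     (\<exists>u. bij_betw u {..3 * p} (pverts H) \<and>
       (\<forall>k \<le> 3 * p. (u k, u ((k + 1) mod (3 * p + 1))) \<in> parcs H) \<and>
       (\<forall>i \<in> {1..<p}. nbh H (u (3 * i)) =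
          {u (3 * i - 2), u (3 * i - 1), u (3 * i + 1), u (3 * i + 2)}) \<and>
       (\<forall>i \<in> {1..p}. nbh H (u (3 * i - 1)) \<inter> nbh H (u (3 * i - 2)) =
          {u (3 * i - 3), u (3 * i)}))"

definition colourable :: "nat \<Rightarrow> 'a pair_pre_digraph \<Rightarrow> bool" where
  "colourable k G \<longleftrightarrow>
     (\<exists>c :: 'a \<Rightarrow> nat. (\<forall>x \<in> pverts G. c x < k) \<and> (\<forall>(x, y) \<in> parcs G. c x \<noteq> c y))"


definition standard_spindle :: "nat \<Rightarrow> nat pair_pre_digraph" where
  "standard_spindle p = undirected {..3 * p}
     ({(k, (k + 1) mod (3 * p + 1)) | k. k \<le> 3 * p} \<union>
      {(3 * i, 3 * i + 2) | i. i < p} \<union> {(3 * i + 1, 3 * i + 3) | i. i < p})"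

lemma parcs_standard_spindle:
  assumes "p \<ge> 1"
  shows "(x, y) \<in> parcs (standard_spindle p) \<longleftrightarrow> x \<le> 3 * p \<and> y \<le> 3 * p \<and>
    (y = x + 1 \<or> x = y + 1 \<or> x = 0 \<and> y = 3 * p \<or> y = 0 \<and> x = 3 * p \<or>
     y = x + 2 \<and> x mod 3 \<noteq> 2 \<or> x = y + 2 \<and> y mod 3 \<noteq> 2)"
proof -
  have cyc: "(\<exists>k. a = k \<and> b = (k + 1) mod (3 * p + 1) \<and> k \<le> 3 * p) \<longleftrightarrow>
      a \<le> 3 * p \<and> b \<le> 3 * p \<and> (b = a + 1 \<or> a = 3 * p \<and> b = 0)" for a b
    using assms by (cases "a < 3 * p") (auto simp: not_less le_less)
  have even0: "(\<exists>i. a = 3 * i \<and> b = 3 * i + 2 \<and> i < p) \<longleftrightarrow>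
      b \<le> 3 * p \<and> b = a + 2 \<and> a mod 3 = 0" for a b :: nat
    by presburger
  have odd1: "(\<exists>i. a = 3 * i + 1 \<and> b = 3 * i + 3 \<and> i < p) \<longleftrightarrow>
      b \<le> 3 * p \<and> b = a + 2 \<and> a mod 3 = 1" for a b :: nat
    by presburger
  have mod3: "a mod 3 \<noteq> 2 \<longleftrightarrow> a mod 3 = 0 \<or> a mod 3 = 1" for a :: nat
    by presburger
  show ?thesis
    unfolding standard_spindle_def undirected_def
    by (simp only: pair_pre_digraph.simps Un_iff converse_iff mem_Collect_eq prod.inject conj_assoc
        cyc even0 odd1 mod3) auto
qed

lemma spindle_standard_spindle:
  assumes "p \<ge> 1"
  shows "spindle p (standard_spindle p)"
proof -
  note arcs = parcs_standard_spindle[OF assms]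
  have verts: "pverts (standard_spindle p) = {..3 * p}"
    by (simp add: standard_spindle_def undirected_def)
  have fin: "finite (parcs (standard_spindle p))"
    by (rule finite_subset[of _ "{..3 * p} \<times> {..3 * p}"]) (auto simp: arcs)
  have "pair_graph (standard_spindle p)"
  proof unfold_locales
    show "symmetric (with_proj (standard_spindle p))"
      by (auto simp: symmetric_def standard_spindle_def undirected_def sym_def)
    show "fst e \<noteq> snd e" if "e \<in> parcs (standard_spindle p)" for e
      using that assms by (cases e) (auto simp: arcs)
  qed (use fin in \<open>auto simp: verts arcs\<close>)
  moreover have "(k, (k + 1) mod (3 * p + 1)) \<in> parcs (standard_spindle p)" if "k \<le> 3 * p" for k
    using that by (auto simp: standard_spindle_def undirected_def)
  moreover have "nbh (standard_spindle p) (3 * i) = {3 * i - 2, 3 * i - 1, 3 * i + 1, 3 * i + 2}"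
    if "i \<in> {1..<p}" for i
  proof -
    obtain j where j: "i = j + 1" "j + 1 < p"
      using \<open>i \<in> {1..<p}\<close> by (cases i) auto
    have "y \<in> nbh (standard_spindle p) (3 * (j + 1)) \<longleftrightarrow>
        y = 3 * j + 1 \<or> y = 3 * j + 2 \<or> y = 3 * j + 4 \<or> y = 3 * j + 5" (is "?L \<longleftrightarrow> ?R") for y
    proof
      assume ?L then show ?R
        using j unfolding nbh_def mem_Collect_eq arcs by (elim conjE disjE) auto
    next
      assume ?R then show ?L
        using j unfolding nbh_def mem_Collect_eq arcs by (elim disjE) (auto simp: mod_Suc)
    qed
    then have "nbh (standard_spindle p) (3 * i) = {3 * j + 1, 3 * j + 2, 3 * j + 4, 3 * j + 5}"
      unfolding j by blast
    then show ?thesis by (simp add: j add.commute)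
  qed
  moreover have "nbh (standard_spindle p) (3 * i - 1) \<inter> nbh (standard_spindle p) (3 * i - 2) =
      {3 * i - 3, 3 * i}"
    if "i \<in> {1..p}" for i
  proof -
    obtain j where j: "i = j + 1" "j < p"
      using \<open>i \<in> {1..p}\<close> by (cases i) auto
    have "y \<in> nbh (standard_spindle p) (3 * j + 2) \<inter> nbh (standard_spindle p) (3 * j + 1) \<longleftrightarrow>
        y = 3 * j \<or> y = 3 * j + 3" (is "?L \<longleftrightarrow> ?R") for y
    proof
      assume L: ?L
      have "(3 * j + 2) mod 3 = 2" by presburger
      then have "y = 3 * j + 3 \<or> y = 3 * j + 1 \<or> y = 3 * j"
        using L unfolding nbh_def Int_iff mem_Collect_eq arcs by auto
      moreover have "y \<noteq> 3 * j + 1"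
        using L unfolding nbh_def Int_iff mem_Collect_eq arcs by auto
      ultimately show ?R by blast
    next
      assume ?R then show ?L
        using j unfolding nbh_def Int_iff mem_Collect_eq arcs
        by (elim disjE) (auto simp: mod_Suc)
    qed
    then have "nbh (standard_spindle p) (3 * j + 2) \<inter> nbh (standard_spindle p) (3 * j + 1) =
        {3 * j, 3 * j + 3}"
      by blast
    then show ?thesis by (simp add: j add.commute)
  qed
  ultimately show ?thesis
    unfolding spindle_def verts by (intro conjI exI[of _ "\<lambda>x. x"]) (auto simp: bij_betw_def inj_on_def)
qed

lemma spindle_imp_standard_spindle:
  assumes "spindle p H"
  shows "\<exists>u. bij_betw u {..3 * p} (pverts H) \<and>
    (\<forall>(x, y) \<in> parcs (standard_spindle p). (u x, u y) \<in> parcs H)"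
proof -
  interpret pair_graph H using assms by (simp add: spindle_def)
  have sym: "(y, x) \<in> parcs H" if "(x, y) \<in> parcs H" for x y
    using that pair_sym_arcs by (auto simp: symmetric_def dest: symD)
  obtain u where u: "bij_betw u {..3 * p} (pverts H)"
    and cyc: "\<forall>k \<le> 3 * p. (u k, u ((k + 1) mod (3 * p + 1))) \<in> parcs H"
    and dia: "\<forall>i \<in> {1..p}. nbh H (u (3 * i - 1)) \<inter> nbh H (u (3 * i - 2)) =
      {u (3 * i - 3), u (3 * i)}"
    using assms unfolding spindle_def by blast
  have dia_arcs: "(u (3 * i), u (3 * i + 2)) \<in> parcs H" "(u (3 * i + 1), u (3 * i + 3)) \<in> parcs H"
    if "i < p" for i
  proof -
    have eqs: "3 * (i + 1) = 3 * i + 3" "3 * i + 3 - 1 = 3 * i + 2" "3 * i + 3 - 2 = 3 * i + 1"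
      "3 * i + 3 - 3 = 3 * i"
      by simp_all
    have "i + 1 \<in> {1..p}" using that by simp
    from bspec[OF dia this]
    have "nbh H (u (3 * i + 2)) \<inter> nbh H (u (3 * i + 1)) = {u (3 * i), u (3 * i + 3)}"
      unfolding eqs .
    then have "u (3 * i) \<in> nbh H (u (3 * i + 2))" "u (3 * i + 3) \<in> nbh H (u (3 * i + 1))"
      by blast+
    then show "(u (3 * i), u (3 * i + 2)) \<in> parcs H" "(u (3 * i + 1), u (3 * i + 3)) \<in> parcs H"
      by (simp_all add: nbh_def sym)
  qed
  have "(u x, u y) \<in> parcs H" if "(x, y) \<in> parcs (standard_spindle p)" for x y
  proof -
    let ?E = "{(k, (k + 1) mod (3 * p + 1)) | k. k \<le> 3 * p} \<union>
      {(3 * i, 3 * i + 2) | i. i < p} \<union> {(3 * i + 1, 3 * i + 3) | i. i < p}"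
    have *: "(u a, u b) \<in> parcs H" if "(a, b) \<in> ?E" for a b
      using that cyc dia_arcs by blast
    have "(x, y) \<in> ?E \<or> (y, x) \<in> ?E"
      using that by (simp only: standard_spindle_def undirected_def pair_pre_digraph.simps
          Un_iff converse_iff)
    then show ?thesis using * sym by blast
  qed
  then have "\<forall>(x, y) \<in> parcs (standard_spindle p). (u x, u y) \<in> parcs H" by blast
  with u show ?thesis by blast
qed

end

theory Submission
  imports Defs
begin

text \<open>
  Take a vertex-critical induced subgraph that is not 3-colourable, and suppose it has no odd wheel
  (neighbourhoods are bipartite) and no spindle (no chain of diamonds has adjacent ends).

  Without odd holes, in a 3-colouring of \<open>G - v\<close> two colour classes together with \<open>v\<close> are not bipartite,
  so every pair of colours occurs on an edge inside \<open>N(v)\<close>. As \<open>G\<close> is bull-free and has no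
  homogeneous set, these edges lie in one component of \<open>N(v)\<close>, which contains a path \<open>xaby\<close> on which
  \<open>x\<close> and \<open>y\<close> share a colour and \<open>a\<close>, \<open>b\<close> have the other two. Outer neighbours of \<open>a\<close> and \<open>b\<close> complete
  it to the complement of a 7-cycle, which contains the Moser spindle.

  If there is an odd hole of length at least 7 but no pentagon, all vertices are clones of the
  vertices of the hole. In this blow-up of an odd cycle some classes contain edges; they are
  pairwise not consecutive, and if they alternate with the others around the cycle, they
  form a spindle; otherwise there is a 3-colouring.

  A pentagon dominates the graph. The neighbourhoods of the other vertices on it are of few types, the
  adjacencies between different types are almost determined, and the graph is coloured explicitly.
\<close>

section \<open>Odd cycles\<close>

text \<open>In every 3-colouring the two ends of a diamond share a colour, so a chain of diamonds
  with adjacent ends is an obstruction. Many contradictions below come from following such forced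
  colours until they close up; apart from the long holes, chains of at most three diamonds suffice
  (\<open>no_K4\<close>, \<open>no_M7\<close>, \<open>no_M10\<close>). The division by hole length
  comes from E. Around a hole of length at least 7 there is room for both long legs of an E, and
  this leaves only clones. Around a pentagon the ends of such legs are adjacent, so more
  neighbourhoods survive. Length 7 is borderline: where two legs would touch, a pentagon arises
  instead, which is why pentagons have to be excluded before longer holes are treated. Criticality
  enters in three forms: deleting any vertex leaves a 3-colourable graph, no proper nonempty vertex
  set is without an outgoing edge, and a homogeneous bipartite set with an edge consists of that
  edge only.\<close>

locale sgraph =
  fixes V :: "'a set" and adj :: "'a \<Rightarrow> 'a \<Rightarrow> bool" (infix "\<sim>" 50)
  assumes finite_V: "finite V"
    and adj_sym: "x \<sim> y \<Longrightarrow> y \<sim> x"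
    and adj_irrefl [simp]: "\<not> x \<sim> x"
    and adj_V: "x \<sim> y \<Longrightarrow> x \<in> V"
begin

lemma adj_commute: "x \<sim> y \<longleftrightarrow> y \<sim> x"
  using adj_sym by blast

definition colourable_on :: "nat \<Rightarrow> 'a set \<Rightarrow> bool" where
  "colourable_on k W \<longleftrightarrow>
     (\<exists>col :: 'a \<Rightarrow> nat. (\<forall>x \<in> W. col x < k) \<and> (\<forall>x \<in> W. \<forall>y \<in> W. x \<sim> y \<longrightarrow> col x \<noteq> col y))"

text \<open>Indexing by the integers modulo \<open>n\<close> makes shifts and reflections of a cycle cycles again.\<close>

definition induced_cycle :: "int \<Rightarrow> (int \<Rightarrow> 'a) \<Rightarrow> bool" where
  "induced_cycle n c \<longleftrightarrow> (\<forall>i j. c i = c j \<longleftrightarrow> n dvd (i - j)) \<and>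
     (\<forall>i j. c i \<sim> c j \<longleftrightarrow> n dvd (i - j - 1) \<or> n dvd (i - j + 1))"

text \<open>Colour each vertex by the parity of its walks to a root of its component. This is well
  defined and proper unless two walks of different parity combine to an odd closed walk.\<close>

lemma ex_odd_closed_walk:
  assumes "\<not> colourable_on 2 W"
  shows "\<exists>n x. odd n \<and> (x, x) \<in> {(x, y). x \<in> W \<and> y \<in> W \<and> x \<sim> y} ^^ n"
proof (rule ccontr)
  define R where "R = {(x, y). x \<in> W \<and> y \<in> W \<and> x \<sim> y}"
  assume "\<not> ?thesis"
  then have even: "even n" if "(x, x) \<in> R ^^ n" for n x
    using that unfolding R_def by blast
  have symR: "(y, x) \<in> R ^^ n" if "(x, y) \<in> R ^^ n" for n x y
    using that
  proof (induction n arbitrary: y)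
    case (Suc n)
    then obtain z where "(x, z) \<in> R ^^ n" "(z, y) \<in> R" by auto
    then have "(z, x) \<in> R ^^ n" "(y, z) \<in> R" using Suc.IH by (auto simp: R_def intro: adj_sym)
    then show ?case by (metis relpow_Suc_I2)
  qed auto
  \<comment> \<open>Adjacent vertices reach the same vertices, so \<open>SOME\<close> picks a single
    root for a whole component.\<close>
  define root where "root x = (SOME y. (x, y) \<in> R\<^sup>*)" for x
  have root: "(x, root x) \<in> R\<^sup>*" for x
    unfolding root_def by (rule someI[of _ x]) simp
  define col where "col x = (if \<exists>n. even n \<and> (x, root x) \<in> R ^^ n then 0 else 1 :: nat)" for x
  have "col x \<noteq> col y" if "(x, y) \<in> R" for x y
  proof -
    have "(x, z) \<in> R\<^sup>* \<longleftrightarrow> (y, z) \<in> R\<^sup>*" for z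
      using that symR[of x y 1] by (metis converse_rtrancl_into_rtrancl relpow_1)
    then have eq: "root x = root y" by (simp add: root_def)
    obtain m where m: "(x, root y) \<in> R ^^ m" using root[of x] rtrancl_imp_relpow eq by metis
    have step: "(a, r) \<in> R ^^ Suc k" if "(b, r) \<in> R ^^ k" "(a, b) \<in> R" for a b r k
      using relpow_Suc_I2[OF that(2,1)] .
    have yx: "(y, x) \<in> R" using symR[of x y 1] that by simp
    have par: "even k \<longleftrightarrow> even l" if "(x, root y) \<in> R ^^ k" "(x, root y) \<in> R ^^ l" for k l
    proof -
      have "(x, x) \<in> R ^^ (k + l)"
        using that(1) symR[OF that(2)] by (auto simp: relpow_add)
      then have "even (k + l)" by (rule even)
      then show ?thesis by simp
    qed
    have "(\<exists>n. even n \<and> (x, root y) \<in> R ^^ n) \<longleftrightarrow> even m"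
      using m par by blast
    moreover have "(\<exists>n. even n \<and> (y, root y) \<in> R ^^ n) \<longleftrightarrow> odd m"
    proof
      assume "\<exists>n. even n \<and> (y, root y) \<in> R ^^ n"
      then obtain n where "even n" "(y, root y) \<in> R ^^ n" by blast
      then have "(x, root y) \<in> R ^^ Suc n" by (intro step[OF _ \<open>(x, y) \<in> R\<close>])
      then show "odd m" using par[OF m] \<open>even n\<close> by (metis even_Suc)
    next
      assume "odd m"
      then show "\<exists>n. even n \<and> (y, root y) \<in> R ^^ n"
        using step[OF m yx] by (intro exI[of _ "Suc m"] conjI) simp_all
    qed
    ultimately show ?thesis unfolding col_def eq by auto
  qed
  then have "\<forall>x\<in>W. \<forall>y\<in>W. x \<sim> y \<longrightarrow> col x \<noteq> col y" by (auto simp: R_def)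
  moreover have "\<forall>x\<in>W. col x < 2" by (simp add: col_def)
  ultimately show False using assms unfolding colourable_on_def by blast
qed

text \<open>A shortest odd closed walk works: a repeated vertex or a chord splits it into two closed
  walks, one of them odd and shorter. Triangles count as induced cycles here.\<close>

lemma ex_odd_induced_cycle:
  assumes "\<not> colourable_on 2 W"
  obtains n c where "odd n" "n \<ge> 3" "induced_cycle n c" "range c \<subseteq> W"
proof -
  define R where "R = {(x, y). x \<in> W \<and> y \<in> W \<and> x \<sim> y}"
  define P where "P n \<longleftrightarrow> odd n \<and> (\<exists>x. (x, x) \<in> R ^^ n)" for n
  define m where "m = (LEAST n. P n)"
  have "\<exists>n. P n" using ex_odd_closed_walk[OF assms] by (auto simp: P_def R_def)
  then have m: "P m" and least: "P k \<Longrightarrow> m \<le> k" for k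
    unfolding m_def by (auto intro: LeastI_ex Least_le)
  have odd: "odd m" using m by (simp add: P_def)
  obtain f where f: "f 0 = f m" "\<And>i. i < m \<Longrightarrow> (f i, f (Suc i)) \<in> R"
    using m unfolding P_def relpow_fun_conv by metis
  define n where "n = int m"
  define c where "c i = f (nat (i mod n))" for i :: int
  have n0: "n > 0" using odd n_def by (cases m) auto
  have oddn: "odd n" using odd by (simp add: n_def)
  have per: "c i = c j" if "n dvd (i - j)" for i j
    unfolding c_def mod_eq_dvd_iff[THEN iffD2, OF that] ..
  have stp: "(c i, c (i + 1)) \<in> R" for i
  proof -
    define k where "k = nat (i mod n)"
    have k: "k < m" "int k = i mod n" using n0 by (auto simp: k_def n_def nat_less_iff)
    have "(f k, f (Suc k)) \<in> R" using f(2) k by blast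
    moreover have "f (Suc k) = c (i + 1)"
    proof (cases "Suc k = m")
      case True
      have "(i + 1) mod n = (i mod n + 1) mod n" by (simp add: mod_simps)
      also have "i mod n + 1 = n" using k True by (simp add: n_def)
      finally show ?thesis using True f(1) by (simp add: c_def)
    next
      case False
      then have "(i mod n + 1) mod n = int (Suc k)" using k by (simp add: n_def)
      then have "(i + 1) mod n = int (Suc k)" by (simp add: mod_simps)
      then have "nat ((i + 1) mod n) = Suc k" by simp
      then show ?thesis by (simp add: c_def)
    qed
    ultimately show ?thesis by (simp add: c_def k_def)
  qed
  have walk: "(c i, c (i + int k)) \<in> R ^^ k" for i k
  proof (induction k)
    case (Suc k)
    then show ?case using stp[of "i + int k"] by (auto simp: algebra_simps)
  qed simp
  have closed: "n \<le> int k" if "odd k" "(x, x) \<in> R ^^ k" for x k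
    using least[of k] that by (auto simp: P_def n_def)
  have inj: "n dvd (i - j)" if eq: "c i = c j" for i j
  proof (rule ccontr)
    assume nd: "\<not> n dvd (i - j)"
    define d where "d = nat ((i - j) mod n)"
    have d: "int d = (i - j) mod n" "int d < n" "0 < d"
      using n0 nd by (auto simp: d_def dvd_eq_mod_eq_0 zero_less_nat_eq order_le_neq_trans)
    have "n dvd (i - j - int d)" by (simp add: d(1))
    then have ci: "c (j + int d) = c i"
      using per[of i "j + int d"] by (simp add: diff_diff_eq)
    have "(c j, c j) \<in> R ^^ d" using walk[of j d] ci eq by simp
    moreover have "(c j, c j) \<in> R ^^ (m - d)"
    proof -
      have "c (j + int d + int (m - d)) = c j" using d n_def by (intro per) auto
      then show ?thesis using walk[of "j + int d" "m - d"] ci eq by simp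
    qed
    moreover have "odd d \<or> odd (m - d)" using odd d n_def by auto
    ultimately show False using closed[of d] closed[of "m - d"] d n_def by auto
  qed
  have chord: "n dvd (i - j - 1) \<or> n dvd (i - j + 1)" if ij: "c i \<sim> c j" for i j
  proof (rule ccontr)
    assume nd: "\<not> ?thesis"
    define d where "d = nat ((i - j) mod n)"
    have nd0: "\<not> n dvd (i - j)" using per[of i j] ij by auto
    have d: "int d = (i - j) mod n" "int d < n" "0 < d"
      using n0 nd0 by (auto simp: d_def dvd_eq_mod_eq_0 zero_less_nat_eq order_le_neq_trans)
    have dv: "n dvd (i - j - int d)" by (simp add: d(1))
    have ci: "c (j + int d) = c i"
      using per[of i "j + int d"] dv by (simp add: diff_diff_eq)
    have d1: "d \<noteq> 1" using nd dv by auto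
    have d2: "d + 1 \<noteq> m"
    proof
      assume "d + 1 = m"
      then have "int d = n - 1" by (simp add: n_def flip: of_nat_Suc)
      then have "n dvd (i - j + 1 - n)" using dv by (simp add: diff_diff_eq2 diff_diff_eq add.commute)
      then have "n dvd (i - j + 1)" by (metis diff_add_cancel dvd_add dvd_refl)
      then show False using nd by blast
    qed
    have R: "(c i, c j) \<in> R" "(c j, c i) \<in> R"
      using ij stp by (auto simp: R_def intro: adj_sym)
    have "(c j, c j) \<in> R ^^ (Suc d)" using walk[of j d] ci R(1) by auto
    moreover have "(c j, c j) \<in> R ^^ (Suc (m - d))"
    proof -
      have "c (j + int d + int (m - d)) = c j" using d n_def by (intro per) auto
      then have "(c i, c j) \<in> R ^^ (m - d)" using walk[of "j + int d" "m - d"] ci by simp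
      then show ?thesis using R(2) by (metis relpow_Suc_I2)
    qed
    \<comment> \<open>The chord closes the two arcs to walks of lengths \<open>d + 1\<close> and
      \<open>m - d + 1\<close>, whose sum \<open>m + 2\<close> is odd; \<open>d1\<close> and
      \<open>d2\<close> make both shorter than \<open>m\<close>.\<close>
    moreover have "odd (Suc d) \<or> odd (Suc (m - d))" using odd d n_def by auto
    ultimately show False using closed[of "Suc d"] closed[of "Suc (m - d)"] d d1 d2 n_def by auto
  qed
  have "c i \<sim> c j" if "n dvd (i - j - 1) \<or> n dvd (i - j + 1)" for i j
  proof -
    have "c i = c (j + 1) \<or> c (i + 1) = c j"
      using that per[of i "j + 1"] per[of "i + 1" j] by (auto simp: algebra_simps)
    then show ?thesis using stp[of i] stp[of j] by (auto simp: R_def intro: adj_sym)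
  qed
  then have "induced_cycle n c"
    unfolding induced_cycle_def using inj per chord by blast
  moreover have "range c \<subseteq> W" using stp by (auto simp: R_def)
  moreover have "n \<ge> 3"
  proof -
    have "n \<noteq> 1"
    proof
      assume "n = 1"
      then have "c 0 = c 1" using per by simp
      then show False using stp[of 0] by (simp add: R_def)
    qed
    then show ?thesis using oddn n0 by presburger
  qed
  ultimately show ?thesis using that oddn by blast
qed

end

section \<open>Forbidden subgraphs and critical graphs\<close>

text \<open>In the bull the triangle is \<open>b\<close>, \<open>c\<close>, \<open>d\<close> with
  pendants \<open>a\<close>, \<open>e\<close>; in E the centre is \<open>z\<close> and the short leg
  is \<open>a\<close>. In both, the adjacency pattern already forces the vertices to be distinct,
  whereas a spindle need not be induced and therefore carries an injectivity condition. The wheel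
  condition for \<open>n = 3\<close> excludes K4.\<close>

locale forbidden_graph = sgraph +
  assumes no_bull: "\<lbrakk>a \<sim> b; b \<sim> c; c \<sim> d; d \<sim> e; b \<sim> d;
      \<not> a \<sim> c; \<not> a \<sim> d; \<not> a \<sim> e; \<not> b \<sim> e; \<not> c \<sim> e\<rbrakk> \<Longrightarrow> False"
    and no_E: "\<lbrakk>z \<sim> a; z \<sim> b; b \<sim> b'; z \<sim> d; d \<sim> d';
      \<not> z \<sim> b'; \<not> z \<sim> d'; \<not> a \<sim> b; \<not> a \<sim> b'; \<not> a \<sim> d; \<not> a \<sim> d';
      \<not> b \<sim> d; \<not> b \<sim> d'; \<not> b' \<sim> d; \<not> b' \<sim> d'\<rbrakk> \<Longrightarrow> False"
    and no_wheel: "\<lbrakk>odd n; n \<ge> 3; induced_cycle n cyc\<rbrakk> \<Longrightarrow> \<exists>i. \<not> v \<sim> cyc i"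
    and no_spindle: "\<lbrakk>p \<ge> 1; inj_on u {..3 * p :: nat}; \<And>k. k < 3 * p \<Longrightarrow> u k \<sim> u (k + 1); u (3 * p) \<sim> u 0;
      \<And>i. i < p \<Longrightarrow> u (3 * i) \<sim> u (3 * i + 2); \<And>i. i < p \<Longrightarrow> u (3 * i + 1) \<sim> u (3 * i + 3)\<rbrakk> \<Longrightarrow> False"
begin

lemma adj_neq: "x \<sim> y \<Longrightarrow> x \<noteq> y"
  by auto

text \<open>An odd induced cycle inside a neighbourhood would be the rim of a wheel. With the sides
  given as a Boolean function, three mutually adjacent neighbours or a closed walk of length 5
  contradict it immediately.\<close>

lemma bipartite_nbh:
  obtains h :: "'a \<Rightarrow> bool" where "\<And>x y. \<lbrakk>v \<sim> x; v \<sim> y; x \<sim> y\<rbrakk> \<Longrightarrow> h x \<noteq> h y"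
proof -
  have "colourable_on 2 {x. v \<sim> x}"
  proof (rule ccontr)
    assume "\<not> ?thesis"
    then obtain n c where "odd n" "n \<ge> 3" "induced_cycle n c" "range c \<subseteq> {x. v \<sim> x}"
      by (rule ex_odd_induced_cycle)
    then show False using no_wheel[of n c v] by auto
  qed
  then obtain col :: "'a \<Rightarrow> nat" where lt: "\<And>x. v \<sim> x \<Longrightarrow> col x < 2"
    and ne: "\<And>x y. \<lbrakk>v \<sim> x; v \<sim> y; x \<sim> y\<rbrakk> \<Longrightarrow> col x \<noteq> col y"
    unfolding colourable_on_def by auto
  have "(col x = 0) \<noteq> (col y = 0)" if "v \<sim> x" "v \<sim> y" "x \<sim> y" for x y
    using lt[OF that(1)] lt[OF that(2)] ne[OF that] by linarith
  then show ?thesis by (rule that)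
qed

lemma no_K4: "\<lbrakk>a \<sim> b; a \<sim> c; a \<sim> d; b \<sim> c; b \<sim> d; c \<sim> d\<rbrakk> \<Longrightarrow> False"
  by (rule bipartite_nbh[of a]) metis

lemma no_W5: "\<lbrakk>v \<sim> a; v \<sim> b; v \<sim> c; v \<sim> d; v \<sim> e; a \<sim> b; b \<sim> c; c \<sim> d; d \<sim> e; e \<sim> a\<rbrakk> \<Longrightarrow> False"
  by (rule bipartite_nbh[of v]) metis

text \<open>If two of the seven vertices coincide, a \<open>K\<^sub>4\<close> or a closed walk of length 5 in a
  neighbourhood appears.\<close>

lemma no_M7:
  assumes "a \<sim> b" "a \<sim> b'" "b \<sim> b'" "b \<sim> c" "b' \<sim> c"
    and "c \<sim> d" "c \<sim> d'" "d \<sim> d'" "d \<sim> e" "d' \<sim> e" "e \<sim> a"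
  shows False
proof -
  note adj = assms assms[THEN adj_sym]
  have "distinct [a, b, b', c, d, d', e]"
  proof (rule ccontr)
    assume "\<not> ?thesis"
    \<comment> \<open>Of the 21 pairs, 11 are assumed adjacent and hence distinct; these are the
      other 10.\<close>
    then consider "a = c" | "a = d" | "a = d'" | "b = d" | "b = d'" | "b' = d" | "b' = d'"
      | "b = e" | "b' = e" | "c = e"
      using assms[THEN adj_neq] by auto
    then show False
    proof cases
      case 1 then show ?thesis using adj no_K4[of c d d' e] by blast
    next
      case 2 then show ?thesis using adj no_K4[of a b b' c] by blast
    next
      case 3 then show ?thesis using adj no_K4[of a b b' c] by blast
    next
      case 4 then show ?thesis using adj no_W5[of b a b' c d' e] by blast
    next
      case 5 then show ?thesis using adj no_W5[of b a b' c d e] by blast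
    next
      case 6 then show ?thesis using adj no_W5[of b' a b c d' e] by blast
    next
      case 7 then show ?thesis using adj no_W5[of b' a b c d e] by blast
    next
      case 8 then show ?thesis using adj no_K4[of c d d' e] by blast
    next
      case 9 then show ?thesis using adj no_K4[of c d d' e] by blast
    next
      case 10 then show ?thesis using adj no_K4[of a b b' c] by blast
    qed
  qed
  then have inj: "inj_on ((!) [a, b, b', c, d, d', e]) {..3 * 2}"
    by (intro inj_on_nth) auto
  have lt: "k < 3 * 2 \<longleftrightarrow> k \<in> {0, 1, 2, 3, 4, 5}" "k < 2 \<longleftrightarrow> k \<in> {0, 1}" for k :: nat by auto
  show False
    by (rule no_spindle[OF _ inj]) (unfold lt, use assms in auto)
qed

lemma no_M10:
  assumes "a \<sim> b" "a \<sim> b'" "b \<sim> b'" "b \<sim> c" "b' \<sim> c"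
    and "c \<sim> d" "c \<sim> d'" "d \<sim> d'" "d \<sim> e" "d' \<sim> e"
    and "e \<sim> f" "e \<sim> f'" "f \<sim> f'" "f \<sim> g" "f' \<sim> g" "g \<sim> a"
    and "distinct [a, b, b', c, d, d', e, f, f', g]"
  shows False
proof -
  have inj: "inj_on ((!) [a, b, b', c, d, d', e, f, f', g]) {..3 * 3}"
    using assms(17) by (intro inj_on_nth) auto
  have lt: "k < 3 * 3 \<longleftrightarrow> k \<in> {0, 1, 2, 3, 4, 5, 6, 7, 8}" "k < 3 \<longleftrightarrow> k \<in> {0, 1, 2}" for k :: nat
    by auto
  show False
    by (rule no_spindle[OF _ inj]) (unfold lt, use assms in auto)
qed

lemma induced_cycle_5I:
  assumes "a0 \<sim> a1" "a1 \<sim> a2" "a2 \<sim> a3" "a3 \<sim> a4" "a4 \<sim> a0"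
    and "\<not> a0 \<sim> a2" "\<not> a1 \<sim> a3" "\<not> a2 \<sim> a4" "\<not> a3 \<sim> a0" "\<not> a4 \<sim> a1"
  obtains c where "induced_cycle 5 c" "c 0 = a0" "c 1 = a1" "c 2 = a2" "c 3 = a3" "c 4 = a4"
proof -
  define xs where "xs = [a0, a1, a2, a3, a4]"
  have non: "\<not> y \<sim> x" if "\<not> x \<sim> y" for x y
    using that adj_sym by blast
  have "a0 \<noteq> a2" "a1 \<noteq> a3" "a2 \<noteq> a4" "a3 \<noteq> a0" "a4 \<noteq> a1"
    using assms adj_sym by metis+
  then have dist: "distinct xs" using assms(1-5)[THEN adj_neq] by (auto simp: xs_def)
  have lt: "i < 5 \<longleftrightarrow> i \<in> {0, 1, 2, 3, 4}" for i :: nat by auto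
  have A: "xs ! i \<sim> xs ! j \<longleftrightarrow> j = i + 1 \<or> i = j + 1 \<or> i = 0 \<and> j = 4 \<or> i = 4 \<and> j = 0"
    if "i < 5" "j < 5" for i j
    using that unfolding lt insert_iff empty_iff xs_def
    by (elim disjE FalseE)
      (simp_all add: assms assms(1-5)[THEN adj_sym] assms(6-10)[THEN non])
  define c where "c i = xs ! nat (i mod 5)" for i :: int
  have "induced_cycle 5 c"
    unfolding induced_cycle_def
  proof (intro conjI allI)
    fix i j :: int
    have n: "nat (i mod 5) < 5" "nat (j mod 5) < 5" by (auto simp: nat_less_iff)
    show "c i = c j \<longleftrightarrow> 5 dvd (i - j)"
    proof -
      have "c i = c j \<longleftrightarrow> nat (i mod 5) = nat (j mod 5)"
        unfolding c_def using n by (intro nth_eq_iff_index_eq[OF dist]) (auto simp: xs_def)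
      also have "\<dots> \<longleftrightarrow> 5 dvd (i - j)" by (simp add: eq_nat_nat_iff mod_eq_dvd_iff)
      finally show ?thesis .
    qed
    show "c i \<sim> c j \<longleftrightarrow> 5 dvd (i - j - 1) \<or> 5 dvd (i - j + 1)"
    proof -
      have ij: "i mod 5 \<in> {0, 1, 2, 3, 4}" "j mod 5 \<in> {0, 1, 2, 3, 4}" by auto
      have "5 dvd (i - j - 1) \<longleftrightarrow> (i mod 5 - j mod 5 - 1) mod 5 = 0"
        "5 dvd (i - j + 1) \<longleftrightarrow> (i mod 5 - j mod 5 + 1) mod 5 = 0"
        unfolding dvd_eq_mod_eq_0 by (metis mod_diff_eq mod_diff_left_eq, metis mod_diff_eq mod_add_left_eq)
      then show ?thesis
        unfolding c_def A[OF n] using ij by (elim insertE emptyE) simp_all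
    qed
  qed
  then show ?thesis by (rule that) (simp_all add: c_def xs_def)
qed

end

locale critical_graph = forbidden_graph +
  assumes not_colourable: "\<not> colourable_on 3 V"
    and minimal: "W \<subset> V \<Longrightarrow> colourable_on 3 W"
begin

lemma colouring_without:
  assumes "v \<in> V"
  obtains col :: "'a \<Rightarrow> nat" where "\<And>x. x \<in> V \<Longrightarrow> x \<noteq> v \<Longrightarrow> col x < 3"
    "\<And>x y. x \<noteq> v \<Longrightarrow> y \<noteq> v \<Longrightarrow> x \<sim> y \<Longrightarrow> col x \<noteq> col y"
proof -
  have "colourable_on 3 (V - {v})" using assms by (intro minimal) auto
  then obtain col :: "'a \<Rightarrow> nat" where
    col: "\<forall>x \<in> V - {v}. col x < 3" "\<forall>x \<in> V - {v}. \<forall>y \<in> V - {v}. x \<sim> y \<longrightarrow> col x \<noteq> col y"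
    unfolding colourable_on_def by blast
  show ?thesis
    by (rule that[of col]) (use col adj_V adj_sym in blast)+
qed

text \<open>Without such an edge, colourings of the proper subsets \<open>Z\<close> and
  \<open>V - Z\<close> would combine to one of \<open>V\<close>.\<close>

lemma edge_leaving:
  assumes "Z \<subseteq> V" "Z \<noteq> {}" "Z \<noteq> V"
  obtains x y where "x \<in> Z" "y \<in> V - Z" "x \<sim> y"
proof (rule ccontr)
  note thesisI = that
  assume "\<not> thesis"
  then have sep: "\<not> x \<sim> y" if "x \<in> Z" "y \<in> V - Z" for x y using that thesisI by blast
  obtain f where f: "\<forall>x \<in> Z. f x < (3::nat)" "\<forall>x \<in> Z. \<forall>y \<in> Z. x \<sim> y \<longrightarrow> f x \<noteq> f y"
    using minimal[of Z] assms unfolding colourable_on_def by blast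
  obtain g where g: "\<forall>x \<in> V - Z. g x < (3::nat)" "\<forall>x \<in> V - Z. \<forall>y \<in> V - Z. x \<sim> y \<longrightarrow> g x \<noteq> g y"
    using minimal[of "V - Z"] assms unfolding colourable_on_def by blast
  have "colourable_on 3 V"
    unfolding colourable_on_def
    by (rule exI[of _ "\<lambda>x. if x \<in> Z then f x else g x"]) (use f g sep in \<open>auto dest: adj_sym\<close>)
  then show False using not_colourable by simp
qed

text \<open>A homogeneous set that induces a bipartite graph could be replaced by one of its edges.\<close>

lemma homogeneous_edge:
  assumes hom: "\<And>w p q. \<lbrakk>w \<notin> K; p \<in> K; q \<in> K; w \<sim> p\<rbrakk> \<Longrightarrow> w \<sim> q"
    and K: "x \<in> K" "y \<in> K" "x \<sim> y" "K \<subseteq> V"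
    and h: "\<And>p q. \<lbrakk>p \<in> K; q \<in> K; p \<sim> q\<rbrakk> \<Longrightarrow> h p \<noteq> (h q :: bool)"
  shows "K = {x, y}"
proof (rule ccontr)
  assume "K \<noteq> {x, y}"
  then have "V - (K - {x, y}) \<subset> V" using K by auto
  from minimal[OF this] obtain g where g: "\<forall>z \<in> V - (K - {x, y}). g z < (3::nat)"
    "\<forall>z \<in> V - (K - {x, y}). \<forall>w \<in> V - (K - {x, y}). z \<sim> w \<longrightarrow> g z \<noteq> g w"
    unfolding colourable_on_def by blast
  have xy: "g x < 3" "g y < 3" "g x \<noteq> g y" using g K by auto
  \<comment> \<open>The colours of \<open>x\<close> and \<open>y\<close> are spread over the two
    sides of \<open>K\<close>. An outside vertex that sees some vertex of \<open>K\<close> sees both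
    \<open>x\<close> and \<open>y\<close>, so it avoids both colours.\<close>
  define col where "col z = (if z \<in> K then if h z = h x then g x else g y else g z)" for z
  have out: "col z \<noteq> col p" if "z \<in> V" "z \<notin> K" "p \<in> K" "z \<sim> p" for z p
  proof -
    have "z \<sim> x" "z \<sim> y" using hom[OF that(2,3) _ that(4)] K by auto
    then have "g z \<noteq> g x" "g z \<noteq> g y" using g(2) that K by auto
    then show ?thesis using that by (simp add: col_def)
  qed
  have "col z \<noteq> col w" if "z \<in> V" "w \<in> V" "z \<sim> w" for z w
  proof (cases "z \<in> K"; cases "w \<in> K")
    assume "z \<in> K" "w \<in> K"
    then show ?thesis using h[OF _ _ that(3)] xy by (auto simp: col_def)
  next
    assume "z \<in> K" "w \<notin> K"
    then show ?thesis using out[of w z] that adj_sym by metis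
  next
    assume "z \<notin> K" "w \<in> K"
    then show ?thesis using out[of z w] that by metis
  next
    assume "z \<notin> K" "w \<notin> K"
    then show ?thesis using g(2) that by (auto simp: col_def)
  qed
  moreover have "\<forall>z \<in> V. col z < 3" using g(1) xy by (auto simp: col_def)
  ultimately have "colourable_on 3 V" unfolding colourable_on_def by blast
  then show False using not_colourable by simp
qed

end

locale critical_no_hole = critical_graph +
  assumes no_odd_hole: "\<lbrakk>odd n; n \<ge> 5\<rbrakk> \<Longrightarrow> \<not> induced_cycle n c"
begin

lemma ex_coloured_edge:
  assumes v: "v \<in> V"
    and lt: "\<And>x. x \<in> V \<Longrightarrow> x \<noteq> v \<Longrightarrow> col x < (3::nat)"
    and ne: "\<And>x y. x \<noteq> v \<Longrightarrow> y \<noteq> v \<Longrightarrow> x \<sim> y \<Longrightarrow> col x \<noteq> col y"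
    and ij: "i < 3" "j < 3" "i \<noteq> j"
  obtains x y where "v \<sim> x" "v \<sim> y" "x \<sim> y" "col x = i" "col y = j"
proof -
  note thesisI = that
  define W where "W = insert v {x \<in> V. col x = i \<or> col x = j}"
  have "\<not> colourable_on 2 W"
  proof
    assume "colourable_on 2 W"
    then obtain g where g: "\<forall>x \<in> W. g x < (2::nat)" "\<forall>x \<in> W. \<forall>y \<in> W. x \<sim> y \<longrightarrow> g x \<noteq> g y"
      unfolding colourable_on_def by blast
    \<comment> \<open>Outside \<open>W\<close> only the third class of \<open>col\<close> remains,
      which is stable and can receive the new colour 2.\<close>
    define g' where "g' x = (if x \<in> W then g x else 2)" for x
    have out: "x \<noteq> v \<and> col x \<noteq> i \<and> col x \<noteq> j" if "x \<in> V" "x \<notin> W" for x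
      using that by (auto simp: W_def)
    have "g' x \<noteq> g' y" if "x \<in> V" "y \<in> V" "x \<sim> y" for x y
    proof (cases "x \<in> W \<or> y \<in> W")
      case True
      have "g' x \<noteq> g' y" if "x \<in> W" "x \<sim> y" for x y
        using g that by (cases "y \<in> W") (auto simp: g'_def dest: bspec[of _ _ x])
      then show ?thesis using True that(3) adj_sym by metis
    next
      case False
      then have "col x \<noteq> col y" "col x < 3" "col y < 3" using out[of x] out[of y] ne lt that by auto
      then show ?thesis using out[of x] out[of y] False that ij by linarith
    qed
    moreover have "\<forall>x \<in> V. g' x < 3" using g(1) by (auto simp: g'_def intro: less_trans[of _ 2])
    ultimately show False using not_colourable unfolding colourable_on_def by blast
  qed
  then obtain n c where c: "odd n" "n \<ge> 3" "induced_cycle n c" "range c \<subseteq> W"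
    by (rule ex_odd_induced_cycle)
  have "\<not> n \<ge> 5" using no_odd_hole[of n c] c by blast
  then have "n = 3" using c(1,2) by presburger
  then have tri: "c 0 \<sim> c 1" "c 1 \<sim> c 2" "c 0 \<sim> c 2"
    using c(3) unfolding induced_cycle_def by auto
  have W: "c k = v \<or> (col (c k) = i \<or> col (c k) = j)" for k
    using c(4) unfolding W_def by blast
  have goal: thesis if "v \<sim> x" "v \<sim> y" "x \<sim> y" "{x, y} \<subseteq> range c" for x y
  proof -
    have "x \<noteq> v" "y \<noteq> v" using that by auto
    then have "col x = i \<and> col y = j \<or> col x = j \<and> col y = i"
      using W that(4) ne[OF _ _ that(3)] by (metis insert_subset rangeE)
    then show ?thesis using thesisI that adj_sym by metis
  qed
  \<comment> \<open>A triangle that avoids \<open>v\<close> would be properly coloured with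
    \<open>i\<close> and \<open>j\<close> alone.\<close>
  have "c 0 = v \<or> c 1 = v \<or> c 2 = v"
    using W[of 0] W[of 1] W[of 2] ne tri by metis
  then show thesis
    using goal[of "c 1" "c 2"] goal[of "c 0" "c 2"] goal[of "c 0" "c 1"] tri adj_sym by auto
qed

definition nbh_comp :: "'a \<Rightarrow> 'a \<Rightarrow> 'a set" where
  "nbh_comp v x = {(x, y). v \<sim> x \<and> v \<sim> y \<and> x \<sim> y}\<^sup>* `` {x}"

lemma nbh_comp_step:
  assumes "p \<in> nbh_comp v x" "v \<sim> p" "v \<sim> q" "p \<sim> q"
  shows "q \<in> nbh_comp v x"
  using assms unfolding nbh_comp_def by (auto intro: rtrancl_into_rtrancl)

lemma nbh_comp_refl: "x \<in> nbh_comp v x"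
  unfolding nbh_comp_def by auto

lemma nbh_comp_induct [consumes 1, case_names refl step]:
  assumes "p \<in> nbh_comp v x"
    and "P x" "\<And>p q. \<lbrakk>p \<in> nbh_comp v x; P p; v \<sim> p; v \<sim> q; p \<sim> q\<rbrakk> \<Longrightarrow> P q"
  shows "P p"
proof -
  have "(x, p) \<in> {(x, y). v \<sim> x \<and> v \<sim> y \<and> x \<sim> y}\<^sup>*" using assms(1) by (simp add: nbh_comp_def)
  then show ?thesis
    by (induction rule: rtrancl_induct) (use assms(2,3) in \<open>auto simp: nbh_comp_def\<close>)
qed

lemma nbh_comp_nbh: "p \<in> nbh_comp v x \<Longrightarrow> v \<sim> x \<Longrightarrow> v \<sim> p"
  by (induction rule: nbh_comp_induct) auto

text \<open>If no outside vertex distinguished the ends of an edge of the component, connectivity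
  would make the component homogeneous, hence equal to \<open>{x, y}\<close> by
  \<open>homogeneous_edge\<close>. Deleting and colouring around \<open>x\<close> then gives an edge
  in its neighbourhood that avoids the colour of \<open>y\<close>; with \<open>x\<close> and
  \<open>y\<close> it forms a K4.\<close>

lemma ex_mixed_on_comp:
  assumes "v \<sim> x" "v \<sim> y" "x \<sim> y"
  obtains w p q where "w \<in> V" "\<not> v \<sim> w" "p \<in> nbh_comp v x" "q \<in> nbh_comp v x"
    "p \<sim> q" "w \<sim> p" "\<not> w \<sim> q"
proof (rule ccontr)
  note thesisI = that
  define K where "K = nbh_comp v x"
  assume "\<not> thesis"
  then have unmixed: "w \<sim> q" if "w \<in> V" "\<not> v \<sim> w" "p \<in> K" "q \<in> K" "p \<sim> q" "w \<sim> p" for w p q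
    using that thesisI unfolding K_def by blast
  have KN: "v \<sim> p" if "p \<in> K" for p using that assms nbh_comp_nbh K_def by blast
  have conn: "w \<sim> p \<longleftrightarrow> w \<sim> x" if "p \<in> K" "w \<in> V" "\<not> v \<sim> w" for w p
    using that(1) unfolding K_def
  proof (induction rule: nbh_comp_induct)
    case (step p q)
    have "q \<in> nbh_comp v x" using nbh_comp_step step.hyps by blast
    then show ?case using unmixed[of w p q] unmixed[of w q p] step adj_sym that K_def by blast
  qed simp
  have hom: "w \<sim> q" if "w \<notin> K" "p \<in> K" "q \<in> K" "w \<sim> p" for w p q
  proof (cases "v \<sim> w")
    case True
    then have "w \<in> K" using that nbh_comp_step[of p v x w] KN adj_sym unfolding K_def by blast
    then show ?thesis using that by simp
  next
    case False
    then show ?thesis using conn[OF that(2)] conn[OF that(3)] that adj_V by blast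
  qed
  obtain h :: "'a \<Rightarrow> bool" where h: "\<And>x y. \<lbrakk>v \<sim> x; v \<sim> y; x \<sim> y\<rbrakk> \<Longrightarrow> h x \<noteq> h y"
    using bipartite_nbh[of v] by blast
  have "y \<in> K" "x \<in> K" using nbh_comp_refl nbh_comp_step[of x v x y] assms unfolding K_def by auto
  moreover have "K \<subseteq> V" using KN adj_V adj_sym by blast
  ultimately have K: "K = {x, y}"
    using homogeneous_edge[of K x y h] hom h KN assms by blast
  have xV: "x \<in> V" using assms adj_V by blast
  obtain col :: "'a \<Rightarrow> nat" where lt: "\<And>z. z \<in> V \<Longrightarrow> z \<noteq> x \<Longrightarrow> col z < 3"
    and ne: "\<And>z w. z \<noteq> x \<Longrightarrow> w \<noteq> x \<Longrightarrow> z \<sim> w \<Longrightarrow> col z \<noteq> col w"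
    using colouring_without[OF xV] by blast
  \<comment> \<open>The two colours other than \<open>col y\<close>: neighbours of \<open>x\<close>
    with these colours lie outside \<open>K\<close> and therefore see \<open>y\<close> too.\<close>
  define i j :: nat where "i = (if col y = 0 then 1 else 0)" and "j = (if col y = 2 then 1 else 2)"
  have ij: "i < 3" "j < 3" "i \<noteq> j" "i \<noteq> col y" "j \<noteq> col y" by (auto simp: i_def j_def)
  obtain a b where ab: "x \<sim> a" "x \<sim> b" "a \<sim> b" "col a = i" "col b = j"
    using ex_coloured_edge[of x col i j, OF xV lt ne ij(1-3)] by blast
  have "a \<notin> K" "b \<notin> K" using ab ij K by auto
  then have "a \<sim> y" "b \<sim> y" using hom[of _ x y] ab K adj_sym by blast+
  then show False using no_K4[of x y a b] ab assms adj_sym by blast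
qed

end

section \<open>Graphs without odd holes\<close>

context critical_no_hole
begin

text \<open>Otherwise the triangle \<open>p\<close>, \<open>q\<close>, \<open>v\<close> with
  pendants \<open>w\<close> at \<open>p\<close> and \<open>r\<close> at \<open>v\<close> is a
  bull.\<close>

lemma mixed_complete:
  assumes "v \<sim> p" "v \<sim> q" "p \<sim> q" "w \<sim> p" "\<not> w \<sim> q" "\<not> v \<sim> w"
    and "v \<sim> r" "\<not> r \<sim> p" "\<not> r \<sim> q"
  shows "w \<sim> r"
  using no_bull[of w p q v r] assms adj_sym by blast

text \<open>A vertex \<open>w\<close> mixed on an edge of one component sees all of N(v) outside
  that component (\<open>mixed_complete\<close>), so the colour of \<open>w\<close> occurs in N(v)
  only inside the component. Two components with edges would thus own two colours \<open>k\<close>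
  and \<open>k'\<close>, but some edge in N(v) joins these colours.\<close>

lemma nbh_edges_connected:
  assumes v: "v \<in> V" and e: "v \<sim> x" "v \<sim> y" "x \<sim> y" and e': "v \<sim> x'" "v \<sim> y'" "x' \<sim> y'"
  shows "x' \<in> nbh_comp v x"
proof (rule ccontr)
  assume nin: "x' \<notin> nbh_comp v x"
  have symc: "q \<in> nbh_comp v p" if "p \<in> nbh_comp v q" "v \<sim> q" for p q
    using that(1)
  proof (induction rule: nbh_comp_induct)
    case (step p r)
    have "(r, p) \<in> {(x, y). v \<sim> x \<and> v \<sim> y \<and> x \<sim> y}" using step adj_sym by auto
    then show ?case
      using step.IH unfolding nbh_comp_def by (auto intro: converse_rtrancl_into_rtrancl)
  qed (rule nbh_comp_refl)
  have trans: "r \<in> nbh_comp v q" if "r \<in> nbh_comp v p" "p \<in> nbh_comp v q" for p q r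
    using that unfolding nbh_comp_def by auto
  have disj: "p \<notin> nbh_comp v x'" if "p \<in> nbh_comp v x" for p
    using nin that symc[of p x'] trans e' by blast
  obtain col :: "'a \<Rightarrow> nat" where lt: "\<And>z. z \<in> V \<Longrightarrow> z \<noteq> v \<Longrightarrow> col z < 3"
    and ne: "\<And>z w. z \<noteq> v \<Longrightarrow> w \<noteq> v \<Longrightarrow> z \<sim> w \<Longrightarrow> col z \<noteq> col w"
    using colouring_without[OF v] by blast
  have loc: "\<exists>k < 3. \<forall>r. v \<sim> r \<longrightarrow> col r = k \<longrightarrow> r \<in> nbh_comp v x"
    if xy: "v \<sim> x" "v \<sim> y" "x \<sim> y" for x y
  proof -
    obtain w p q where w: "w \<in> V" "\<not> v \<sim> w" "p \<in> nbh_comp v x" "q \<in> nbh_comp v x"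
      "p \<sim> q" "w \<sim> p" "\<not> w \<sim> q"
      using ex_mixed_on_comp[OF xy] by blast
    have vpq: "v \<sim> p" "v \<sim> q" using nbh_comp_nbh w xy by blast+
    then have wv: "w \<noteq> v" using w by auto
    have "r \<in> nbh_comp v x" if "v \<sim> r" "col r = col w" for r
    proof (rule ccontr)
      assume "r \<notin> nbh_comp v x"
      then have "\<not> r \<sim> p" "\<not> r \<sim> q"
        using nbh_comp_step[of _ v x r] w vpq that adj_sym by blast+
      then have "w \<sim> r" using mixed_complete[of v p q w r] w vpq that by blast
      then show False using ne[of w r] wv that adj_neq[OF that(1)] by auto
    qed
    then show ?thesis using lt[OF w(1) wv] by blast
  qed
  obtain k where k: "k < 3" "\<And>r. v \<sim> r \<Longrightarrow> col r = k \<Longrightarrow> r \<in> nbh_comp v x"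
    using loc[OF e] by blast
  obtain k' where k': "k' < 3" "\<And>r. v \<sim> r \<Longrightarrow> col r = k' \<Longrightarrow> r \<in> nbh_comp v x'"
    using loc[OF e'] by blast
  \<comment> \<open>Every colour occurs in N(v), so no colour can be confined to two disjoint
    components.\<close>
  have "k \<noteq> k'"
  proof
    assume "k = k'"
    define j where "j = (if k = 0 then 1 else 0 :: nat)"
    have "j < 3" "k \<noteq> j" by (auto simp: j_def)
    then obtain a b where "v \<sim> a" "col a = k"
      using ex_coloured_edge[of v col k j, OF v lt ne k(1)] by blast
    then show False using k(2) k'(2) disj \<open>k = k'\<close> by blast
  qed
  then obtain a b where "v \<sim> a" "v \<sim> b" "a \<sim> b" "col a = k" "col b = k'"
    using ex_coloured_edge[of v col k k', OF v lt ne k(1) k'(1)] by blast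
  then show False using k(2)[of a] k'(2)[of b] nbh_comp_step[of a v x b] disj by blast
qed

lemma contradiction: False
proof -
  have "V \<noteq> {}" using not_colourable unfolding colourable_on_def by auto
  then obtain v where v: "v \<in> V" by blast
  obtain col :: "'a \<Rightarrow> nat" where lt: "\<And>z. z \<in> V \<Longrightarrow> z \<noteq> v \<Longrightarrow> col z < 3"
    and ne: "\<And>z w. z \<noteq> v \<Longrightarrow> w \<noteq> v \<Longrightarrow> z \<sim> w \<Longrightarrow> col z \<noteq> col w"
    using colouring_without[OF v] by blast
  have edge: "\<exists>x y. v \<sim> x \<and> v \<sim> y \<and> x \<sim> y \<and> col x = i \<and> col y = j"
    if "i < 3" "j < 3" "i \<noteq> j" for i j
    by (rule ex_coloured_edge[of v col i j]) (use v lt ne that in blast)+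
  have vne: "x \<noteq> v" if "v \<sim> x" for x using that by auto
  have inV: "x \<in> V" if "v \<sim> x" for x using that adj_V adj_sym by blast
  have lt': "col x < 3" if "v \<sim> x" for x using lt vne inV that by blast
  have ne': "col x \<noteq> col y" if "v \<sim> x" "v \<sim> y" "x \<sim> y" for x y
    using ne vne that by blast
  obtain h :: "'a \<Rightarrow> bool" where h: "\<And>x y. \<lbrakk>v \<sim> x; v \<sim> y; x \<sim> y\<rbrakk> \<Longrightarrow> h x \<noteq> h y"
    using bipartite_nbh[of v] by blast
  \<comment> \<open>If all other neighbours of \<open>a\<close> were neighbours of \<open>v\<close>,
    a colouring of the graph without \<open>a\<close> would give an edge in N(a) that avoids the
    colour of \<open>v\<close>, and this edge would form a K4 with \<open>a\<close> and
    \<open>v\<close>.\<close>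
  have outer: "\<exists>w. w \<in> V \<and> w \<sim> a \<and> \<not> v \<sim> w \<and> w \<noteq> v" if a: "v \<sim> a" for a
  proof (rule ccontr)
    assume "\<not> ?thesis"
    then have sub: "v \<sim> w" if "a \<sim> w" "w \<noteq> v" for w using that adj_sym adj_V by metis
    obtain f :: "'a \<Rightarrow> nat" where lf: "\<And>z. z \<in> V \<Longrightarrow> z \<noteq> a \<Longrightarrow> f z < 3"
      and nf: "\<And>z w. z \<noteq> a \<Longrightarrow> w \<noteq> a \<Longrightarrow> z \<sim> w \<Longrightarrow> f z \<noteq> f w"
      using colouring_without[OF inV[OF a]] by blast
    define i j :: nat where "i = (if f v = 0 then 1 else 0)" and "j = (if f v = 2 then 1 else 2)"
    have ij: "i < 3" "j < 3" "i \<noteq> j" "i \<noteq> f v" "j \<noteq> f v" by (auto simp: i_def j_def)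
    obtain x y where "a \<sim> x" "a \<sim> y" "x \<sim> y" "f x = i" "f y = j"
      using ex_coloured_edge[of a f i j, OF inV[OF a] lf nf ij(1-3)] by blast
    moreover from this ij have "v \<sim> x" "v \<sim> y" using sub by auto
    ultimately show False using no_K4[of v a x y] a by blast
  qed
  \<comment> \<open>If all paths of two edges in N(v) had equally coloured ends, the colours 0, 1 of
    one edge would spread over its whole component, which also contains an edge coloured 2,
    1.\<close>
  have "\<exists>p0 p1 p2. v \<sim> p0 \<and> v \<sim> p1 \<and> v \<sim> p2 \<and> p0 \<sim> p1 \<and> p1 \<sim> p2 \<and> col p0 \<noteq> col p2"
  proof (rule ccontr)
    assume "\<not> ?thesis"
    then have same: "col x = col z" if "v \<sim> x" "v \<sim> y" "v \<sim> z" "x \<sim> y" "y \<sim> z" for x y z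
      using that by blast
    obtain x y where xy: "v \<sim> x" "v \<sim> y" "x \<sim> y" "col x = 0" "col y = 1"
      using edge[of 0 1] by auto
    obtain x' y' where xy': "v \<sim> x'" "v \<sim> y'" "x' \<sim> y'" "col x' = 2" "col y' = 1"
      using edge[of 2 1] by auto
    have "x' \<in> nbh_comp v x" using nbh_edges_connected[OF v xy(1-3) xy'(1-3)] .
    then have "v \<sim> x' \<and> (\<forall>z. v \<sim> z \<longrightarrow> z \<sim> x' \<longrightarrow> {col x', col z} = {0, 1})"
    proof (induction rule: nbh_comp_induct)
      case refl
      have "col z = 1" if "v \<sim> z" "z \<sim> x" for z
        using same[of z x y] that xy by simp
      then show ?case using xy by auto
    next
      case (step a b)
      then have "b \<sim> a" using adj_sym by simp
      then have ab: "{col a, col b} = {0, 1}" using step by simp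
      show ?case
      proof (intro conjI allI impI)
        show "v \<sim> b" by fact
        fix z assume "v \<sim> z" "z \<sim> b"
        then have "col z = col a"
          using same[of z b a] step(2-4) \<open>b \<sim> a\<close> by blast
        then have "{col b, col z} = {col a, col b}" by auto
        then show "{col b, col z} = {0, 1}" unfolding ab .
      qed
    qed
    from this[THEN conjunct2, rule_format, OF xy'(2) adj_sym[OF xy'(3)]]
    have "{col x', col y'} = {0, 1}" .
    then have "col x' \<in> {0, 1}" by blast
    then show False using xy' by simp
  qed
  then obtain p0 p1 p2 where p: "v \<sim> p0" "v \<sim> p1" "v \<sim> p2" "p0 \<sim> p1" "p1 \<sim> p2" "col p0 \<noteq> col p2"
    by blast
  have c012: "col p0 \<noteq> col p1" "col p1 \<noteq> col p2" using ne' p by auto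
  obtain w where w: "w \<in> V" "w \<sim> p1" "\<not> v \<sim> w" "w \<noteq> v" using outer[OF p(2)] by blast
  have cw: "col w < 3" "col w \<noteq> col p1" using lt w ne[of w p1] vne[OF p(2)] by auto
  \<comment> \<open>The colour \<alpha> is that of the outer neighbour \<open>w\<close>, shared with
    an end \<open>p0\<close> or \<open>p2\<close> of the path. A vertex \<open>r\<close> of N(v)
    with this colour that missed \<open>p1\<close> would see \<open>w\<close> by
    \<open>mixed_complete\<close>, although both have the same colour.\<close>
  have claim: "\<exists>\<alpha> \<gamma>. \<alpha> < 3 \<and> \<gamma> < 3 \<and> \<alpha> \<noteq> \<gamma> \<and> \<alpha> \<noteq> col p1 \<and> \<gamma> \<noteq> col p1 \<and>
      (\<forall>r. v \<sim> r \<longrightarrow> col r = \<alpha> \<longrightarrow> r \<sim> p1) \<and> (\<exists>q. v \<sim> q \<and> q \<sim> p1 \<and> col q = \<gamma>)"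
  proof -
    have main: "\<forall>r. v \<sim> r \<longrightarrow> col r = col q \<longrightarrow> r \<sim> p1"
      if q: "v \<sim> q" "q \<sim> p1" "col w = col q" for q
    proof (intro allI impI)
      fix r assume r: "v \<sim> r" "col r = col q"
      have wq: "\<not> w \<sim> q" using ne[of w q] q w vne by metis
      have wr: "\<not> w \<sim> r" using ne[of w r] q r w vne by metis
      have "\<not> r \<sim> q" using ne' q r by metis
      then show "r \<sim> p1"
        using mixed_complete[of v p1 q w r] wq wr q r p(2) w adj_sym by blast
    qed
    have "col w = col p0 \<or> col w = col p2"
      using cw c012 p(6) lt' p(1-3) by (metis less_Suc_eq less_antisym less_nat_zero_code numeral_3_eq_3 not_less_eq)
    then show ?thesis
    proof
      assume "col w = col p0"
      then show ?thesis using main[of p0] p c012 lt'[of p0] lt'[of p2] adj_sym by metis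
    next
      assume "col w = col p2"
      then show ?thesis using main[of p2] p c012 lt'[of p0] lt'[of p2] adj_sym by metis
    qed
  qed
  then obtain \<alpha> \<gamma> q where q: "\<alpha> < 3" "\<gamma> < 3" "\<alpha> \<noteq> \<gamma>" "\<alpha> \<noteq> col p1" "\<gamma> \<noteq> col p1"
      "\<And>r. v \<sim> r \<Longrightarrow> col r = \<alpha> \<Longrightarrow> r \<sim> p1" "v \<sim> q" "q \<sim> p1" "col q = \<gamma>"
    by blast
  \<comment> \<open>Since all of colour \<alpha> in N(v) sees \<open>p1\<close>, any edge coloured
    \<alpha>, \<gamma> extends through \<open>p1\<close> to the vertex \<open>q\<close> of colour
    \<gamma>.\<close>
  obtain a x where ax: "v \<sim> a" "v \<sim> x" "a \<sim> x" "col a = \<alpha>" "col x = \<gamma>"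
    using edge[OF q(1,2,3)] by blast
  define b where "b = p1"
  define y where "y = q"
  have P4: "v \<sim> x" "v \<sim> a" "v \<sim> b" "v \<sim> y" "x \<sim> a" "a \<sim> b" "b \<sim> y" "\<not> x \<sim> y"
    and col4: "col x = col y" "col a \<noteq> col b" "col x \<noteq> col a" "col x \<noteq> col b"
    using ax q p(2) ne'[of x q] adj_sym unfolding b_def y_def by auto
  have par: "\<not> x \<sim> b" "\<not> a \<sim> y"
    using h[of x b] h[of x a] h[of a b] h[of a y] h[of b y] P4 by blast+
  \<comment> \<open>Besides \<open>a\<close>, the vertex \<open>w\<close> cannot see
    \<open>b\<close> and one of \<open>x\<close>, \<open>y\<close>, for then it would see all three
    colours. If it missed \<open>x\<close>, \<open>mixed_complete\<close> on the edge
    \<open>a x\<close> would make it see \<open>y\<close>, and then on the edge \<open>y b\<close>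
    make it see \<open>x\<close>. The statement is general so that it also serves \<open>w'\<close>
    on the reversed path.\<close>
  have key: "w \<sim> x \<and> \<not> w \<sim> b"
    if P: "v \<sim> x" "v \<sim> a" "v \<sim> b" "v \<sim> y" "x \<sim> a" "a \<sim> b" "b \<sim> y"
      "\<not> x \<sim> y" "\<not> x \<sim> b" "\<not> a \<sim> y"
      and C: "col x = col y" "col a \<noteq> col b" "col x \<noteq> col a" "col x \<noteq> col b"
      and w: "w \<in> V" "w \<sim> a" "\<not> v \<sim> w" "w \<noteq> v"
    for x a b y w
  proof -
    have diff: "col w \<noteq> col z" if "w \<sim> z" "v \<sim> z" for z
      using ne[of w z] that w vne by blast
    have three: "\<not> (w \<sim> b \<and> (w \<sim> x \<or> w \<sim> y))"
      using diff[of a] diff[of b] diff[of x] diff[of y] w P C lt[OF w(1,4)] lt'[OF P(1)] lt'[OF P(2)] lt'[OF P(3)]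
      by (metis less_Suc_eq less_antisym less_nat_zero_code numeral_3_eq_3 not_less_eq)
    have "w \<sim> x"
    proof (rule ccontr)
      assume nx: "\<not> w \<sim> x"
      then have "w \<sim> y"
        using mixed_complete[of v a x w y] P w adj_sym by blast
      moreover from this have "\<not> w \<sim> b" using three by blast
      ultimately have "w \<sim> x"
        using mixed_complete[of v y b w x] P w adj_sym by blast
      then show False using nx by simp
    qed
    then show ?thesis using three by blast
  qed
  obtain w where w: "w \<in> V" "w \<sim> a" "\<not> v \<sim> w" "w \<noteq> v" using outer[OF P4(2)] by blast
  obtain w' where w': "w' \<in> V" "w' \<sim> b" "\<not> v \<sim> w'" "w' \<noteq> v" using outer[OF P4(3)] by blast
  have wx: "w \<sim> x" "\<not> w \<sim> b" using key[OF P4 par col4 w] by auto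
  have wy: "w' \<sim> y" "\<not> w' \<sim> a"
    using key[of y b a x w', OF P4(4,3,2,1)] P4(5-7)[THEN adj_sym] P4 par col4 w' adj_commute by metis+
  \<comment> \<open>Otherwise the triangle \<open>a\<close>, \<open>v\<close>, \<open>b\<close> with
    pendants \<open>w\<close>, \<open>w'\<close> is a bull.\<close>
  have ww: "w \<sim> w'"
    using no_bull[of w a v b w'] P4 w w' wx wy adj_commute by blast
  have C5: False if "a0 \<sim> a1" "a1 \<sim> a2" "a2 \<sim> a3" "a3 \<sim> a4" "a4 \<sim> a0"
    "\<not> a0 \<sim> a2" "\<not> a1 \<sim> a3" "\<not> a2 \<sim> a4" "\<not> a3 \<sim> a0" "\<not> a4 \<sim> a1" for a0 a1 a2 a3 a4
    using induced_cycle_5I[OF that] no_odd_hole[of 5] by auto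
  have "w \<sim> y"
  proof (rule ccontr)
    assume n: "\<not> w \<sim> y"
    show False
    proof (rule C5[of w w' y v a])
    qed (use n ww wx wy P4 par w w' adj_commute in blast)+
  qed
  moreover have "w' \<sim> x"
  proof (rule ccontr)
    assume n: "\<not> w' \<sim> x"
    show False
    proof (rule C5[of w' w x v b])
    qed (use n ww wx wy P4 par w w' adj_commute in blast)+
  qed
  \<comment> \<open>The diamonds \<open>v\<close>, \<open>b\<close>, \<open>y\<close>,
    \<open>w'\<close> and \<open>w'\<close>, \<open>w\<close>, \<open>x\<close>, \<open>a\<close>
    share \<open>w'\<close>, and the edge \<open>a v\<close> closes the chain.\<close>
  ultimately show False
    using no_M7[of v b y w' w x a] P4 w w' wx wy ww adj_commute by blast
qed

end

section \<open>Long odd holes\<close>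

context sgraph
begin

lemma induced_cycle_eq: "induced_cycle n c \<Longrightarrow> c i = c j \<longleftrightarrow> n dvd (i - j)"
  unfolding induced_cycle_def by blast

lemma induced_cycle_adj: "induced_cycle n c \<Longrightarrow> c i \<sim> c j \<longleftrightarrow> n dvd (i - j - 1) \<or> n dvd (i - j + 1)"
  unfolding induced_cycle_def by blast

lemma induced_cycle_shift: "induced_cycle n c \<Longrightarrow> induced_cycle n (\<lambda>j. c (i + j))"
  unfolding induced_cycle_def by simp

lemma induced_cycle_reflect: "induced_cycle n c \<Longrightarrow> induced_cycle n (\<lambda>j. c (i - j))"
proof -
  assume c: "induced_cycle n c"
  have *: "n dvd (i - x - (i - y)) \<longleftrightarrow> n dvd (x - y)"
    "n dvd (i - x - (i - y) - 1) \<longleftrightarrow> n dvd (x - y + 1)"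
    "n dvd (i - x - (i - y) + 1) \<longleftrightarrow> n dvd (x - y - 1)" for x y
  proof -
    have e: "i - x - (i - y) = - (x - y)" "i - x - (i - y) - 1 = - (x - y + 1)"
      "i - x - (i - y) + 1 = - (x - y - 1)"
      by simp_all
    show "n dvd (i - x - (i - y)) \<longleftrightarrow> n dvd (x - y)" unfolding e(1) by (rule dvd_minus_iff)
    show "n dvd (i - x - (i - y) - 1) \<longleftrightarrow> n dvd (x - y + 1)" unfolding e(2) by (rule dvd_minus_iff)
    show "n dvd (i - x - (i - y) + 1) \<longleftrightarrow> n dvd (x - y - 1)" unfolding e(3) by (rule dvd_minus_iff)
  qed
  show ?thesis
    unfolding induced_cycle_def
    by (auto simp only: induced_cycle_eq[OF c] induced_cycle_adj[OF c] *)
qed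

end

lemma dvd_small_int: "\<bar>k\<bar> < n \<Longrightarrow> n dvd k \<longleftrightarrow> k = 0" for k n :: int
  using zdvd_imp_le[of n "\<bar>k\<bar>"] by auto

context forbidden_graph
begin

text \<open>Two bulls use the triangle \<open>c 0\<close>, \<open>c 1\<close>, \<open>v\<close>,
  with pendants \<open>c (-1)\<close>, \<open>c 2\<close> and \<open>c (-1)\<close>,
  \<open>c j\<close>. The index -2 escapes the second because \<open>c (-2)\<close> sees
  \<open>c (-1)\<close>; it needs a third bull on the triangle \<open>c 1\<close>,
  \<open>c 2\<close>, \<open>v\<close>.\<close>

lemma run_of_three:
  assumes c: "induced_cycle n c" "n \<ge> 7"
    and v: "\<not> v \<sim> c (-1)" "v \<sim> c 0" "v \<sim> c 1"
  shows "v \<sim> c 2" "v \<sim> c j \<Longrightarrow> n dvd j \<or> n dvd (j - 1) \<or> n dvd (j - 2)"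
proof -
  note adj = induced_cycle_adj[OF c(1)] and eq = induced_cycle_eq[OF c(1)]
  note small = dvd_small_int[of _ n]
  show v2: "v \<sim> c 2"
    using no_bull[of "c (-1)" "c 0" v "c 1" "c 2"] v c(2)
    by (auto simp: adj small adj_commute[of _ v])
  have other: "n dvd j \<or> n dvd (j - 1) \<or> n dvd (j - 2) \<or> n dvd (j + 2)" if "v \<sim> c j" for j
  proof (rule ccontr)
    assume j: "\<not> ?thesis"
    have "\<not> n dvd (j + 1)" using eq[of j "-1"] that v(1) by auto
    then have "\<not> c (-1) \<sim> c j" "\<not> c 0 \<sim> c j" "\<not> c 1 \<sim> c j"
      using j unfolding adj_commute[of _ "c j"] adj by (auto simp: algebra_simps)
    then show False
      using no_bull[of "c (-1)" "c 0" "c 1" v "c j"] v that c(2)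
      by (auto simp: adj small adj_commute[of _ v])
  qed
  have v3: "\<not> v \<sim> c 3"
    using other[of 3] c(2) by (auto simp: small)
  show "n dvd j \<or> n dvd (j - 1) \<or> n dvd (j - 2)" if "v \<sim> c j"
  proof (rule ccontr)
    assume "\<not> ?thesis"
    then have "n dvd (j + 2)" using other[OF that] by blast
    then have "c j = c (-2)" using eq[of j "-2"] by simp
    then show False
      using no_bull[of "c 3" "c 2" "c 1" v "c (-2)"] v v2 v3 that c(2)
      by (auto simp: adj small adj_commute[of _ v])
  qed
qed

text \<open>If \<open>v\<close> saw \<open>c 4\<close>, it would be the centre of an E with legs
  through \<open>c 0\<close>, \<open>c (-1)\<close> and \<open>c 4\<close>, \<open>c 5\<close>. For
  \<open>n = 7\<close> the ends of these legs are adjacent, and \<open>v\<close> closes a pentagon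
  with \<open>c 4\<close>, \<open>c 5\<close>, \<open>c 6\<close>, \<open>c 0\<close>.\<close>

lemma run_of_one_aux:
  assumes c: "induced_cycle n c" "odd n" "n \<ge> 7" and no5: "\<And>c. \<not> induced_cycle 5 c"
    and v: "\<not> v \<sim> c (-1)" "v \<sim> c 0" "\<not> v \<sim> c 1" "v \<sim> c 2"
  shows "\<not> v \<sim> c 3" "\<not> v \<sim> c 4"
proof -
  note adj = induced_cycle_adj[OF c(1)] and eq = induced_cycle_eq[OF c(1)]
  note small = dvd_small_int[of _ n]
  show v3: "\<not> v \<sim> c 3"
    using run_of_three(2)[OF induced_cycle_shift[OF c(1), of 2] c(3), of v "-2"] v c(3)
    by (auto simp: small)
  show "\<not> v \<sim> c 4"
  proof
    assume v4: "v \<sim> c 4"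
    have v5: "\<not> v \<sim> c 5"
      using run_of_three(2)[OF induced_cycle_shift[OF c(1), of 4] c(3), of v "-4"] v v3 v4 c(3)
      by (auto simp: small)
    show False
    proof (cases "n = 7")
      case True
      have "c 6 = c (-1)" using eq[of 6 "-1"] True by simp
      then have "\<not> v \<sim> c 6" using v by simp
      then show False
        using induced_cycle_5I[of v "c 4" "c 5" "c 6" "c 0"] no5 v v4 v5 True
        by (auto simp: adj adj_commute[of _ v])
    next
      case False
      then have "n \<ge> 8" using c(3) by simp
      then show False
        using no_E[of v "c 2" "c 0" "c (-1)" "c 4" "c 5"] v v4 v5
        by (auto simp: adj small adj_commute[of _ v])
    qed
  qed
qed

text \<open>A further neighbour \<open>c j\<close> would be the short leg of an E centred at
  \<open>v\<close>. The non-neighbours this needs come from the auxiliary lemma and its reflection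
  about \<open>c 1\<close>.\<close>

lemma run_of_one:
  assumes c: "induced_cycle n c" "odd n" "n \<ge> 7" and no5: "\<And>c. \<not> induced_cycle 5 c"
    and v: "\<not> v \<sim> c (-1)" "v \<sim> c 0" "\<not> v \<sim> c 1" "v \<sim> c 2" "v \<sim> c j"
  shows "n dvd j \<or> n dvd (j - 2)"
proof (rule ccontr)
  note adj = induced_cycle_adj[OF c(1)] and eq = induced_cycle_eq[OF c(1)]
  note small = dvd_small_int[of _ n]
  assume j: "\<not> ?thesis"
  note v34 = run_of_one_aux[OF c no5 v(1-4)]
  have "\<not> v \<sim> c (-2)"
    using run_of_one_aux(2)[OF induced_cycle_reflect[OF c(1), of 2] c(2,3) no5, of v] v v34 by simp
  then have "\<not> n dvd (j + 2)" using eq[of j "-2"] v by auto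
  moreover have "\<not> n dvd (j + 1)" using eq[of j "-1"] v by auto
  moreover have "\<not> n dvd (j - 1)" using eq[of j 1] v by auto
  moreover have "\<not> n dvd (j - 3)" using eq[of j 3] v v34 by auto
  moreover have "\<not> n dvd (j - 4)" using eq[of j 4] v v34 by auto
  ultimately have "\<not> c j \<sim> c 2" "\<not> c j \<sim> c 3" "\<not> c j \<sim> c 0" "\<not> c j \<sim> c (-1)"
    using j unfolding adj by (auto simp: algebra_simps)
  then show False
    using no_E[of v "c j" "c 2" "c 3" "c 0" "c (-1)"] v v34 c(3)
    by (auto simp: adj small adj_commute[of _ v])
qed

end

section \<open>Vertices as clones of the vertices of a long hole\<close>

locale long_hole = critical_graph +
  fixes n :: int and c :: "int \<Rightarrow> 'a"
  assumes hole: "induced_cycle n c" and odd_n: "odd n" and n7: "n \<ge> 7"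
    and no5: "\<not> induced_cycle 5 c'"
begin

text \<open>Whether \<open>v\<close> sees \<open>c i\<close> is left open, so adjacent and
  nonadjacent copies of \<open>c i\<close> are covered, as is \<open>c i\<close> itself.\<close>

definition clone :: "'a \<Rightarrow> int \<Rightarrow> bool" where
  "clone v i \<longleftrightarrow> v \<sim> c (i - 1) \<and> v \<sim> c (i + 1) \<and>
     (\<forall>j. v \<sim> c j \<longrightarrow> n dvd (j - i + 1) \<or> n dvd (j - i) \<or> n dvd (j - i - 1))"

lemmas adj_c = induced_cycle_adj[OF hole]
lemmas eq_c = induced_cycle_eq[OF hole]

lemma small [simp]: "\<bar>k\<bar> < 7 \<Longrightarrow> n dvd k \<longleftrightarrow> k = 0"
  using dvd_small_int[of k n] n7 by simp

lemma abs_n [simp]: "\<bar>n\<bar> \<noteq> 1"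
  using n7 by simp

lemma clone_c: "clone (c i) i"
  unfolding clone_def adj_c by (auto simp: dvd_diff_commute[of n i] algebra_simps)

text \<open>The wheel condition provides a non-neighbour followed by a neighbour \<open>d 0\<close>.
  Either \<open>d 1\<close> is a neighbour as well and \<open>run_of_three\<close> applies, or an E
  centred at \<open>d 0\<close> with short leg \<open>v\<close> forces a neighbour at distance two
  on one of the two sides, which are mirror images.\<close>

lemma ex_clone:
  assumes "v \<sim> c k"
  shows "\<exists>i. clone v i"
proof -
  obtain z where z: "\<not> v \<sim> c z" using no_wheel[OF odd_n _ hole, of v] n7 by auto
  have "\<exists>m. \<not> v \<sim> c m \<and> v \<sim> c (m + 1)"
  proof (rule ccontr)
    assume "\<not> ?thesis"
    then have step: "v \<sim> c m" if "v \<sim> c (m + 1)" for m using that by blast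
    have "v \<sim> c (k - int t)" for t
    proof (induction t)
      case (Suc t)
      then show ?case using step[of "k - int (Suc t)"] by (simp add: algebra_simps)
    qed (use assms in simp)
    moreover have "c z = c (k - int (nat ((k - z) mod n)))"
    proof -
      have "z - (k - (k - z) mod n) = - ((k - z) - (k - z) mod n)" by simp
      then have "n dvd (z - (k - (k - z) mod n))" by (metis dvd_minus_iff dvd_minus_mod)
      then show ?thesis using n7 by (simp add: eq_c)
    qed
    ultimately show False using z by metis
  qed
  then obtain m where m: "\<not> v \<sim> c m" "v \<sim> c (m + 1)" by blast
  define d where "d j = c (m + 1 + j)" for j
  have d: "induced_cycle n d" unfolding d_def by (rule induced_cycle_shift[OF hole])
  have v0: "\<not> v \<sim> d (-1)" "v \<sim> d 0" using m by (simp_all add: d_def)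
  have dj: "c j = d (j - m - 1)" for j by (simp add: d_def)
  note adj = induced_cycle_adj[OF d]
  show ?thesis
  proof (cases "v \<sim> d 1")
    case True
    have "v \<sim> d 2" using run_of_three(1)[OF d n7 v0 True] .
    moreover have "n dvd (j - (m + 2) + 1) \<or> n dvd (j - (m + 2)) \<or> n dvd (j - (m + 2) - 1)"
      if "v \<sim> c j" for j
      using run_of_three(2)[OF d n7 v0 True, of "j - m - 1"] that by (simp add: dj algebra_simps)
    ultimately have "clone v (m + 2)" using v0 unfolding clone_def dj by simp
    then show ?thesis by blast
  next
    case False
    have "v \<sim> d 2 \<or> v \<sim> d (-2)"
      using no_E[of "d 0" v "d 1" "d 2" "d (-1)" "d (-2)"] v0 False n7
      by (auto simp: adj adj_commute[of _ v])
    then show ?thesis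
    proof
      assume v2: "v \<sim> d 2"
      have "n dvd (j - (m + 2) + 1) \<or> n dvd (j - (m + 2) - 1)" if "v \<sim> c j" for j
        using run_of_one[OF d odd_n n7 no5 v0 False v2, of "j - m - 1"] that by (simp add: dj algebra_simps)
      then have "clone v (m + 2)" using v0 v2 unfolding clone_def dj by auto
      then show ?thesis by blast
    next
      assume v2: "v \<sim> d (-2)"
      have "n dvd (j - m + 1) \<or> n dvd (j - m - 1)" if "v \<sim> c j" for j
      proof -
        have "n dvd (- (j - m - 1)) \<or> n dvd (- (j - m - 1) - 2)"
          using run_of_one[OF induced_cycle_reflect[OF d, of 0] odd_n n7 no5, of v "- (j - m - 1)"] v0 False v2 that
          by (simp add: dj)
        moreover have "- (j - m - 1) - 2 = - (j - m + 1)" by simp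
        ultimately show ?thesis by (metis dvd_minus_iff)
      qed
      then have "clone v m" using v0 v2 unfolding clone_def dj by auto
      then show ?thesis by blast
    qed
  qed
qed

lemma clone_near: "clone v i \<Longrightarrow> j = i + 1 \<or> j = i - 1 \<Longrightarrow> v \<sim> c j"
  unfolding clone_def by auto

lemma clone_far:
  assumes "clone v i" "1 < \<bar>j - i\<bar>" "\<bar>j - i\<bar> < 6"
  shows "\<not> v \<sim> c j"
proof -
  have "\<not> n dvd (j - i + 1)" "\<not> n dvd (j - i)" "\<not> n dvd (j - i - 1)"
    using assms(2,3) by (subst small; linarith)+
  then show ?thesis using assms(1) unfolding clone_def by blast
qed

text \<open>A vertex that sees the hole is a clone, so an edge leaving the set of clones ends in a
  vertex \<open>y\<close> that misses the hole. It is the short leg of an E centred at the clone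
  \<open>x\<close>.\<close>

lemma all_clone:
  assumes "v \<in> V"
  shows "\<exists>i. clone v i"
proof -
  define Z where "Z = {v \<in> V. \<exists>i. clone v i}"
  have "Z = V"
  proof (rule ccontr)
    assume "Z \<noteq> V"
    moreover have "c 0 \<in> Z" using adj_V[of "c 0" "c 1"] clone_c[of 0] by (auto simp: adj_c Z_def)
    moreover have "Z \<subseteq> V" by (auto simp: Z_def)
    ultimately obtain x y where xy: "x \<in> Z" "y \<in> V - Z" "x \<sim> y"
      using edge_leaving[of Z] by blast
    then obtain i where i: "clone x i" by (auto simp: Z_def)
    have y: "\<not> y \<sim> c k" for k using ex_clone xy by (auto simp: Z_def)
    show False
      using no_E[of x y "c (i + 1)" "c (i + 2)" "c (i - 1)" "c (i - 2)"]
        clone_near[OF i, of "i + 1"] clone_near[OF i, of "i - 1"]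
        clone_far[OF i, of "i + 2"] clone_far[OF i, of "i - 2"] xy y
      by (auto simp: adj_c)
  qed
  then show ?thesis using assms by (auto simp: Z_def)
qed

lemma clone_cong: "clone v i \<Longrightarrow> n dvd (i - j) \<Longrightarrow> clone v j"
proof -
  assume v: "clone v i" and dv: "n dvd (i - j)"
  have "c (i - 1) = c (j - 1)" "c (i + 1) = c (j + 1)" using dv by (simp_all add: eq_c)
  moreover have "n dvd (k - i + e) \<longleftrightarrow> n dvd (k - j + e)" for k e
    using dv dvd_add_right_iff[OF dv, of "k - i + e"] by (simp add: algebra_simps)
  note this[of _ 1] this[of _ 0] this[of _ "-1"]
  ultimately show ?thesis using v unfolding clone_def by simp
qed

lemma clone_unique: "clone v i \<Longrightarrow> clone v j \<Longrightarrow> n dvd (i - j)"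
proof (rule ccontr)
  assume v: "clone v i" "clone v j" and nd: "\<not> n dvd (i - j)"
  have "n dvd (i - j + 2) \<or> n dvd (i - j + 1)"
  proof -
    have "n dvd (i + 1 - j + 1) \<or> n dvd (i + 1 - j) \<or> n dvd (i + 1 - j - 1)"
      using v unfolding clone_def by blast
    moreover have "i + 1 - j + 1 = i - j + 2" "i + 1 - j = i - j + 1" "i + 1 - j - 1 = i - j" by auto
    ultimately show ?thesis using nd by metis
  qed
  moreover have "n dvd (i - j - 2) \<or> n dvd (i - j - 1)"
  proof -
    have "n dvd (i - 1 - j + 1) \<or> n dvd (i - 1 - j) \<or> n dvd (i - 1 - j - 1)"
      using v unfolding clone_def by blast
    moreover have "i - 1 - j + 1 = i - j" "i - 1 - j = i - j - 1" "i - 1 - j - 1 = i - j - 2" by auto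
    ultimately show ?thesis using nd by metis
  qed
  ultimately have "n dvd 4 \<or> n dvd 3 \<or> n dvd 2"
    by (elim disjE) (drule (1) dvd_diff, simp)+
  then show False by simp
qed

text \<open>If \<open>u\<close> sees \<open>c (i + 1)\<close>, nonadjacency gives a bull with
  triangle \<open>c (i + 1)\<close>, \<open>u\<close>, \<open>c (i + 2)\<close>; otherwise it gives
  an E centred at \<open>c (i + 2)\<close>.\<close>

lemma adj_consecutive:
  assumes v: "clone v i" and u: "clone u j" and ij: "n dvd (j - i - 1)"
  shows "v \<sim> u"
proof (rule ccontr)
  assume nvu: "\<not> v \<sim> u"
  have u: "clone u (i + 1)" using clone_cong[OF u, of "i + 1"] ij by (simp add: algebra_simps)
  have A: "v \<sim> c (i + 1)" "u \<sim> c (i + 2)" "\<not> v \<sim> c (i + 2)" "\<not> v \<sim> c (i + 3)" "\<not> v \<sim> c (i + 4)"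
    "\<not> u \<sim> c (i + 3)" "\<not> u \<sim> c (i + 4)"
    by (rule clone_near[OF v] clone_near[OF u] clone_far[OF v] clone_far[OF u]; simp; fail)+
  show False
  proof (cases "u \<sim> c (i + 1)")
    case True
    then show False
      using no_bull[of v "c (i + 1)" u "c (i + 2)" "c (i + 3)"] A nvu
      by (auto simp: adj_c adj_commute[of "c k" v for k] adj_commute[of "c k" u for k] adj_commute[of u v])
  next
    case False
    then show False
      using no_E[of "c (i + 2)" u "c (i + 1)" v "c (i + 3)" "c (i + 4)"] A nvu
      by (auto simp: adj_c adj_commute[of "c k" v for k] adj_commute[of "c k" u for k] adj_commute[of u v])
  qed
qed

text \<open>At distance two an edge gives a bull; at distance three it gives an E centred at
  \<open>u\<close>, or a pentagon when \<open>n = 7\<close>. At larger distance \<open>u\<close>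
  misses \<open>c (i - 2)\<close> to \<open>c (i + 2)\<close> apart from possibly
  \<open>c i\<close>, and is the short leg of an E centred at \<open>v\<close>.\<close>

lemma non_adj_far:
  assumes v: "clone v i" and u: "clone u j" and ij: "\<not> n dvd (j - i - 1)" "\<not> n dvd (j - i)" "\<not> n dvd (j - i + 1)"
  shows "\<not> v \<sim> u"
proof
  assume vu: "v \<sim> u"
  have two: False if v: "clone v i" and u: "clone u (i + 2)" and vu: "v \<sim> u" for v u i
  proof -
    have "v \<sim> c (i - 1)" "v \<sim> c (i + 1)" "u \<sim> c (i + 1)" "u \<sim> c (i + 3)"
      "\<not> v \<sim> c (i + 3)" "\<not> u \<sim> c (i - 1)"
      by (rule clone_near[OF v] clone_near[OF u] clone_far[OF v] clone_far[OF u]; simp; fail)+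
    then show False
      using no_bull[of "c (i - 1)" v "c (i + 1)" u "c (i + 3)"] vu
      by (auto simp: adj_c adj_commute[of "c k" v for k] adj_commute[of "c k" u for k] adj_commute[of u v])
  qed
  have three: False if v: "clone v i" and u: "clone u (i + 3)" and vu: "v \<sim> u" for v u i
  proof -
    have A: "v \<sim> c (i - 1)" "v \<sim> c (i + 1)" "u \<sim> c (i + 2)" "u \<sim> c (i + 4)"
      "\<not> v \<sim> c (i + 2)" "\<not> v \<sim> c (i + 4)" "\<not> v \<sim> c (i + 5)" "\<not> u \<sim> c (i - 1)" "\<not> u \<sim> c (i + 5)"
      by (rule clone_near[OF v] clone_near[OF u] clone_far[OF v] clone_far[OF u]; simp; fail)+
    show False
    proof (cases "n = 7")
      case True
      have "c (i + 6) = c (i - 1)" unfolding eq_c using True by simp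
      then have "v \<sim> c (i + 6)" "\<not> u \<sim> c (i + 6)" using A by auto
      then show False
        using induced_cycle_5I[of v u "c (i + 4)" "c (i + 5)" "c (i + 6)"] no5 A vu
        by (auto simp: adj_c adj_commute[of "c k" v for k] adj_commute[of "c k" u for k] adj_commute[of u v])
    next
      case False
      then have "n \<ge> 8" using n7 by simp
      then show False
        using no_E[of u "c (i + 2)" v "c (i - 1)" "c (i + 4)" "c (i + 5)"] A vu
        by (auto simp: adj_c dvd_small_int adj_commute[of "c k" v for k] adj_commute[of "c k" u for k] adj_commute[of u v])
    qed
  qed
  define e where "e = j - i"
  have nd: "\<not> n dvd e - 2" "\<not> n dvd e - 3" "\<not> n dvd e + 2" "\<not> n dvd e + 3"
  proof -
    show "\<not> n dvd e - 2"
    proof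
      assume "n dvd e - 2"
      then have "clone u (i + 2)" using clone_cong[OF u, of "i + 2"] by (simp add: e_def diff_diff_eq)
      then show False using two[OF v _ vu] by blast
    qed
    show "\<not> n dvd e - 3"
    proof
      assume "n dvd e - 3"
      then have "clone u (i + 3)" using clone_cong[OF u, of "i + 3"] by (simp add: e_def diff_diff_eq)
      then show False using three[OF v _ vu] by blast
    qed
    show "\<not> n dvd e + 2"
    proof
      assume "n dvd e + 2"
      then have "n dvd i - (j + 2)" unfolding e_def by (subst dvd_minus_iff[symmetric]) (simp add: algebra_simps)
      then have "clone v (j + 2)" using clone_cong[OF v, of "j + 2"] by simp
      then show False using two[OF u _ adj_sym[OF vu]] by blast
    qed
    show "\<not> n dvd e + 3"
    proof
      assume "n dvd e + 3"
      then have "n dvd i - (j + 3)" unfolding e_def by (subst dvd_minus_iff[symmetric]) (simp add: algebra_simps)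
      then have "clone v (j + 3)" using clone_cong[OF v, of "j + 3"] by simp
      then show False using three[OF u _ adj_sym[OF vu]] by blast
    qed
  qed
  have ufar: "\<not> u \<sim> c (i + k)" if "\<not> n dvd (e - k - 1)" "\<not> n dvd (e - k)" "\<not> n dvd (e - k + 1)" for k
  proof -
    have "i + k - j + 1 = - (e - k - 1)" "i + k - j = - (e - k)" "i + k - j - 1 = - (e - k + 1)"
      by (simp_all add: e_def)
    then show ?thesis using u that unfolding clone_def by (metis dvd_minus_iff)
  qed
  have "\<not> u \<sim> c (i + 1)" "\<not> u \<sim> c (i + 2)" "\<not> u \<sim> c (i + (-1))" "\<not> u \<sim> c (i + (-2))"
    using ufar[of 1] ufar[of 2] ufar[of "-1"] ufar[of "-2"] nd ij
    unfolding e_def[symmetric] by (simp_all add: add.commute)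
  moreover have "v \<sim> c (i + 1)" "v \<sim> c (i - 1)" "\<not> v \<sim> c (i + 2)" "\<not> v \<sim> c (i - 2)"
    by (rule clone_near[OF v] clone_far[OF v]; simp; fail)+
  ultimately show False
    using no_E[of v u "c (i + 1)" "c (i + 2)" "c (i - 1)" "c (i - 2)"] vu
    by (auto simp: adj_c)
qed

section \<open>Clone classes that contain an edge\<close>

definition doubled :: "int \<Rightarrow> bool" where
  "doubled i \<longleftrightarrow> (\<exists>u v. clone u i \<and> clone v i \<and> u \<sim> v)"

lemma doubled_cong: "n dvd (i - j) \<Longrightarrow> doubled i \<longleftrightarrow> doubled j"
  unfolding doubled_def using clone_cong dvd_diff_commute[of n i j] by blast

lemma not_doubled_consecutive: "doubled i \<Longrightarrow> \<not> doubled (i + 1)"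
proof
  assume "doubled i" "doubled (i + 1)"
  then obtain u v x y where "clone u i" "clone v i" "u \<sim> v"
    "clone x (i + 1)" "clone y (i + 1)" "x \<sim> y"
    unfolding doubled_def by blast
  then show False using no_K4[of u v x y] adj_consecutive[of _ i _ "i + 1"] by simp
qed

text \<open>Single and doubled classes cannot alternate around an odd cycle. The pair found is where
  the cycle is cut open.\<close>

lemma ex_single_pair: "\<exists>i. \<not> doubled i \<and> \<not> doubled (i + 1)"
proof (rule ccontr)
  assume "\<not> ?thesis"
  then have alt: "doubled (i + 1) \<longleftrightarrow> \<not> doubled i" for i
    using not_doubled_consecutive by blast
  have "doubled (int k) \<longleftrightarrow> (doubled 0 \<longleftrightarrow> even k)" for k
  proof (induction k)
    case (Suc k)
    then show ?case using alt[of "int k"] by (simp add: add.commute)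
  qed simp
  from this[of "nat n"] have "doubled n \<longleftrightarrow> \<not> doubled 0"
    using odd_n n7 by (simp add: even_nat_iff)
  then show False using doubled_cong[of n 0] by simp
qed

end

text \<open>\<open>t k\<close> counts the pairs of consecutive single classes up to \<open>k\<close>. Single classes around a
  doubled one get the same colour, so the colour may change only where \<open>t\<close> does: it follows the
  parity of \<open>t\<close>, with the third colour at the end. If \<open>t\<close> never changes, single and doubled
  classes alternate, which is a spindle.\<close>

locale cut_hole = long_hole +
  assumes cut: "\<not> doubled (-1)" "\<not> doubled 0"
begin

primrec t :: "nat \<Rightarrow> nat" where
  "t 0 = 0"
| "t (Suc k) = (if \<not> doubled (int k) \<and> \<not> doubled (int k + 1) then Suc (t k) else t k)"

text \<open>A step between two single classes raises both \<open>t\<close> and \<open>k\<close>.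
  Every other step raises only \<open>k\<close> and, as doubled classes are never consecutive,
  switches between single and doubled.\<close>

lemma t_parity: "even (t k + k) \<longleftrightarrow> \<not> doubled (int k)"
proof (induction k)
  case 0
  then show ?case using cut by simp
next
  case (Suc k)
  then show ?case using not_doubled_consecutive[of "int k"] by (auto simp: add.commute)
qed

lemma t_mono: "i \<le> j \<Longrightarrow> t i \<le> t j"
  by (rule lift_Suc_mono_le[of t]) auto

definition m :: nat where "m = nat n - 1"

lemma m: "int m = n - 1" "even m" "m \<ge> 6"
  using n7 odd_n by (auto simp: m_def even_nat_iff)

lemma not_doubled_m: "\<not> doubled (int m)"
  using doubled_cong[of "-1" "int m"] cut m by simp

lemma t_m_pos: "t m \<noteq> 0"
proof
  assume "t m = 0"
  then have "t k = 0" if "k \<le> m" for k using t_mono[OF that] by simp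
  then have alt: "doubled (int k) \<longleftrightarrow> odd k" if "k \<le> m" for k
    using t_parity[of k] that by simp
  obtain p where p: "m = 2 * p" using m by blast
  have "\<exists>u v. clone u (int (2 * i + 1)) \<and> clone v (int (2 * i + 1)) \<and> u \<sim> v" if "i < p" for i
    using alt[of "2 * i + 1"] that p unfolding doubled_def by simp
  then obtain x y where xy: "\<And>i. i < p \<Longrightarrow> clone (x i) (int (2 * i + 1))"
    "\<And>i. i < p \<Longrightarrow> clone (y i) (int (2 * i + 1))" "\<And>i. i < p \<Longrightarrow> x i \<sim> y i"
    by metis
  \<comment> \<open>The diamonds of the spindle have the even hole vertices as ends and the edges
    \<open>x i\<close>, \<open>y i\<close> of the odd classes as middle edges; the ends of the
    chain, \<open>c 0\<close> and \<open>c (n - 1)\<close>, are adjacent.\<close>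
  define u where "u k = (if k mod 3 = 0 then c (int (2 * (k div 3)))
      else if k mod 3 = 1 then x (k div 3) else y (k div 3))" for k
  have u: "u (3 * i) = c (int (2 * i))" "u (3 * i + 1) = x i" "u (3 * i + 2) = y i"
    "u (3 * i + 3) = c (int (2 * i + 2))" for i
  proof -
    have d: "(3 * i) div 3 = i" "(3 * i) mod 3 = 0" "(3 * i + 1) div 3 = i" "(3 * i + 1) mod 3 = 1"
      "(3 * i + 2) div 3 = i" "(3 * i + 2) mod 3 = 2" "(3 * i + 3) div 3 = i + 1" "(3 * i + 3) mod 3 = 0"
      by presburger+
    then show "u (3 * i) = c (int (2 * i))" "u (3 * i + 1) = x i" "u (3 * i + 2) = y i"
      "u (3 * i + 3) = c (int (2 * i + 2))"
      unfolding u_def d by simp_all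
  qed
  \<comment> \<open>The position on the hole of which \<open>u k\<close> is a clone; it separates
    all vertices except the two in one middle edge.\<close>
  define q where "q k = 2 * (k div 3) + (if k mod 3 = 0 then 0 else 1)" for k :: nat
  have at: "clone (u k) (int (q k))" "q k \<le> m" if "k \<le> 3 * p" for k
  proof -
    have "k mod 3 \<noteq> 0 \<Longrightarrow> k div 3 < p" "k div 3 \<le> p" using that by presburger+
    then show "clone (u k) (int (q k))" "q k \<le> m"
      unfolding u_def q_def using xy clone_c p by (auto simp: add.commute)
  qed
  have adj1: "c (int (2 * i)) \<sim> x i" "c (int (2 * i)) \<sim> y i" "x i \<sim> c (int (2 * i + 2))"
    "y i \<sim> c (int (2 * i + 2))" if "i < p" for i
    using xy[OF that] clone_near adj_sym by simp_all
  have "inj_on u {..3 * p}"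
  proof (rule inj_onI)
    fix j k assume jk: "j \<in> {..3 * p}" "k \<in> {..3 * p}" "u j = u k"
    have "n dvd (int (q j) - int (q k))"
      using at[of j] at[of k] jk clone_unique by auto
    moreover have "\<bar>int (q j) - int (q k)\<bar> < n" using at(2)[of j] at(2)[of k] jk m by auto
    ultimately have "q j = q k" using dvd_small_int by force
    moreover have "q l div 2 = l div 3" "q l mod 2 = (if l mod 3 = 0 then 0 else 1)" for l
      unfolding q_def by auto
    ultimately have div: "j div 3 = k div 3" "j mod 3 = 0 \<longleftrightarrow> k mod 3 = 0"
      by (metis, metis zero_neq_one)
    have "j mod 3 = k mod 3"
    proof (rule ccontr)
      assume ne: "j mod 3 \<noteq> k mod 3"
      have "j mod 3 \<noteq> 0" "k mod 3 \<noteq> 0" using ne div(2) by metis+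
      moreover have "j \<le> 3 * p" using jk by auto
      ultimately have "j div 3 < p" by presburger
      then have "x (j div 3) \<noteq> y (j div 3)" by (rule adj_neq[OF xy(3)])
      moreover have "j mod 3 = 1 \<and> k mod 3 = 2 \<or> j mod 3 = 2 \<and> k mod 3 = 1"
        using ne \<open>j mod 3 \<noteq> 0\<close> \<open>k mod 3 \<noteq> 0\<close> by presburger
      ultimately show False using jk(3) div(1) unfolding u_def by (elim disjE conjE) simp_all
    qed
    then show "j = k" using div by (metis div_mult_mod_eq)
  qed
  then show False
  proof (rule no_spindle[rotated])
    show "1 \<le> p" using p m by simp
    show "u k \<sim> u (k + 1)" if "k < 3 * p" for k
    proof -
      define i where "i = k div 3"
      have i: "i < p" using that by (simp add: i_def less_mult_imp_div_less mult.commute)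
      have "k = 3 * i \<or> k = 3 * i + 1 \<or> k = 3 * i + 2" unfolding i_def by presburger
      then show ?thesis
      proof (elim disjE)
        assume k: "k = 3 * i" show ?thesis unfolding k u using adj1 i by simp
      next
        assume k: "k = 3 * i + 1"
        have "k + 1 = 3 * i + 2" using k by simp
        then show ?thesis using k u xy(3)[OF i] by metis
      next
        assume k: "k = 3 * i + 2"
        have "k + 1 = 3 * i + 3" using k by simp
        then show ?thesis using k u adj1[OF i] by metis
      qed
    qed
    show "u (3 * p) \<sim> u 0"
      using u(1)[of p] u(1)[of 0] p m by (simp add: adj_c)
    show "u (3 * i) \<sim> u (3 * i + 2)" if "i < p" for i
      using adj1[OF that] by (simp only: u)
    show "u (3 * i + 1) \<sim> u (3 * i + 3)" if "i < p" for i
      using adj1[OF that] by (simp only: u)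
  qed
qed

lemma contradiction: False
proof -
  have "\<exists>k. clone v (int k) \<and> k \<le> m" if v: "v \<in> V" for v
  proof -
    obtain i where i: "clone v i" using all_clone[OF v] by blast
    have "clone v (i mod n)" using clone_cong[OF i, of "i mod n"] by simp
    moreover have "i mod n = int (nat (i mod n))" "nat (i mod n) \<le> m" using n7 m
      by (auto simp: nat_le_iff)
    ultimately show ?thesis by metis
  qed
  then obtain pos where pos: "\<And>v. v \<in> V \<Longrightarrow> clone v (int (pos v))" "\<And>v. v \<in> V \<Longrightarrow> pos v \<le> m"
    by metis
  \<comment> \<open>All clones of \<open>c i\<close> lie in the neighbourhood of
    \<open>c (i + 1)\<close>, so each class is bipartite.\<close>
  have "\<exists>h :: 'a \<Rightarrow> bool. \<forall>x y. clone x i \<longrightarrow> clone y i \<longrightarrow> x \<sim> y \<longrightarrow> h x \<noteq> h y" for i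
  proof -
    obtain h :: "'a \<Rightarrow> bool" where h: "\<And>x y. \<lbrakk>c (i + 1) \<sim> x; c (i + 1) \<sim> y; x \<sim> y\<rbrakk> \<Longrightarrow> h x \<noteq> h y"
      using bipartite_nbh[of "c (i + 1)"] by blast
    have "c (i + 1) \<sim> x" if "clone x i" for x
      using adj_sym[OF clone_near[OF that, of "i + 1"]] by simp
    then show ?thesis using h by (intro exI[of _ h]) blast
  qed
  then obtain h :: "int \<Rightarrow> 'a \<Rightarrow> bool"
    where h: "\<And>i x y. clone x i \<Longrightarrow> clone y i \<Longrightarrow> x \<sim> y \<Longrightarrow> h i x \<noteq> h i y"
    by metis
  \<comment> \<open>A doubled class uses the two colours other than \<open>b k\<close>. Across the
    cut, position \<open>m\<close> has base colour 2 and position 0 has base colour 0, because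
    \<open>t m\<close> is not 0.\<close>
  define b where "b k = (if t k = t m then 2 else t k mod 2)" for k
  define col where "col v = (let k = pos v in if doubled (int k)
      then (b k + (if h (int k) v then 1 else 2)) mod 3 else b k)" for v
  have b3: "b k < 3" for k unfolding b_def by (auto intro: less_trans[of _ 2])
  have eq3: "(b k + 1) mod 3 \<noteq> b k" "(b k + 2) mod 3 \<noteq> b k" "(b k + 1) mod 3 \<noteq> (b k + 2) mod 3" for k
    using b3[of k] by presburger+
  have up: "col u \<noteq> col v" if uv: "u \<in> V" "v \<in> V" "u \<sim> v" "pos v = pos u + 1" for u v
  proof -
    define k where "k = pos u"
    have k: "k < m" "pos u = k" "pos v = Suc k" using pos(2)[OF uv(2)] uv by (auto simp: k_def)
    have "t k \<le> t m" "t (Suc k) \<le> t m" by (rule t_mono, use k in simp)+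
    then have ne: "b (Suc k) \<noteq> b k" if "t (Suc k) = Suc (t k)"
      using that by (auto simp: b_def mod_Suc split: if_splits)
    have eq: "b (Suc k) = b k" if "t (Suc k) = t k" using that by (simp add: b_def)
    have colu: "col u = (if doubled (int k) then (b k + (if h (int k) u then 1 else 2)) mod 3 else b k)"
      and colv: "col v = (if doubled (int k + 1)
        then (b (Suc k) + (if h (int k + 1) v then 1 else 2)) mod 3 else b (Suc k))"
      unfolding col_def k Let_def by (simp_all add: add.commute)
    consider "doubled (int k)" "\<not> doubled (int k + 1)" | "\<not> doubled (int k)" "doubled (int k + 1)"
      | "\<not> doubled (int k)" "\<not> doubled (int k + 1)"
      using not_doubled_consecutive by blast
    then show ?thesis
    proof cases
      case 1
      then have "b (Suc k) = b k" by (intro eq) simp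
      then show ?thesis using 1 eq3[of k] by (simp add: colu colv)
    next
      case 2
      then have "b (Suc k) = b k" by (intro eq) simp
      then show ?thesis using 2 eq3[THEN not_sym, of k] by (simp add: colu colv)
    next
      case 3
      then have "b (Suc k) \<noteq> b k" by (intro ne) simp
      then show ?thesis using 3 by (simp add: colu colv)
    qed
  qed
  have wrap: "col u \<noteq> col v" if "pos u = m" "pos v = 0" for u v
    using that cut not_doubled_m t_m_pos by (simp add: col_def b_def)
  have proper: "col u \<noteq> col v" if uv: "u \<in> V" "v \<in> V" "u \<sim> v" "pos u \<le> pos v" for u v
  proof -
    have "n dvd (int (pos v) - int (pos u) - 1) \<or> n dvd (int (pos v) - int (pos u)) \<or>
        n dvd (int (pos v) - int (pos u) + 1)"
      using non_adj_far[OF pos(1)[OF uv(1)] pos(1)[OF uv(2)]] uv by blast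
    moreover have "pos v \<le> m" using pos(2) uv by simp
    ultimately consider "pos v = pos u" | "pos v = pos u + 1" | "pos v = m" "pos u = 0"
    proof -
      define d where "d = int (pos v) - int (pos u)"
      have d: "0 \<le> d" "d \<le> n - 1" using uv \<open>pos v \<le> m\<close> m by (auto simp: d_def)
      assume "n dvd (int (pos v) - int (pos u) - 1) \<or> n dvd (int (pos v) - int (pos u)) \<or>
        n dvd (int (pos v) - int (pos u) + 1)"
      then have "d = 1 \<or> d = 0 \<or> d + 1 = n"
        unfolding d_def[symmetric] using d dvd_small_int[of "d - 1" n] dvd_small_int[of d n]
          zdvd_imp_le[of n "d + 1"] by auto
      then show thesis
      proof (elim disjE)
        assume "d = 1" then show thesis by (intro that(2)) (simp add: d_def)
      next
        assume "d = 0" then show thesis by (intro that(1)) (simp add: d_def)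
      next
        assume "d + 1 = n"
        then have "int (pos v) - int (pos u) = int m" using m(1) by (simp add: d_def)
        then show thesis using \<open>pos v \<le> m\<close> by (intro that(3)) linarith+
      qed
    qed
    then show ?thesis
    proof cases
      case 1
      then have "h (int (pos u)) u \<noteq> h (int (pos u)) v" "doubled (int (pos u))"
        using h pos(1) uv unfolding doubled_def by metis+
      then show ?thesis using 1 eq3[of "pos u"] by (auto simp: col_def)
    next
      case 2
      then show ?thesis using up uv by blast
    next
      case 3
      then show ?thesis using wrap[of v u] by simp
    qed
  qed
  have "col u \<noteq> col v" if "u \<in> V" "v \<in> V" "u \<sim> v" for u v
    using proper[OF that] proper[OF that(2,1) adj_sym[OF that(3)]] by (cases "pos u \<le> pos v") auto
  moreover have "col v < 3" for v using b3 by (simp add: col_def Let_def)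
  ultimately show False using not_colourable unfolding colourable_on_def by blast
qed

end

context long_hole
begin

lemma contradiction: False
proof -
  obtain i where i: "\<not> doubled i" "\<not> doubled (i + 1)" using ex_single_pair by blast
  \<comment> \<open>Rotates the pair of single classes to the positions -1 and 0.\<close>
  define d where "d j = c (i + 1 + j)" for j
  interpret d: long_hole V adj n d
    by unfold_locales
      (use induced_cycle_shift[OF hole, of "i + 1"] odd_n n7 no5 in \<open>auto simp: d_def[abs_def]\<close>)
  have cl: "d.clone v j \<longleftrightarrow> clone v (i + 1 + j)" for v j
  proof -
    have "(\<forall>k. v \<sim> d k \<longrightarrow> P (k - j)) \<longleftrightarrow> (\<forall>k. v \<sim> c k \<longrightarrow> P (k - (i + 1 + j)))" for P
    proof (intro iffI allI impI)
      fix k assume "\<forall>k. v \<sim> d k \<longrightarrow> P (k - j)" "v \<sim> c k"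
      from this(1)[rule_format, of "k - i - 1"] this(2) show "P (k - (i + 1 + j))"
        by (simp add: d_def algebra_simps)
    next
      fix k assume "\<forall>k. v \<sim> c k \<longrightarrow> P (k - (i + 1 + j))" "v \<sim> d k"
      from this(1)[rule_format, of "i + 1 + k"] this(2) show "P (k - j)"
        by (simp add: d_def algebra_simps)
    qed
    from this[of "\<lambda>e. n dvd (e + 1) \<or> n dvd e \<or> n dvd (e - 1)"] show ?thesis
      unfolding d.clone_def clone_def by (simp add: d_def algebra_simps)
  qed
  have "cut_hole V adj n d"
    by unfold_locales (use i in \<open>simp_all add: d.doubled_def doubled_def cl\<close>)
  then show False by (rule cut_hole.contradiction)
qed

end

section \<open>Pentagons\<close>

context sgraph
begin

definition anti :: "'a set \<Rightarrow> 'a set \<Rightarrow> bool" where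
  "anti S T \<longleftrightarrow> (\<forall>x \<in> S. \<forall>y \<in> T. \<not> x \<sim> y)"

lemma antiI: "(\<And>x y. x \<in> S \<Longrightarrow> y \<in> T \<Longrightarrow> x \<sim> y \<Longrightarrow> False) \<Longrightarrow> anti S T"
  unfolding anti_def by blast

lemma anti_sym: "anti S T \<Longrightarrow> anti T S"
  unfolding anti_def using adj_sym by blast

lemma anti_Un: "anti (S \<union> T) U \<longleftrightarrow> anti S U \<and> anti T U" "anti U (S \<union> T) \<longleftrightarrow> anti U S \<and> anti U T"
  unfolding anti_def by blast+

lemma anti_mono: "anti S T \<Longrightarrow> S' \<subseteq> S \<Longrightarrow> T' \<subseteq> T \<Longrightarrow> anti S' T'"
  unfolding anti_def by blast

lemma colourable_3I:
  assumes "V \<subseteq> S0 \<union> S1 \<union> S2" "anti S0 S0" "anti S1 S1" "anti S2 S2"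
  shows "colourable_on 3 V"
proof -
  define col where "col v = (if v \<in> S0 then 0 else if v \<in> S1 then 1 else 2 :: nat)" for v
  have "col x \<noteq> col y" if "x \<in> V" "y \<in> V" "x \<sim> y" for x y
    using that assms(2-4) subsetD[OF assms(1) that(1)] subsetD[OF assms(1) that(2)]
    unfolding col_def anti_def by (auto split: if_splits)
  moreover have "col x < 3" for x by (simp add: col_def)
  ultimately show ?thesis unfolding colourable_on_def by blast
qed

end

locale pentagon = forbidden_graph +
  fixes c :: "int \<Rightarrow> 'a"
  assumes cycle: "induced_cycle 5 c"
begin

text \<open>One neighbour on the pentagon, two at distance two (as for \<open>c i\<close>), three or four.\<close>

definition A :: "int \<Rightarrow> 'a set" where "A i = {v. \<forall>j. v \<sim> c j \<longleftrightarrow> 5 dvd (j - i)}"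
definition B :: "int \<Rightarrow> 'a set" where
  "B i = {v. \<forall>j. v \<sim> c j \<longleftrightarrow> 5 dvd (j - i - 1) \<or> 5 dvd (j - i + 1)}"
definition D :: "int \<Rightarrow> 'a set" where
  "D i = {v. \<forall>j. v \<sim> c j \<longleftrightarrow> 5 dvd (j - i) \<or> 5 dvd (j - i - 1) \<or> 5 dvd (j - i + 1)}"
definition F :: "int \<Rightarrow> 'a set" where "F i = {v. \<forall>j. v \<sim> c j \<longleftrightarrow> \<not> 5 dvd (j - i)}"

lemmas adj_c = induced_cycle_adj[OF cycle]
lemmas eq_c = induced_cycle_eq[OF cycle]

lemma A_adj: "v \<in> A i \<Longrightarrow> v \<sim> c j \<longleftrightarrow> 5 dvd (j - i)" "v \<in> A i \<Longrightarrow> c j \<sim> v \<longleftrightarrow> 5 dvd (j - i)"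
  by (simp_all add: A_def adj_commute[of "c j"])

lemma B_adj: "v \<in> B i \<Longrightarrow> v \<sim> c j \<longleftrightarrow> 5 dvd (j - i - 1) \<or> 5 dvd (j - i + 1)"
  "v \<in> B i \<Longrightarrow> c j \<sim> v \<longleftrightarrow> 5 dvd (j - i - 1) \<or> 5 dvd (j - i + 1)"
  by (simp_all add: B_def adj_commute[of "c j"])

lemma D_adj: "v \<in> D i \<Longrightarrow> v \<sim> c j \<longleftrightarrow> 5 dvd (j - i) \<or> 5 dvd (j - i - 1) \<or> 5 dvd (j - i + 1)"
  "v \<in> D i \<Longrightarrow> c j \<sim> v \<longleftrightarrow> 5 dvd (j - i) \<or> 5 dvd (j - i - 1) \<or> 5 dvd (j - i + 1)"
  by (simp_all add: D_def adj_commute[of "c j"])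

lemma F_adj: "v \<in> F i \<Longrightarrow> v \<sim> c j \<longleftrightarrow> \<not> 5 dvd (j - i)" "v \<in> F i \<Longrightarrow> c j \<sim> v \<longleftrightarrow> \<not> 5 dvd (j - i)"
  by (simp_all add: F_def adj_commute[of "c j"])

lemma periodic: "5 dvd (i - k) \<Longrightarrow> A i = A k \<and> B i = B k \<and> D i = D k \<and> F i = F k"
proof -
  assume ik: "5 dvd (i - k)"
  have "5 dvd (j - i + e) \<longleftrightarrow> 5 dvd (j - k + e)" for j e using ik by presburger
  from this[of _ 0] this[of _ 1] this[of _ "-1"] show ?thesis
    unfolding A_def B_def D_def F_def by simp
qed

lemma wrap [simp]: "A 5 = A 0" "A 6 = A 1" "A 7 = A 2" "A 8 = A 3" "B 5 = B 0" "B 6 = B 1" "B 7 = B 2" "B 8 = B 3"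
  "D 5 = D 0" "D 6 = D 1" "D 7 = D 2" "D 8 = D 3" "F 5 = F 0" "F 6 = F 1" "F 7 = F 2" "F 8 = F 3"
  "A (- 1) = A 4" "A (- 2) = A 3" "A (- 3) = A 2" "A (- 4) = A 1"
  using periodic[of 5 0] periodic[of 6 1] periodic[of 7 2] periodic[of 8 3]
    periodic[of "-1" 4] periodic[of "-2" 3] periodic[of "-3" 2] periodic[of "-4" 1] by auto

lemma adj_c_mod: "v \<sim> c j \<longleftrightarrow> v \<sim> c (j mod 5)"
proof -
  have "c j = c (j mod 5)" unfolding eq_c by simp
  then show ?thesis by simp
qed

lemma forall_mod_5: "(\<forall>j. v \<sim> c j \<longleftrightarrow> Q j) \<longleftrightarrow> (\<forall>j \<in> {0, 1, 2, 3, 4}. v \<sim> c j \<longleftrightarrow> Q j)"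
  if "\<And>j :: int. Q j \<longleftrightarrow> Q (j mod 5)"
proof
  assume *: "\<forall>j \<in> {0, 1, 2, 3, 4}. v \<sim> c j \<longleftrightarrow> Q j"
  have "j mod 5 \<in> {0, 1, 2, 3, 4}" for j :: int by auto
  then show "\<forall>j. v \<sim> c j \<longleftrightarrow> Q j" using * that adj_c_mod by blast
qed blast

lemma dvd_mod_5: "5 dvd (j - i) \<longleftrightarrow> 5 dvd (j mod 5 - i)" "5 dvd (j - i - 1) \<longleftrightarrow> 5 dvd (j mod 5 - i - 1)"
    "5 dvd (j - i + 1) \<longleftrightarrow> 5 dvd (j mod 5 - i + 1)" for j i :: int
  by presburger+

lemma class_iff:
  "v \<in> A i \<longleftrightarrow> (\<forall>j \<in> {0, 1, 2, 3, 4}. v \<sim> c j \<longleftrightarrow> 5 dvd (j - i))"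
  "v \<in> B i \<longleftrightarrow> (\<forall>j \<in> {0, 1, 2, 3, 4}. v \<sim> c j \<longleftrightarrow> 5 dvd (j - i - 1) \<or> 5 dvd (j - i + 1))"
  "v \<in> D i \<longleftrightarrow> (\<forall>j \<in> {0, 1, 2, 3, 4}. v \<sim> c j \<longleftrightarrow> 5 dvd (j - i) \<or> 5 dvd (j - i - 1) \<or> 5 dvd (j - i + 1))"
  "v \<in> F i \<longleftrightarrow> (\<forall>j \<in> {0, 1, 2, 3, 4}. v \<sim> c j \<longleftrightarrow> \<not> 5 dvd (j - i))"
  unfolding A_def B_def D_def F_def mem_Collect_eq
  by (rule forall_mod_5; use dvd_mod_5 in blast)+

text \<open>Seeing all five vertices would be a wheel. Every other nonempty neighbourhood outside
  the four types contains a consecutive pair of the kind that \<open>pair\<close> excludes.\<close>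

lemma classes:
  assumes "v \<sim> c i"
  shows "\<exists>i \<in> {0, 1, 2, 3, 4}. v \<in> A i \<or> v \<in> B i \<or> v \<in> D i \<or> v \<in> F i"
proof -
  have "i mod 5 \<in> {0, 1, 2, 3, 4}" by auto
  then have some: "v \<sim> c 0 \<or> v \<sim> c 1 \<or> v \<sim> c 2 \<or> v \<sim> c 3 \<or> v \<sim> c 4"
    using adj_c_mod[of v i] assms by auto
  have not_all: "\<not> (v \<sim> c 0 \<and> v \<sim> c 1 \<and> v \<sim> c 2 \<and> v \<sim> c 3 \<and> v \<sim> c 4)"
    using no_W5[of v "c 0" "c 1" "c 2" "c 3" "c 4"] by (auto simp: adj_c)
  \<comment> \<open>This excludes exactly two consecutive neighbours, and also three of which only
    two are consecutive.\<close>
  have pair: "\<not> (v \<sim> c i \<and> v \<sim> c (i + 1) \<and> \<not> v \<sim> c (i + 2) \<and> \<not> v \<sim> c (i + 4))" for i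
    using no_bull[of "c (i + 4)" "c i" v "c (i + 1)" "c (i + 2)"] adj_commute[of "c i" v]
      adj_commute[of "c (i + 4)" v] by (auto simp: adj_c)
  have w: "c 5 = c 0" "c 6 = c 1" "c 7 = c 2" "c 8 = c 3" by (simp_all add: eq_c)
  show ?thesis
    unfolding bex_simps class_iff ball_simps
    using some not_all pair[of 0] pair[of 1] pair[of 2] pair[of 3] pair[of 4]
    by (simp add: w, cases "v \<sim> c 0"; cases "v \<sim> c 1"; cases "v \<sim> c 2"; cases "v \<sim> c 3";
        cases "v \<sim> c 4"; simp)
qed

text \<open>Together with the exclusions further below, this and the following facts leave open, up
  to symmetry, only \<open>A i\<close> against \<open>B (i + 2)\<close>, \<open>B (i + 3)\<close>
  and \<open>F i\<close>, \<open>B i\<close> against \<open>B (i + 1)\<close> and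
  \<open>D i\<close>, and the edges inside a single \<open>A i\<close>, \<open>B i\<close> or
  \<open>D i\<close>.\<close>

lemma A_A1:
  assumes "x \<in> A i" "y \<in> A (i + 1)"
  shows "x \<sim> y"
  by (rule ccontr)
    (use no_E[of "c i" x "c (i + 1)" y "c (i + 4)" "c (i + 3)"] adj_commute[of y x]
      in \<open>simp add: adj_c A_adj[OF assms(1)] A_adj[OF assms(2)]\<close>)

lemma A_A2:
  assumes "x \<in> A i" "y \<in> A (i + 2)"
  shows "\<not> x \<sim> y"
  by (rule ccontr)
    (use no_E[of "c i" "c (i + 1)" "c (i + 4)" "c (i + 3)" x y] adj_commute[of y x]
      in \<open>simp add: adj_c A_adj[OF assms(1)] A_adj[OF assms(2)]\<close>)

lemma A_B0:
  assumes "x \<in> A i" "y \<in> B i"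
  shows "x \<sim> y"
  by (rule ccontr)
    (use no_E[of "c (i + 1)" y "c i" x "c (i + 2)" "c (i + 3)"] adj_commute[of y x]
      in \<open>simp add: adj_c A_adj[OF assms(1)] B_adj[OF assms(2)]\<close>)

lemma A_B1:
  assumes "x \<in> A i" "y \<in> B (i + 1)"
  shows "\<not> x \<sim> y"
  by (rule ccontr)
    (use no_bull[of "c (i + 2)" y x "c i" "c (i + 4)"] adj_commute[of y x]
      in \<open>simp add: adj_c A_adj[OF assms(1)] B_adj[OF assms(2)]\<close>)

lemma A_B4:
  assumes "x \<in> A i" "y \<in> B (i + 4)"
  shows "\<not> x \<sim> y"
  by (rule ccontr)
    (use no_bull[of "c (i + 1)" "c i" x y "c (i + 3)"] adj_commute[of y x]
      in \<open>simp add: adj_c A_adj[OF assms(1)] B_adj[OF assms(2)]\<close>)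

lemma A_D0:
  assumes "x \<in> A i" "y \<in> D i"
  shows "x \<sim> y"
  by (rule ccontr)
    (use no_bull[of "c (i + 2)" "c (i + 1)" y "c i" x] adj_commute[of y x]
      in \<open>simp add: adj_c A_adj[OF assms(1)] D_adj[OF assms(2)]\<close>)

lemma A_D1:
  assumes "x \<in> A i" "y \<in> D (i + 1)"
  shows "\<not> x \<sim> y"
  by (rule ccontr)
    (use no_bull[of "c (i + 2)" y x "c i" "c (i + 4)"] adj_commute[of y x]
      in \<open>simp add: adj_c A_adj[OF assms(1)] D_adj[OF assms(2)]\<close>)

lemma A_D2:
  assumes "x \<in> A i" "y \<in> D (i + 2)"
  shows "\<not> x \<sim> y"
  by (rule ccontr)
    (use no_bull[of "c (i + 4)" "c (i + 3)" "c (i + 2)" y x] adj_commute[of y x]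
      in \<open>simp add: adj_c A_adj[OF assms(1)] D_adj[OF assms(2)]\<close>)

lemma A_D3:
  assumes "x \<in> A i" "y \<in> D (i + 3)"
  shows "\<not> x \<sim> y"
  by (rule ccontr)
    (use no_bull[of "c (i + 1)" "c (i + 2)" "c (i + 3)" y x] adj_commute[of y x]
      in \<open>simp add: adj_c A_adj[OF assms(1)] D_adj[OF assms(2)]\<close>)

lemma A_D4:
  assumes "x \<in> A i" "y \<in> D (i + 4)"
  shows "\<not> x \<sim> y"
  by (rule ccontr)
    (use no_bull[of "c (i + 1)" "c i" x y "c (i + 3)"] adj_commute[of y x]
      in \<open>simp add: adj_c A_adj[OF assms(1)] D_adj[OF assms(2)]\<close>)

lemma B_B2:
  assumes "x \<in> B i" "y \<in> B (i + 2)"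
  shows "\<not> x \<sim> y"
  by (rule ccontr)
    (use no_bull[of "c i" "c (i + 1)" x y "c (i + 3)"] adj_commute[of y x]
      in \<open>simp add: adj_c B_adj[OF assms(1)] B_adj[OF assms(2)]\<close>)

lemma B_D1:
  assumes "x \<in> B i" "y \<in> D (i + 1)"
  shows "x \<sim> y"
  by (rule ccontr)
    (use no_bull[of "c (i + 3)" "c (i + 2)" y "c (i + 1)" x] adj_commute[of y x]
      in \<open>simp add: adj_c B_adj[OF assms(1)] D_adj[OF assms(2)]\<close>)

lemma B_D4:
  assumes "x \<in> B i" "y \<in> D (i + 4)"
  shows "x \<sim> y"
  by (rule ccontr)
    (use no_bull[of "c (i + 2)" "c (i + 3)" y "c (i + 4)" x] adj_commute[of y x]
      in \<open>simp add: adj_c B_adj[OF assms(1)] D_adj[OF assms(2)]\<close>)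

lemma B_D2:
  assumes "x \<in> B i" "y \<in> D (i + 2)"
  shows "\<not> x \<sim> y"
  by (rule ccontr)
    (use no_bull[of "c i" "c (i + 1)" x y "c (i + 3)"] adj_commute[of y x]
      in \<open>simp add: adj_c B_adj[OF assms(1)] D_adj[OF assms(2)]\<close>)

lemma B_D3:
  assumes "x \<in> B i" "y \<in> D (i + 3)"
  shows "\<not> x \<sim> y"
  by (rule ccontr)
    (use no_bull[of "c i" "c (i + 4)" x y "c (i + 2)"] adj_commute[of y x]
      in \<open>simp add: adj_c B_adj[OF assms(1)] D_adj[OF assms(2)]\<close>)

lemma B_F0:
  assumes "x \<in> B i" "y \<in> F i"
  shows "\<not> x \<sim> y"
  by (rule ccontr)
    (use no_bull[of "c i" "c (i + 1)" x y "c (i + 3)"] adj_commute[of y x]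
      in \<open>simp add: adj_c B_adj[OF assms(1)] F_adj[OF assms(2)]\<close>)

lemma B_F1:
  assumes "x \<in> B i" "y \<in> F (i + 1)"
  shows "x \<sim> y"
  by (rule ccontr)
    (use no_bull[of "c (i + 2)" y "c i" "c (i + 4)" x] adj_commute[of y x]
      in \<open>simp add: adj_c B_adj[OF assms(1)] F_adj[OF assms(2)]\<close>)

lemma B_F2:
  assumes "x \<in> B i" "y \<in> F (i + 2)"
  shows "x \<sim> y"
  by (rule ccontr)
    (use no_bull[of "c (i + 2)" "c (i + 3)" y "c (i + 4)" x] adj_commute[of y x]
      in \<open>simp add: adj_c B_adj[OF assms(1)] F_adj[OF assms(2)]\<close>)

lemma B_F3:
  assumes "x \<in> B i" "y \<in> F (i + 3)"
  shows "x \<sim> y"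
  by (rule ccontr)
    (use no_bull[of "c (i + 2)" y "c i" "c (i + 4)" x] adj_commute[of y x]
      in \<open>simp add: adj_c B_adj[OF assms(1)] F_adj[OF assms(2)]\<close>)

lemma B_F4:
  assumes "x \<in> B i" "y \<in> F (i + 4)"
  shows "x \<sim> y"
  by (rule ccontr)
    (use no_bull[of "c (i + 3)" y "c i" "c (i + 1)" x] adj_commute[of y x]
      in \<open>simp add: adj_c B_adj[OF assms(1)] F_adj[OF assms(2)]\<close>)

lemma F_F0:
  assumes "x \<in> F i" "y \<in> F i"
  shows "\<not> x \<sim> y"
  by (rule ccontr)
    (use no_K4[of "c (i + 1)" "c (i + 2)" x y] adj_commute[of y x]
      in \<open>simp add: adj_c F_adj[OF assms(1)] F_adj[OF assms(2)]\<close>)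

section \<open>Types that cannot both occur\<close>

lemma no_D_D1:
  assumes "x \<in> D i" "y \<in> D (i + 1)"
  shows False
  using no_K4[of "c i" "c (i + 1)" x y] no_bull[of "c (i + 3)" "c (i + 2)" y "c (i + 1)" x] adj_commute[of y x]
  by (cases "x \<sim> y") (simp_all add: adj_c D_adj[OF assms(1)] D_adj[OF assms(2)])

text \<open>The two diamonds with middle edges \<open>c (i + 2) y\<close> and \<open>c i x\<close>
  form a chain whether or not \<open>x\<close> and \<open>y\<close> are adjacent.\<close>

lemma no_D_D2:
  assumes "x \<in> D i" "y \<in> D (i + 2)"
  shows False
  using no_M7[of "c (i + 3)" "c (i + 2)" y "c (i + 1)" "c i" x "c (i + 4)"]  adj_commute[of y x]
  by (simp add: adj_c D_adj[OF assms(1)] D_adj[OF assms(2)])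

lemma no_D_F0:
  assumes "x \<in> D i" "y \<in> F i"
  shows False
  using no_M7[of "c (i + 1)" "c i" x "c (i + 4)" "c (i + 3)" y "c (i + 2)"]  adj_commute[of y x]
  by (simp add: adj_c D_adj[OF assms(1)] F_adj[OF assms(2)])

lemma no_D_F1:
  assumes "x \<in> D i" "y \<in> F (i + 1)"
  shows False
  using no_M7[of "c (i + 1)" "c i" x "c (i + 4)" "c (i + 3)" y "c (i + 2)"]  adj_commute[of y x]
  by (simp add: adj_c D_adj[OF assms(1)] F_adj[OF assms(2)])

lemma no_D_F2:
  assumes "x \<in> D i" "y \<in> F (i + 2)"
  shows False
  using no_K4[of "c i" "c (i + 1)" x y] no_bull[of "c (i + 2)" "c (i + 3)" y "c (i + 4)" x] adj_commute[of y x]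
  by (cases "x \<sim> y") (simp_all add: adj_c D_adj[OF assms(1)] F_adj[OF assms(2)])

lemma no_D_F3:
  assumes "x \<in> D i" "y \<in> F (i + 3)"
  shows False
  using no_K4[of "c i" "c (i + 1)" x y] no_bull[of "c (i + 3)" "c (i + 2)" y "c (i + 1)" x] adj_commute[of y x]
  by (cases "x \<sim> y") (simp_all add: adj_c D_adj[OF assms(1)] F_adj[OF assms(2)])

lemma no_D_F4:
  assumes "x \<in> D i" "y \<in> F (i + 4)"
  shows False
  using no_M7[of "c (i + 3)" "c (i + 2)" y "c (i + 1)" "c i" x "c (i + 4)"]  adj_commute[of y x]
  by (simp add: adj_c D_adj[OF assms(1)] F_adj[OF assms(2)])

lemma no_F_F1:
  assumes "x \<in> F i" "y \<in> F (i + 1)"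
  shows False
  using no_M7[of "c i" "c (i + 4)" y "c (i + 3)" "c (i + 2)" x "c (i + 1)"]  adj_commute[of y x]
  by (simp add: adj_c F_adj[OF assms(1)] F_adj[OF assms(2)])

lemma no_F_F2:
  assumes "x \<in> F i" "y \<in> F (i + 2)"
  shows False
  using no_M7[of "c i" "c (i + 4)" y "c (i + 3)" "c (i + 2)" x "c (i + 1)"]  adj_commute[of y x]
  by (simp add: adj_c F_adj[OF assms(1)] F_adj[OF assms(2)])

lemma no_A_F1:
  assumes "x \<in> A i" "y \<in> F (i + 1)"
  shows False
  using no_bull[of "c (i + 1)" "c i" x y "c (i + 3)"] no_bull[of "c (i + 2)" y "c (i + 4)" "c i" x] adj_commute[of y x]
  by (cases "x \<sim> y") (simp_all add: adj_c A_adj[OF assms(1)] F_adj[OF assms(2)])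

lemma no_A_F2:
  assumes "x \<in> A i" "y \<in> F (i + 2)"
  shows False
  using no_bull[of "c (i + 2)" "c (i + 3)" "c (i + 4)" y x] no_bull[of "c (i + 2)" "c (i + 1)" y "c i" x] adj_commute[of y x]
  by (cases "x \<sim> y") (simp_all add: adj_c A_adj[OF assms(1)] F_adj[OF assms(2)])

lemma no_A_F3:
  assumes "x \<in> A i" "y \<in> F (i + 3)"
  shows False
  using no_bull[of "c (i + 3)" "c (i + 2)" "c (i + 1)" y x] no_bull[of "c (i + 2)" y "c (i + 4)" "c i" x] adj_commute[of y x]
  by (cases "x \<sim> y") (simp_all add: adj_c A_adj[OF assms(1)] F_adj[OF assms(2)])

lemma no_A_F4:
  assumes "x \<in> A i" "y \<in> F (i + 4)"
  shows False
  using no_bull[of "c (i + 2)" y x "c i" "c (i + 4)"] no_bull[of "c (i + 3)" y "c (i + 1)" "c i" x] adj_commute[of y x]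
  by (cases "x \<sim> y") (simp_all add: adj_c A_adj[OF assms(1)] F_adj[OF assms(2)])

text \<open>Every \<open>f\<close> in \<open>F i\<close> sees \<open>B (i + 2)\<close> and
  \<open>B (i + 3)\<close>; so this lemma and the three after it settle the open pairs between
  \<open>A\<close> and \<open>B\<close> at \<open>i\<close> once \<open>F i\<close> is
  inhabited.\<close>

lemma A_B2_F_adj:
  assumes "x \<in> A i" "y \<in> B (i + 2)" "f \<in> F i"
    and "f \<sim> x" "f \<sim> y"
  shows "\<not> x \<sim> y"
  by (rule ccontr)
    (use no_bull[of "c i" x y f "c (i + 2)"] assms(4-5) adj_commute[of y x] adj_commute[of f x] adj_commute[of f y]
      in \<open>simp add: adj_c A_adj[OF assms(1)] B_adj[OF assms(2)] F_adj[OF assms(3)]\<close>)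

lemma A_B2_F_nonadj:
  assumes "x \<in> A i" "y \<in> B (i + 2)" "f \<in> F i"
    and "\<not> f \<sim> x" "f \<sim> y"
  shows "\<not> x \<sim> y"
  by (rule ccontr)
    (use no_bull[of "c (i + 4)" f "c (i + 1)" y x] assms(4-5) adj_commute[of y x] adj_commute[of f x] adj_commute[of f y]
      in \<open>simp add: adj_c A_adj[OF assms(1)] B_adj[OF assms(2)] F_adj[OF assms(3)]\<close>)

lemma A_B3_F_adj:
  assumes "x \<in> A i" "y \<in> B (i + 3)" "f \<in> F i"
    and "f \<sim> x" "f \<sim> y"
  shows "\<not> x \<sim> y"
  by (rule ccontr)
    (use no_bull[of "c i" x y f "c (i + 3)"] assms(4-5) adj_commute[of y x] adj_commute[of f x] adj_commute[of f y]
      in \<open>simp add: adj_c A_adj[OF assms(1)] B_adj[OF assms(2)] F_adj[OF assms(3)]\<close>)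

lemma A_B3_F_nonadj:
  assumes "x \<in> A i" "y \<in> B (i + 3)" "f \<in> F i"
    and "\<not> f \<sim> x" "f \<sim> y"
  shows "\<not> x \<sim> y"
  by (rule ccontr)
    (use no_bull[of "c (i + 1)" f "c (i + 4)" y x] assms(4-5) adj_commute[of y x] adj_commute[of f x] adj_commute[of f y]
      in \<open>simp add: adj_c A_adj[OF assms(1)] B_adj[OF assms(2)] F_adj[OF assms(3)]\<close>)

text \<open>The ends of an edge inside one type are twins with respect to the open pairs between
  \<open>A\<close> and \<open>B\<close>; so a vertex that sees one end spans a diamond together with
  a common pentagon neighbour of both ends.\<close>

lemma mixed_A_edge2:
  assumes "a \<in> A i" "a' \<in> A i" "b \<in> B (i + 2)"
    and "a \<sim> a'" "a \<sim> b"
  shows "a' \<sim> b"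
  by (rule ccontr)
    (use no_bull[of "c (i + 4)" "c i" a' a b] assms(4-5) adj_commute[of a' a] adj_commute[of b a] adj_commute[of b a']
      in \<open>simp add: adj_c A_adj[OF assms(1)] A_adj[OF assms(2)] B_adj[OF assms(3)]\<close>)

lemma mixed_A_edge3:
  assumes "a \<in> A i" "a' \<in> A i" "b \<in> B (i + 3)"
    and "a \<sim> a'" "a \<sim> b"
  shows "a' \<sim> b"
  by (rule ccontr)
    (use no_bull[of "c (i + 1)" "c i" a' a b] assms(4-5) adj_commute[of a' a] adj_commute[of b a] adj_commute[of b a']
      in \<open>simp add: adj_c A_adj[OF assms(1)] A_adj[OF assms(2)] B_adj[OF assms(3)]\<close>)

lemma A_A1_B3:
  assumes "a \<in> A i" "a' \<in> A (i + 1)" "b \<in> B (i + 3)"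
    and "a \<sim> b" "a \<sim> a'"
  shows "\<not> a' \<sim> b"
  by (rule ccontr)
    (use no_bull[of "c i" a a' b "c (i + 2)"] assms(4-5) adj_commute[of a' a] adj_commute[of b a] adj_commute[of b a']
      in \<open>simp add: adj_c A_adj[OF assms(1)] A_adj[OF assms(2)] B_adj[OF assms(3)]\<close>)

lemma mixed_B_edge2:
  assumes "b \<in> B (i + 2)" "b' \<in> B (i + 2)" "a \<in> A i"
    and "b \<sim> b'" "a \<sim> b"
  shows "a \<sim> b'"
  by (rule ccontr)
    (use no_bull[of "c (i + 2)" "c (i + 1)" b' b a] assms(4-5) adj_commute[of b' b] adj_commute[of a b] adj_commute[of a b']
      in \<open>simp add: adj_c B_adj[OF assms(1)] B_adj[OF assms(2)] A_adj[OF assms(3)]\<close>)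

lemma mixed_B_edge3:
  assumes "b \<in> B (i + 3)" "b' \<in> B (i + 3)" "a \<in> A i"
    and "b \<sim> b'" "a \<sim> b"
  shows "a \<sim> b'"
  by (rule ccontr)
    (use no_bull[of "c (i + 1)" "c (i + 2)" b' b a] assms(4-5) adj_commute[of b' b] adj_commute[of a b] adj_commute[of a b']
      in \<open>simp add: adj_c B_adj[OF assms(1)] B_adj[OF assms(2)] A_adj[OF assms(3)]\<close>)

lemma A_B3_D3:
  assumes "a \<in> A i" "b \<in> B (i + 3)" "d \<in> D (i + 3)"
    and "a \<sim> b"
  shows "\<not> b \<sim> d"
  by (rule ccontr)
    (use no_bull[of "c (i + 1)" "c (i + 2)" d b a] assms(4) A_D3[OF assms(1,3)] adj_commute[of b a] adj_commute[of d a] adj_commute[of d b]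
      in \<open>simp add: adj_c A_adj[OF assms(1)] B_adj[OF assms(2)] D_adj[OF assms(3)]\<close>)

lemma A_B2_D2:
  assumes "a \<in> A i" "b \<in> B (i + 2)" "d \<in> D (i + 2)"
    and "a \<sim> b"
  shows "\<not> b \<sim> d"
  by (rule ccontr)
    (use no_bull[of "c (i + 4)" "c (i + 3)" d b a] assms(4) A_D2[OF assms(1,3)] adj_commute[of b a] adj_commute[of d a] adj_commute[of d b]
      in \<open>simp add: adj_c A_adj[OF assms(1)] B_adj[OF assms(2)] D_adj[OF assms(3)]\<close>)


end

locale dominating_pentagon = pentagon +
  assumes dominating: "v \<in> V \<Longrightarrow> \<exists>i. v \<sim> c i"

section \<open>Colouring a graph dominated by a pentagon\<close>

context forbidden_graph
begin

text \<open>The vertices isolated in \<open>S\<close> are kept apart as \<open>I\<close>: they fit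
  with either side, while every vertex of \<open>P\<close> and \<open>Q\<close> comes with an edge
  in \<open>S\<close>, and the restrictions found later are about such edges.\<close>

lemma bipartite_split:
  assumes "\<And>x. x \<in> S \<Longrightarrow> v \<sim> x"
  obtains I P Q where "S = I \<union> P \<union> Q" "anti I S" "anti P P" "anti Q Q"
    "\<And>x. x \<in> P \<union> Q \<Longrightarrow> \<exists>y \<in> S. x \<sim> y"
proof -
  obtain h :: "'a \<Rightarrow> bool" where h: "\<And>x y. \<lbrakk>v \<sim> x; v \<sim> y; x \<sim> y\<rbrakk> \<Longrightarrow> h x \<noteq> h y"
    using bipartite_nbh[of v] by blast
  show ?thesis
  proof (rule that)
    show "S = {x \<in> S. \<forall>y \<in> S. \<not> x \<sim> y} \<union> {x \<in> S. h x \<and> (\<exists>y \<in> S. x \<sim> y)} \<union> {x \<in> S. \<not> h x \<and> (\<exists>y \<in> S. x \<sim> y)}"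
      by blast
  qed (use h assms in \<open>unfold anti_def, blast+\<close>)
qed

end

context dominating_pentagon
begin

lemma anti_A_A: "anti (A i) (A (i + 2))" "anti (A (i + 2)) (A i)"
  using A_A2 anti_sym unfolding anti_def by blast+
lemma anti_A_B: "anti (A i) (B (i + 1))" "anti (B (i + 1)) (A i)" "anti (A i) (B (i + 4))" "anti (B (i + 4)) (A i)"
  using A_B1 A_B4 adj_sym unfolding anti_def by blast+
lemma anti_B_B: "anti (B i) (B (i + 2))" "anti (B (i + 2)) (B i)"
  using B_B2 adj_sym unfolding anti_def by blast+

lemmas anti_A_A_simps [simp] = anti_A_A[of 0, simplified] anti_A_A[of 1, simplified] anti_A_A[of 2, simplified]
  anti_A_A[of 3, simplified] anti_A_A[of 4, simplified]
lemmas anti_A_B_simps [simp] = anti_A_B[of 0, simplified] anti_A_B[of 1, simplified] anti_A_B[of 2, simplified]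
  anti_A_B[of 3, simplified] anti_A_B[of 4, simplified]
lemmas anti_B_B_simps [simp] = anti_B_B[of 0, simplified] anti_B_B[of 1, simplified] anti_B_B[of 2, simplified]
  anti_B_B[of 3, simplified] anti_B_B[of 4, simplified]

lemma A_nbh: "x \<in> A i \<Longrightarrow> c i \<sim> x"
  by (simp add: A_adj)

lemma A_split:
  obtains I P Q where "A i = I \<union> P \<union> Q" "anti I (A i)" "anti P P" "anti Q Q"
    "\<And>x. x \<in> P \<union> Q \<Longrightarrow> \<exists>y \<in> A i. x \<sim> y"
  using bipartite_split[of "A i" "c i"] A_nbh by metis

lemma A_A1_edges: "\<lbrakk>x \<in> A i; y \<in> A i; x \<sim> y; x' \<in> A (i + 1); y' \<in> A (i + 1); x' \<sim> y'\<rbrakk> \<Longrightarrow> False"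
  using no_K4[of x y x' y'] A_A1 by blast

text \<open>The pentagon itself is covered because \<open>c i\<close> has type
  \<open>B i\<close>.\<close>

lemma cover_all:
  "V \<subseteq> (A 0 \<union> A 1 \<union> A 2 \<union> A 3 \<union> A 4) \<union> (B 0 \<union> B 1 \<union> B 2 \<union> B 3 \<union> B 4)
    \<union> (D 0 \<union> D 1 \<union> D 2 \<union> D 3 \<union> D 4) \<union> (F 0 \<union> F 1 \<union> F 2 \<union> F 3 \<union> F 4)"
  using dominating classes by fastforce

text \<open>Besides \<open>F 0\<close>, only \<open>A 0\<close> and the types \<open>B\<close> can
  be inhabited. The vertex \<open>f\<close> makes each \<open>B i\<close> stable, by a K4 or, for
  \<open>i = 0\<close>, by a chain of two diamonds, and separates \<open>A 0\<close> from
  \<open>B 2\<close> and \<open>B 3\<close>.\<close>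

lemma colourable_F:
  assumes f: "f \<in> F 0"
  shows "colourable_on 3 V"
proof -
  have F: "F 1 = {}" "F 2 = {}" "F 3 = {}" "F 4 = {}"
    using no_F_F1[of f 0] no_F_F2[of f 0] no_F_F1[of _ 4 f] no_F_F2[of _ 3 f] f by auto
  have D: "D 0 = {}" "D 1 = {}" "D 2 = {}" "D 3 = {}" "D 4 = {}"
    using no_D_F0[of _ 0 f] no_D_F4[of _ 1 f] no_D_F3[of _ 2 f] no_D_F2[of _ 3 f] no_D_F1[of _ 4 f] f by auto
  have A: "A 1 = {}" "A 2 = {}" "A 3 = {}" "A 4 = {}"
    using no_A_F4[of _ 1 f] no_A_F3[of _ 2 f] no_A_F2[of _ 3 f] no_A_F1[of _ 4 f] f by auto
  obtain I P Q where A0: "A 0 = I \<union> P \<union> Q" "anti I (A 0)" "anti P P" "anti Q Q"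
    using A_split[of 0] by metis
  have fB: "f \<sim> x" if "x \<in> B 1 \<union> B 2 \<union> B 3 \<union> B 4" for x
    using that B_F4[of x 1 f] B_F3[of x 2 f] B_F2[of x 3 f] B_F1[of x 4 f] f adj_sym by auto
  have B: "anti (B i) (B i)" if "i \<in> {1, 2, 3, 4}" for i
  proof (rule antiI)
    fix x y assume xy: "x \<in> B i" "y \<in> B i" "x \<sim> y"
    then have fxy: "f \<sim> x" "f \<sim> y" using fB that by auto
    have "c (i + 1) \<sim> x" "c (i + 1) \<sim> y" "c (i + 4) \<sim> x" "c (i + 4) \<sim> y"
      using xy by (simp_all add: B_adj)
    moreover have "f \<sim> c (i + 1) \<or> f \<sim> c (i + 4)" using f that by (auto simp: F_adj)
    ultimately show False using no_K4[of f x y "c (i + 1)"] no_K4[of f x y "c (i + 4)"] fxy xy adj_sym by blast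
  qed
  then have B: "anti (B 1) (B 1)" "anti (B 2) (B 2)" "anti (B 3) (B 3)" "anti (B 4) (B 4)" by simp_all
  have B0: "anti (B 0) (B 0)"
  proof (rule antiI)
    fix x y assume xy: "x \<in> B 0" "y \<in> B 0" "x \<sim> y"
    show False
      using no_M7[of "c 1" x y "c 4" "c 3" f "c 2"] xy f
      by (simp add: adj_c B_adj F_adj)
  qed
  have FF: "anti (F 0) (F 0)" "anti (B 0) (F 0)" "anti (F 0) (B 0)"
    using F_F0[of _ 0] B_F0[of _ 0] adj_sym unfolding anti_def by blast+
  have "\<not> x \<sim> y" if "x \<in> A 0" "y \<in> B 2 \<union> B 3" for x y
    using A_B2_F_adj[of x 0 y f] A_B2_F_nonadj[of x 0 y f] A_B3_F_adj[of x 0 y f] A_B3_F_nonadj[of x 0 y f] f fB[of y] that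
    by (cases "f \<sim> x") auto
  then have "anti (A 0) (B 2)" "anti (A 0) (B 3)"
    unfolding anti_def by blast+
  then have AB: "anti (A 0) (B 1 \<union> B 2 \<union> B 3 \<union> B 4)"
    by (simp add: anti_Un)
  note AB = AB anti_sym[OF AB]
  note AI = anti_sym[OF A0(2), unfolded A0(1)]
  show ?thesis
  proof (rule colourable_3I)
    show "V \<subseteq> (F 0 \<union> B 0) \<union> (B 1 \<union> B 3 \<union> I \<union> P) \<union> (B 2 \<union> B 4 \<union> Q)"
      using cover_all unfolding F D A A0(1) by blast
    note facts = FF B0 B A0(3,4) anti_B_B_simps AI[unfolded anti_Un]
      A0(2)[unfolded A0(1) anti_Un] AB[unfolded A0(1) anti_Un]
    show "anti (F 0 \<union> B 0) (F 0 \<union> B 0)"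
      by (simp only: anti_Un facts simp_thms)
    show "anti (B 1 \<union> B 3 \<union> I \<union> P) (B 1 \<union> B 3 \<union> I \<union> P)"
      by (simp only: anti_Un facts simp_thms)
    show "anti (B 2 \<union> B 4 \<union> Q) (B 2 \<union> B 4 \<union> Q)"
      by (simp only: anti_Un facts simp_thms)
  qed
qed

definition has_edge :: "int \<Rightarrow> bool" where
  "has_edge i \<longleftrightarrow> (\<exists>x \<in> A i. \<exists>y \<in> A i. x \<sim> y)"

lemma has_edge_next: "has_edge i \<Longrightarrow> \<not> has_edge (i + 1)"
  using A_A1_edges unfolding has_edge_def by blast

lemma not_has_edge: "\<not> has_edge i \<Longrightarrow> anti (A i) (A i)"
  unfolding has_edge_def anti_def by blast

end

context dominating_pentagon
begin

lemma A_neq: "x \<in> A i \<Longrightarrow> x \<noteq> c j"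
proof
  assume x: "x \<in> A i" "x = c j"
  have "5 dvd (j + 1 - i)" "5 dvd (j - 1 - i)"
    using A_adj(1)[OF x(1), of "j + 1"] A_adj(1)[OF x(1), of "j - 1"] x(2) by (simp_all add: adj_c)
  then have "5 dvd ((j + 1 - i) - (j - 1 - i))" by (rule dvd_diff)
  then show False by simp
qed

lemma A_disjoint: "x \<in> A i \<Longrightarrow> y \<in> A j \<Longrightarrow> \<not> 5 dvd (i - j) \<Longrightarrow> x \<noteq> y"
  using A_adj(1)[of x i i] A_adj(1)[of y j i] by auto

text \<open>The colouring is not symmetric under the reflection that fixes \<open>c 0\<close>: all
  of \<open>A 3\<close> goes into one class, and the hypotheses remove its conflicts there, with
  itself, with \<open>A 4\<close> and with edges inside \<open>B 0 \<union> D 0\<close>.\<close>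

lemma colourable_D_aux:
  assumes d: "d \<in> D 0"
    and A3: "\<not> has_edge 3" and A4: "has_edge 4 \<Longrightarrow> A 3 = {}"
    and X3: "\<And>x y a. \<lbrakk>x \<in> B 0 \<union> D 0; y \<in> B 0 \<union> D 0; x \<sim> y; a \<in> A 3\<rbrakk> \<Longrightarrow> \<not> x \<sim> a"
  shows "colourable_on 3 V"
proof -
  have F: "F 0 = {}" "F 1 = {}" "F 2 = {}" "F 3 = {}" "F 4 = {}"
    using no_D_F0[of d 0] no_D_F1[of d 0] no_D_F2[of d 0] no_D_F3[of d 0] no_D_F4[of d 0] d by auto
  have D: "D 1 = {}" "D 2 = {}" "D 3 = {}" "D 4 = {}"
    using no_D_D1[of d 0] no_D_D2[of d 0] no_D_D1[of _ 4 d] no_D_D2[of _ 3 d] d by auto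
  have dc: "d \<sim> c 0" "d \<sim> c 1" "d \<sim> c 4" using d by (simp_all add: D_adj)
  have B1d: "x \<sim> d" if "x \<in> B 1 \<union> B 4" for x
    using that B_D4[of x 1 d] B_D1[of x 4 d] d by auto
  have AD: "anti (A 1 \<union> A 2 \<union> A 3 \<union> A 4 \<union> B 2 \<union> B 3) (D 0)"
    using A_D4[of _ 1] A_D3[of _ 2] A_D2[of _ 3] A_D1[of _ 4] B_D3[of _ 2] B_D2[of _ 3]
    unfolding anti_def by auto
  define X where "X = B 0 \<union> D 0"
  have AX: "anti (A 1 \<union> A 4 \<union> B 2 \<union> B 3) X"
    using AD unfolding X_def anti_Un by simp
  have B14: "anti (B 1) (B 1)" "anti (B 4) (B 4)"
  proof -
    have "\<not> x \<sim> y" if "x \<in> B 1 \<and> y \<in> B 1 \<or> x \<in> B 4 \<and> y \<in> B 4" for x y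
    proof -
      have "x \<sim> c 0" "y \<sim> c 0" using that by (auto simp: B_adj)
      then show ?thesis using no_K4[of x y d "c 0"] B1d that dc by blast
    qed
    then show "anti (B 1) (B 1)" "anti (B 4) (B 4)" unfolding anti_def by blast+
  qed
  have B23: "anti (B 2) (B 2)" "anti (B 3) (B 3)"
  proof -
    have "\<not> x \<sim> y" if "x \<in> B 2" "y \<in> B 2" for x y
      using no_M7[of "c 3" x y "c 1" "c 0" d "c 4"] that d by (auto simp: B_adj D_adj adj_c)
    moreover have "\<not> x \<sim> y" if "x \<in> B 3" "y \<in> B 3" for x y
      using no_M7[of "c 2" x y "c 4" "c 0" d "c 1"] that d by (auto simp: B_adj D_adj adj_c)
    ultimately show "anti (B 2) (B 2)" "anti (B 3) (B 3)" unfolding anti_def by blast+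
  qed
  have A0: "anti (A 0) (A 0)"
  proof (rule antiI)
    fix x y assume xy: "x \<in> A 0" "y \<in> A 0" "x \<sim> y"
    then have "x \<sim> c 0" "y \<sim> c 0" "x \<sim> d" "y \<sim> d" using A_D0 d by (auto simp: A_adj)
    then show False using no_K4[of x y d "c 0"] xy dc by blast
  qed
  \<comment> \<open>The edge \<open>c 0 d\<close> is the middle of diamonds whose ends are
    \<open>c 1\<close>, \<open>c 4\<close> or vertices of \<open>B 4\<close>. In this and several of
    the next facts such a diamond is chained to one over the edge \<open>x y\<close>.\<close>
  have A1B3: "\<not> x \<sim> b" if "x \<in> A 1" "y \<in> A 1" "x \<sim> y" "b \<in> B 3" for x y b
    using no_M7[of "c 4" "c 0" d "c 1" x y b] mixed_A_edge2[of x 1 y b] that d adj_sym[of x b]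
    by (auto simp: A_adj B_adj D_adj adj_c)
  have A4B2: "\<not> x \<sim> b" if "x \<in> A 4" "y \<in> A 4" "x \<sim> y" "b \<in> B 2" for x y b
    using no_M7[of "c 1" "c 0" d "c 4" x y b] mixed_A_edge3[of x 4 y b] that d adj_sym[of x b]
    by (auto simp: A_adj B_adj D_adj adj_c)
  have A2B4: "\<not> x \<sim> b" if "x \<in> A 2" "y \<in> A 2" "x \<sim> y" "b \<in> B 4" for x y b
    using no_M7[of "c 2" x y b "c 0" d "c 1"] mixed_A_edge2[of x 2 y b] B1d[of b] that d
    by (auto simp: A_adj B_adj D_adj adj_c)
  have A1A2: "\<not> a \<sim> b" if "x \<in> A 1" "y \<in> A 1" "x \<sim> y" "a \<in> A 2" "b \<in> B 4" for x y a b
    using no_M7[of a x y "c 1" "c 0" d b] A_A1[of x 1 a] A_A1[of y 1 a] B1d[of b] that dc dc[THEN adj_sym]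
      adj_sym[of x a] adj_sym[of y a] adj_sym[of b d] adj_sym[of d "c 1"] adj_sym[of a b]
    by (auto simp: A_adj B_adj adj_c)
  have XA2: "x \<in> B 0 \<and> y \<in> B 0 \<and> a \<sim> y" if "x \<in> X" "y \<in> X" "x \<sim> y" "a \<in> A 2" "x \<sim> a" for x y a
  proof -
    have ax: "a \<sim> x" using that adj_sym by blast
    have x: "x \<in> B 0" using AD that ax unfolding X_def anti_def by blast
    have "y \<notin> D 0" using A_B3_D3[of a 2 x y] x that ax by auto
    then have y: "y \<in> B 0" using that by (auto simp: X_def)
    show ?thesis using mixed_B_edge3[of x 2 y a] x y that ax by simp
  qed
  have XA2_edge: "\<not> a \<sim> a'" if "x \<in> X" "y \<in> X" "x \<sim> y" "a \<in> A 2" "x \<sim> a" "a' \<in> A 2" for x y a a'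
  proof
    assume aa: "a \<sim> a'"
    have xy: "x \<in> B 0" "y \<in> B 0" "a \<sim> y" "a \<sim> x" using XA2 that adj_sym by blast+
    then have "a' \<sim> x" "a' \<sim> y"
      using mixed_A_edge3[of a 2 a' x] mixed_A_edge3[of a 2 a' y] that aa by auto
    then show False using no_K4[of a a' x y] xy aa that by blast
  qed
  have XA2_B4: "\<not> a \<sim> b" if "x \<in> X" "y \<in> X" "x \<sim> y" "a \<in> A 2" "x \<sim> a" "b \<in> B 4" for x y a b
  proof -
    have xy: "x \<in> B 0" "y \<in> B 0" "a \<sim> y" "a \<sim> x" using XA2 that adj_sym by blast+
    then show ?thesis
      using no_M7[of a x y "c 1" "c 0" d b] B1d[of b] that dc adj_sym[of b d] adj_sym[of d "c 1"]
        adj_sym[of a b]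
      by (auto simp: B_adj adj_c adj_commute[of "c 0" d] adj_commute[of "c 1" d])
  qed
  obtain I1 P1 Q1 where 1: "A 1 = I1 \<union> P1 \<union> Q1" "anti I1 (A 1)" "anti P1 P1" "anti Q1 Q1"
    "\<And>x. x \<in> P1 \<union> Q1 \<Longrightarrow> \<exists>y \<in> A 1. x \<sim> y"
    using A_split[of 1] by metis
  obtain I2 P2 Q2 where 2: "A 2 = I2 \<union> P2 \<union> Q2" "anti I2 (A 2)" "anti P2 P2" "anti Q2 Q2"
    "\<And>x. x \<in> P2 \<union> Q2 \<Longrightarrow> \<exists>y \<in> A 2. x \<sim> y"
    using A_split[of 2] by metis
  obtain I4 P4 Q4 where 4: "A 4 = I4 \<union> P4 \<union> Q4" "anti I4 (A 4)" "anti P4 P4" "anti Q4 Q4"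
    "\<And>x. x \<in> P4 \<union> Q4 \<Longrightarrow> \<exists>y \<in> A 4. x \<sim> y"
    using A_split[of 4] by metis
  have "c 1 \<sim> x" if "x \<in> X" for x using that by (auto simp: X_def B_adj D_adj)
  then obtain IX PX QX where X: "X = IX \<union> PX \<union> QX" "anti IX X" "anti PX PX" "anti QX QX"
    "\<And>x. x \<in> PX \<union> QX \<Longrightarrow> \<exists>y \<in> X. x \<sim> y"
    using bipartite_split[of X "c 1"] by metis
  \<comment> \<open>Isolated vertices of \<open>A 2\<close> that conflict with \<open>B 4\<close>
    and so must leave the class of \<open>B 4\<close>.\<close>
  define J2 where "J2 = {a \<in> I2. \<exists>b \<in> B 4. a \<sim> b}"
  define J2' where "J2' = I2 - J2"
  \<comment> \<open>Isolated vertices of \<open>X\<close> that conflict with \<open>A 2\<close> and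
    so are kept apart from \<open>Q2\<close> and \<open>J2\<close>; they do not see
    \<open>A 3\<close>, so they can join its class.\<close>
  define Y where "Y = {x \<in> IX. \<exists>a \<in> A 2. x \<sim> a}"
  define Y' where "Y' = IX - Y"
  have I2: "I2 = J2 \<union> J2'" and IX: "IX = Y \<union> Y'" by (auto simp: J2_def J2'_def Y_def Y'_def)
  note 2 = 2[unfolded I2] and X = X[unfolded IX]
  have J2: "anti J2' (B 4)" by (auto simp: J2_def J2'_def anti_def)
  have Y: "anti Y' (A 2)" by (auto simp: Y_def Y'_def anti_def)
  have P2B4: "anti P2 (B 4)" using A2B4 2(1,5) unfolding anti_def by blast
  have P4B2: "anti P4 (B 2)" using A4B2 4(1,5) unfolding anti_def by blast
  have Q1B3: "anti Q1 (B 3)" using A1B3 1(1,5) unfolding anti_def by blast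
  have PXA3: "anti PX (A 3)" using X3 X(1,5) unfolding X_def[symmetric] anti_def by blast
  have YA3: "anti Y (A 3)"
  proof (rule antiI)
    fix x b assume xb: "x \<in> Y" "b \<in> A 3" "x \<sim> b"
    then obtain a where a: "a \<in> A 2" "x \<sim> a" by (auto simp: Y_def)
    have "x \<in> X" using xb(1) IX X(1) by blast
    then have "x \<in> B 0" using AD a adj_sym unfolding X_def anti_def by blast
    then show False using A_A1_B3[of a 2 b x] A_A1[of a 2 b] a xb adj_sym by auto
  qed
  have P4A3: "anti P4 (A 3)"
    using A4 4(1,5) unfolding has_edge_def anti_def by blast
  have QXQ2: "anti QX Q2"
  proof (rule antiI)
    fix x a assume xa: "x \<in> QX" "a \<in> Q2" "x \<sim> a"
    then obtain y a' where "y \<in> X" "x \<sim> y" "a' \<in> A 2" "a \<sim> a'" using X(5)[of x] 2(5)[of a] by blast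
    then show False using XA2_edge[of x y a a'] xa X(1) 2(1) by blast
  qed
  have QXJ2: "anti QX J2"
  proof (rule antiI)
    fix x a assume xa: "x \<in> QX" "a \<in> J2" "x \<sim> a"
    then obtain y b where "y \<in> X" "x \<sim> y" "b \<in> B 4" "a \<sim> b" using X(5)[of x] by (auto simp: J2_def)
    then show False using XA2_B4[of x y a b] xa X(1) 2(1) by blast
  qed
  have Q1Q2: "anti Q1 Q2"
  proof (rule antiI)
    fix x a assume xa: "x \<in> Q1" "a \<in> Q2" "x \<sim> a"
    then obtain y a' where "y \<in> A 1" "x \<sim> y" "a' \<in> A 2" "a \<sim> a'" using 1(5)[of x] 2(5)[of a] by blast
    then show False using A_A1_edges[of x 1 y a a'] xa 1(1) 2(1) by auto
  qed
  have Q1J2: "anti Q1 J2"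
  proof (rule antiI)
    fix x a assume xa: "x \<in> Q1" "a \<in> J2" "x \<sim> a"
    then obtain y b where "y \<in> A 1" "x \<sim> y" "b \<in> B 4" "a \<sim> b" using 1(5)[of x] by (auto simp: J2_def)
    then show False using A1A2[of x y a b] xa 1(1) 2(1) by blast
  qed
  note parts = 1(1) 2(1) 4(1) X(1)
  note own = 1(2)[unfolded 1(1) anti_Un] 2(2)[unfolded 2(1) anti_Un] 4(2)[unfolded 4(1) anti_Un]
    X(2)[unfolded X(1) anti_Un]
  note own' = anti_sym[OF 1(2), unfolded 1(1) anti_Un] anti_sym[OF 2(2), unfolded 2(1) anti_Un]
    anti_sym[OF 4(2), unfolded 4(1) anti_Un] anti_sym[OF X(2), unfolded X(1) anti_Un]
  note mixed = J2 Y[unfolded 2(1) anti_Un] P2B4 P4B2 Q1B3 PXA3 YA3 P4A3 QXQ2 QXJ2 Q1Q2 Q1J2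
    AX[unfolded parts anti_Un]
  note mixed' = J2[THEN anti_sym] Y[THEN anti_sym, unfolded 2(1) anti_Un] P2B4[THEN anti_sym]
    P4B2[THEN anti_sym] Q1B3[THEN anti_sym] PXA3[THEN anti_sym] YA3[THEN anti_sym] P4A3[THEN anti_sym]
    QXQ2[THEN anti_sym] QXJ2[THEN anti_sym] Q1Q2[THEN anti_sym] Q1J2[THEN anti_sym]
    AX[THEN anti_sym, unfolded parts anti_Un]
  note facts = own own' mixed mixed' 1(3,4) 2(3,4) 4(3,4) X(3,4) A0 B14 B23 not_has_edge[OF A3]
    anti_A_A_simps[unfolded parts anti_Un] anti_A_B_simps[unfolded parts anti_Un] anti_B_B_simps
  \<comment> \<open>The vertex \<open>d\<close> gives \<open>c 1\<close> and \<open>c 4\<close> the same colour. The classes with forced colours are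
    coloured like \<open>c 1\<close>, \<open>c 2\<close>, \<open>c 3\<close>, and the hypotheses permit the colour of \<open>c 2\<close> on all of \<open>A 3\<close>.\<close>
  let ?S0 = "B 1 \<union> B 4 \<union> A 0 \<union> P2 \<union> J2'"
  let ?S1 = "B 2 \<union> PX \<union> Y \<union> (I1 \<union> P1) \<union> P4 \<union> A 3"
  let ?S2 = "B 3 \<union> QX \<union> Y' \<union> Q1 \<union> (I4 \<union> Q4) \<union> Q2 \<union> J2"
  show ?thesis
  proof (rule colourable_3I)
    show "V \<subseteq> ?S0 \<union> ?S1 \<union> ?S2"
      using cover_all X(1)[unfolded X_def] unfolding F D parts by blast
    show "anti ?S0 ?S0" by (simp only: anti_Un facts simp_thms)
    show "anti ?S1 ?S1" by (simp only: anti_Un facts simp_thms)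
    show "anti ?S2 ?S2" by (simp only: anti_Un facts simp_thms)
  qed
qed

end

section \<open>Pentagons on which only the types A and B occur\<close>

locale sparse_pentagon = dominating_pentagon +
  assumes no_hat: "\<lbrakk>a0 \<sim> a1; a1 \<sim> a2; a2 \<sim> a3; a3 \<sim> a4; a4 \<sim> a0;
      \<not> a0 \<sim> a2; \<not> a1 \<sim> a3; \<not> a2 \<sim> a4; \<not> a3 \<sim> a0; \<not> a4 \<sim> a1;
      d \<sim> a0; d \<sim> a1; d \<sim> a4; \<not> d \<sim> a2; \<not> d \<sim> a3\<rbrakk> \<Longrightarrow> False"
    and F_empty: "F i = {}"
begin

lemma D_empty: "D i = {}"
proof -
  have False if "d \<in> D i" for d
    using no_hat[of "c i" "c (i + 1)" "c (i + 2)" "c (i + 3)" "c (i + 4)" d] that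
    by (simp add: adj_c D_adj)
  then show ?thesis by blast
qed

lemma cover: "V \<subseteq> (A 0 \<union> A 1 \<union> A 2 \<union> A 3 \<union> A 4) \<union> (B 0 \<union> B 1 \<union> B 2 \<union> B 3 \<union> B 4)"
  using cover_all unfolding D_empty F_empty by blast

text \<open>The hat \<open>b'\<close> sits on the pentagon in which \<open>b\<close> replaces
  \<open>c i\<close>; this is why \<open>no_hat\<close> speaks of arbitrary pentagons.\<close>

lemma B_stable: "anti (B i) (B i)"
proof (rule antiI)
  fix b b' assume "b \<in> B i" "b' \<in> B i" "b \<sim> b'"
  then show False
    using no_hat[of b "c (i + 1)" "c (i + 2)" "c (i + 3)" "c (i + 4)" b'] adj_sym[of b b']
    by (simp add: adj_c B_adj)
qed

text \<open>With \<open>x\<close> also its twin \<open>y\<close> sees \<open>b\<close>, so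
  \<open>y\<close> is a hat on the pentagon \<open>x\<close>, \<open>b\<close>,
  \<open>c (i + 3)\<close>, \<open>c (i + 4)\<close>, \<open>c i\<close>, or on its mirror
  image.\<close>

lemma A_edge_no_B:
  assumes x: "x \<in> A i" "y \<in> A i" "x \<sim> y" and b: "b \<in> B (i + 2) \<union> B (i + 3)"
  shows "\<not> x \<sim> b"
proof
  assume xb: "x \<sim> b"
  show False
  proof (cases "b \<in> B (i + 2)")
    case True
    then have "y \<sim> b" using mixed_A_edge2 x xb by blast
    then show False
      using no_hat[of x b "c (i + 3)" "c (i + 4)" "c i" y] x xb True adj_commute[of y x] adj_commute[of b x]
      by (simp add: adj_c A_adj B_adj)
  next
    case False
    then have b: "b \<in> B (i + 3)" using b by blast
    then have "y \<sim> b" using mixed_A_edge3 x xb by blast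
    then show False
      using no_hat[of x b "c (i + 2)" "c (i + 1)" "c i" y] x xb b adj_commute[of y x] adj_commute[of b x]
      by (simp add: adj_c A_adj B_adj)
  qed
qed

lemma A_split_sparse:
  obtains I P Q where "A i = I \<union> P \<union> Q" "anti I I" "anti I P" "anti P I" "anti I Q" "anti Q I"
    "anti P P" "anti Q Q"
    "anti P (B (i + 2))" "anti P (B (i + 3))" "anti (B (i + 2)) P" "anti (B (i + 3)) P"
    "anti Q (B (i + 2))" "anti Q (B (i + 3))" "anti (B (i + 2)) Q" "anti (B (i + 3)) Q"
    "has_edge i \<or> P = {} \<and> Q = {}"
proof -
  obtain I P Q where A: "A i = I \<union> P \<union> Q" "anti I (A i)" "anti P P" "anti Q Q"
    "\<And>x. x \<in> P \<union> Q \<Longrightarrow> \<exists>y \<in> A i. x \<sim> y"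
    using A_split[of i] by metis
  have RB: "anti R (B (i + 2))" "anti R (B (i + 3))" "anti (B (i + 2)) R" "anti (B (i + 3)) R"
    if "R \<subseteq> P \<union> Q" for R
  proof -
    have "\<not> x \<sim> b" if x: "x \<in> R" "b \<in> B (i + 2) \<union> B (i + 3)" for x b
    proof -
      have "x \<in> P \<union> Q" using x \<open>R \<subseteq> P \<union> Q\<close> by blast
      then show ?thesis using A(1) A(5)[of x] A_edge_no_B x by blast
    qed
    then show "anti R (B (i + 2))" "anti R (B (i + 3))" "anti (B (i + 2)) R" "anti (B (i + 3)) R"
      using adj_sym unfolding anti_def by blast+
  qed
  have "has_edge i \<or> P = {} \<and> Q = {}"
    using A(1,5) unfolding has_edge_def by blast
  moreover have "anti I I" "anti I P" "anti P I" "anti I Q" "anti Q I"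
    using A(2)[unfolded A(1)] anti_sym[OF A(2)[unfolded A(1)]] by (simp_all add: anti_Un)
  ultimately show ?thesis
    using A(1,3,4) RB[of P] RB[of Q] by (intro that[of I P Q]) simp_all
qed

text \<open>\<open>A 0\<close> is completely adjacent to \<open>A 1\<close> and \<open>A 4\<close>,
  so its parts may share a class with \<open>Q1\<close> or \<open>Q4\<close> only if those are
  empty; the last hypothesis ensures this when \<open>A 0\<close> is inhabited.\<close>

lemma colourable_centre:
  assumes A23: "\<not> has_edge 2" "\<not> has_edge 3"
    and A0: "A 0 = {} \<or> \<not> has_edge 1 \<and> \<not> has_edge 4"
  shows "colourable_on 3 V"
proof -
  obtain I0 P0 Q0 where 0: "A 0 = I0 \<union> P0 \<union> Q0" "anti I0 I0" "anti I0 P0" "anti P0 I0" "anti I0 Q0"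
    "anti Q0 I0" "anti P0 P0" "anti Q0 Q0" "anti P0 (B 3)" "anti (B 3) P0" "anti Q0 (B 2)" "anti (B 2) Q0"
    using A_split_sparse[of 0, simplified] by metis
  obtain I1 P1 Q1 where 1: "A 1 = I1 \<union> P1 \<union> Q1" "anti I1 I1" "anti I1 P1" "anti P1 I1" "anti I1 Q1"
    "anti Q1 I1" "anti P1 P1" "anti Q1 Q1" "anti Q1 (B 4)" "anti (B 4) Q1" "has_edge 1 \<or> P1 = {} \<and> Q1 = {}"
    using A_split_sparse[of 1, simplified] by metis
  obtain I4 P4 Q4 where 4: "A 4 = I4 \<union> P4 \<union> Q4" "anti I4 I4" "anti I4 P4" "anti P4 I4" "anti I4 Q4"
    "anti Q4 I4" "anti P4 P4" "anti Q4 Q4" "anti Q4 (B 1)" "anti (B 1) Q4" "has_edge 4 \<or> P4 = {} \<and> Q4 = {}"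
    using A_split_sparse[of 4, simplified] by metis
  have empty: "A 0 = {} \<or> Q1 = {} \<and> Q4 = {}" using A0 1 4 by blast
  \<comment> \<open>\<open>B 2\<close> may conflict with \<open>A 0\<close> and with
    \<open>A 4\<close>, but by \<open>A_A1_B3\<close> no single vertex does with both; each part
    joins the class it misses.\<close>
  define B2 where "B2 = {b \<in> B 2. \<exists>a \<in> A 0. a \<sim> b}"
  define B2' where "B2' = B 2 - B2"
  have B2: "B 2 = B2 \<union> B2'" by (auto simp: B2_def B2'_def)
  have B2A0: "anti B2' (A 0)" "anti (A 0) B2'" using adj_sym by (auto simp: anti_def B2_def B2'_def)
  have A01: "anti (A 0) Q1" "anti Q1 (A 0)" "anti (A 0) Q4" "anti Q4 (A 0)"
    using empty by (auto simp: anti_def)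
  have B2A4: "anti B2 (A 4)" "anti (A 4) B2"
  proof -
    have "\<not> b \<sim> x" if b: "b \<in> B2" and x: "x \<in> A 4" for b x
    proof
      assume "b \<sim> x"
      obtain a where a: "a \<in> A 0" "a \<sim> b" "b \<in> B 2" using b by (auto simp: B2_def)
      then have "x \<sim> a" using A_A1[of x 4 a] x by simp
      then show False using A_A1_B3[of x 4 a b] x a \<open>b \<sim> x\<close> adj_sym by auto
    qed
    then show "anti B2 (A 4)" "anti (A 4) B2" using adj_sym by (auto simp: anti_def)
  qed
  have A23: "anti (A 2) (A 2)" "anti (A 3) (A 3)" using A23 not_has_edge by auto
  have sub: "anti S' T'" if "anti S T" "S' \<subseteq> S" "T' \<subseteq> T" for S T S' T' using anti_mono that .
  show ?thesis
  proof (rule colourable_3I)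
    show "V \<subseteq> (B 0 \<union> B2 \<union> (I1 \<union> P1) \<union> (I4 \<union> P4)) \<union> (B 1 \<union> B 3 \<union> P0 \<union> Q4 \<union> A 2)
        \<union> (B 4 \<union> B2' \<union> (I0 \<union> Q0) \<union> Q1 \<union> A 3)"
      using cover 0(1) 1(1) 4(1) B2 by blast
    note AA = anti_A_A_simps[unfolded 0(1) 1(1) 4(1) anti_Un]
    note AB = anti_A_B_simps[unfolded 0(1) 1(1) 4(1) B2 anti_Un]
    note BB = anti_B_B_simps[unfolded B2 anti_Un]
    note st = B_stable[of 0] B_stable[of 1] B_stable[of 3] B_stable[of 4] B_stable[of 2, unfolded B2 anti_Un]
    note facts = 0 1 4 A23 B2A0[unfolded 0(1) anti_Un] B2A4[unfolded 4(1) anti_Un] A01[unfolded 0(1) anti_Un]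
      AA AB BB st
    show "anti (B 0 \<union> B2 \<union> (I1 \<union> P1) \<union> (I4 \<union> P4)) (B 0 \<union> B2 \<union> (I1 \<union> P1) \<union> (I4 \<union> P4))"
      by (simp only: anti_Un facts simp_thms)
    show "anti (B 1 \<union> B 3 \<union> P0 \<union> Q4 \<union> A 2) (B 1 \<union> B 3 \<union> P0 \<union> Q4 \<union> A 2)"
      by (simp only: anti_Un facts simp_thms)
    show "anti (B 4 \<union> B2' \<union> (I0 \<union> Q0) \<union> Q1 \<union> A 3) (B 4 \<union> B2' \<union> (I0 \<union> Q0) \<union> Q1 \<union> A 3)"
      by (simp only: anti_Un facts simp_thms)
  qed
qed

lemma colourable_two_edges_aux:
  assumes e1: "has_edge 1" and e4: "has_edge 4" and A0: "A 0 \<noteq> {}" and A2: "A 2 = {}"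
  shows "colourable_on 3 V"
proof -
  obtain I1 P1 Q1 where 1: "A 1 = I1 \<union> P1 \<union> Q1" "anti I1 I1" "anti I1 P1" "anti P1 I1"
    "anti P1 P1" "anti Q1 Q1" "anti Q1 (B 3)" "anti (B 3) Q1"
    using A_split_sparse[of 1, simplified] by metis
  obtain I4 P4 Q4 where 4: "A 4 = I4 \<union> P4 \<union> Q4" "anti I4 I4" "anti I4 Q4" "anti Q4 I4"
    "anti P4 P4" "anti Q4 Q4" "anti P4 (B 2)" "anti (B 2) P4"
    using A_split_sparse[of 4, simplified] by metis
  have "\<not> has_edge 0" using has_edge_next[of 0] e1 by auto
  moreover have "\<not> has_edge 3" using has_edge_next[of 3] e4 by auto
  ultimately have A03: "anti (A 0) (A 0)" "anti (A 3) (A 3)" using not_has_edge by auto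
  obtain x y where xy: "x \<in> A 1" "y \<in> A 1" "x \<sim> y" using e1 by (auto simp: has_edge_def)
  obtain z w where zw: "z \<in> A 4" "w \<in> A 4" "z \<sim> w" using e4 by (auto simp: has_edge_def)
  obtain a where a: "a \<in> A 0" using A0 by blast
  \<comment> \<open>The diamonds over \<open>x y\<close> and \<open>z w\<close> meet in
    \<open>a\<close> and have other ends \<open>b\<close> and \<open>u\<close>.\<close>
  have "\<not> b \<sim> u" if "b \<in> B 1" "u \<in> A 3" for b u
  proof
    assume "b \<sim> u"
    have "x \<sim> b" "y \<sim> b" using A_B0 xy that by blast+
    moreover have "a \<sim> x" "a \<sim> y" using A_A1[of a 0] a xy by auto
    moreover have "z \<sim> a" "w \<sim> a" using A_A1[of _ 4 a] a zw by auto
    moreover have "u \<sim> z" "u \<sim> w" using A_A1[of u 3] that zw by auto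
    ultimately show False using no_M7[of b x y a z w u] xy zw \<open>b \<sim> u\<close> adj_sym by blast
  qed
  then have B1A3: "anti (B 1) (A 3)" "anti (A 3) (B 1)" using adj_sym by (auto simp: anti_def)
  show ?thesis
  proof (rule colourable_3I)
    show "V \<subseteq> (B 4 \<union> B 1 \<union> A 0 \<union> A 3) \<union> (B 0 \<union> B 2 \<union> P4 \<union> (I1 \<union> P1)) \<union> (B 3 \<union> (I4 \<union> Q4) \<union> Q1)"
      using cover 1(1) 4(1) A2 by blast
    note AA = anti_A_A_simps[unfolded 1(1) 4(1) anti_Un]
    note AB = anti_A_B_simps[unfolded 1(1) 4(1) anti_Un]
    note facts = 1 4 A03 B1A3 AA AB anti_B_B_simps B_stable
    show "anti (B 4 \<union> B 1 \<union> A 0 \<union> A 3) (B 4 \<union> B 1 \<union> A 0 \<union> A 3)"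
      by (simp only: anti_Un facts simp_thms)
    show "anti (B 0 \<union> B 2 \<union> P4 \<union> (I1 \<union> P1)) (B 0 \<union> B 2 \<union> P4 \<union> (I1 \<union> P1))"
      by (simp only: anti_Un facts simp_thms)
    show "anti (B 3 \<union> (I4 \<union> Q4) \<union> Q1) (B 3 \<union> (I4 \<union> Q4) \<union> Q1)"
      by (simp only: anti_Un facts simp_thms)
  qed
qed

end

section \<open>Rotations and reflections of a pentagon\<close>

lemma (in pentagon) shift: "pentagon V adj (\<lambda>j. c (i + j))"
  by unfold_locales (rule induced_cycle_shift[OF cycle])

lemma (in pentagon) reflect: "pentagon V adj (\<lambda>j. c (- j))"
  by unfold_locales (use induced_cycle_reflect[OF cycle, of 0] in simp)

lemma (in pentagon) shift_classes:
  shows "pentagon.A adj (\<lambda>j. c (i + j)) k = A (i + k)" "pentagon.F adj (\<lambda>j. c (i + j)) k = F (i + k)"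
    "pentagon.D adj (\<lambda>j. c (i + j)) k = D (i + k)"
proof -
  interpret s: pentagon V adj "\<lambda>j. c (i + j)" by (rule shift)
  have *: "(\<forall>j. v \<sim> c (i + j) \<longleftrightarrow> Q (j - k)) \<longleftrightarrow> (\<forall>j. v \<sim> c j \<longleftrightarrow> Q (j - (i + k)))" for v Q
  proof (rule iffI; rule allI)
    fix j assume "\<forall>j. v \<sim> c (i + j) \<longleftrightarrow> Q (j - k)"
    from this[rule_format, of "j - i"] show "v \<sim> c j \<longleftrightarrow> Q (j - (i + k))" by (simp add: diff_diff_eq)
  next
    fix j assume "\<forall>j. v \<sim> c j \<longleftrightarrow> Q (j - (i + k))"
    from this[rule_format, of "i + j"] show "v \<sim> c (i + j) \<longleftrightarrow> Q (j - k)" by simp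
  qed
  show "s.A k = A (i + k)" unfolding s.A_def A_def using *[of _ "\<lambda>e. 5 dvd e"] by simp
  show "s.F k = F (i + k)" unfolding s.F_def F_def using *[of _ "\<lambda>e. \<not> 5 dvd e"] by simp
  show "s.D k = D (i + k)" unfolding s.D_def D_def
    using *[of _ "\<lambda>e. 5 dvd e \<or> 5 dvd (e - 1) \<or> 5 dvd (e + 1)"] by simp
qed

lemma (in pentagon) reflect_classes:
  shows "pentagon.A adj (\<lambda>j. c (- j)) k = A (- k)" "pentagon.B adj (\<lambda>j. c (- j)) k = B (- k)"
    "pentagon.D adj (\<lambda>j. c (- j)) k = D (- k)" "pentagon.F adj (\<lambda>j. c (- j)) k = F (- k)"
proof -
  interpret s: pentagon V adj "\<lambda>j. c (- j)" by (rule reflect)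
  have *: "(\<forall>j. v \<sim> c (- j) \<longleftrightarrow> Q (j - k)) \<longleftrightarrow> (\<forall>j. v \<sim> c j \<longleftrightarrow> Q (- (j - (- k))))" for v Q
  proof (rule iffI; rule allI)
    fix j assume "\<forall>j. v \<sim> c (- j) \<longleftrightarrow> Q (j - k)"
    from this[rule_format, of "- j"] show "v \<sim> c j \<longleftrightarrow> Q (- (j - (- k)))" by (simp add: algebra_simps)
  next
    fix j assume "\<forall>j. v \<sim> c j \<longleftrightarrow> Q (- (j - (- k)))"
    from this[rule_format, of "- j"] show "v \<sim> c (- j) \<longleftrightarrow> Q (j - k)" by simp
  qed
  have m: "5 dvd (- e - 1) \<longleftrightarrow> 5 dvd (e + 1)" "5 dvd (- e + 1) \<longleftrightarrow> 5 dvd (e - 1)" for e :: int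
    by presburger+
  show "s.A k = A (- k)" unfolding s.A_def A_def *[of _ "\<lambda>e. 5 dvd e"] dvd_minus_iff ..
  show "s.F k = F (- k)" unfolding s.F_def F_def *[of _ "\<lambda>e. \<not> 5 dvd e"] dvd_minus_iff ..
  show "s.B k = B (- k)" unfolding s.B_def B_def *[of _ "\<lambda>e. 5 dvd (e - 1) \<or> 5 dvd (e + 1)"] m
    by (simp only: disj_commute)
  show "s.D k = D (- k)"
    unfolding s.D_def D_def *[of _ "\<lambda>e. 5 dvd e \<or> 5 dvd (e - 1) \<or> 5 dvd (e + 1)"] m dvd_minus_iff
    by (simp only: disj_commute disj_left_commute)
qed

context dominating_pentagon
begin

lemma shift_dominating: "dominating_pentagon V adj (\<lambda>j. c (i + j))"
proof -
  interpret s: pentagon V adj "\<lambda>j. c (i + j)" by (rule shift)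
  have "\<exists>j. v \<sim> c (i + j)" if v: "v \<in> V" for v
  proof -
    obtain k where "v \<sim> c k" using dominating[OF v] by blast
    then have "v \<sim> c (i + (k - i))" by simp
    then show ?thesis ..
  qed
  then show ?thesis by unfold_locales
qed

lemma reflect_dominating: "dominating_pentagon V adj (\<lambda>j. c (- j))"
proof -
  interpret s: pentagon V adj "\<lambda>j. c (- j)" by (rule reflect)
  have "\<exists>j. v \<sim> c (- j)" if v: "v \<in> V" for v
  proof -
    obtain k where "v \<sim> c k" using dominating[OF v] by blast
    then have "v \<sim> c (- (- k))" by simp
    then show ?thesis ..
  qed
  then show ?thesis by unfold_locales
qed

text \<open>If no colouring exists, \<open>colourable_D_aux\<close> fails both for the pentagon and
  for its reflection, which leaves three cases on each side.\<close>

lemma colourable_D: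
  assumes d: "d \<in> D 0"
  shows "colourable_on 3 V"
proof (rule ccontr)
  assume not_col: "\<not> colourable_on 3 V"
  interpret r: dominating_pentagon V adj "\<lambda>j. c (- j)" by (rule reflect_dominating)
  have r: "r.A k = A (- k)" "r.B k = B (- k)" "r.D k = D (- k)" "r.has_edge k \<longleftrightarrow> has_edge (- k)" for k
    by (simp_all add: reflect_classes r.has_edge_def has_edge_def)
  have e: "has_edge (- 3) \<longleftrightarrow> has_edge 2" "has_edge (- 4) \<longleftrightarrow> has_edge 1"
    by (simp_all add: has_edge_def)
  have XA2: "x \<in> B 0 \<and> y \<in> B 0 \<and> y \<sim> a"
    if "x \<in> B 0 \<union> D 0" "y \<in> B 0 \<union> D 0" "x \<sim> y" "a \<in> A 2" "x \<sim> a" for x y a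
  proof -
    have ax: "a \<sim> x" using that adj_sym by blast
    have x: "x \<in> B 0" using A_D3[of a 2 x] that ax by auto
    have "y \<notin> D 0" using A_B3_D3[of a 2 x y] x that ax by auto
    then have y: "y \<in> B 0" using that by auto
    show ?thesis using mixed_B_edge3[of x 2 y a] x y that ax adj_sym by simp
  qed
  have XA3: "x \<in> B 0 \<and> y \<in> B 0 \<and> y \<sim> a"
    if "x \<in> B 0 \<union> D 0" "y \<in> B 0 \<union> D 0" "x \<sim> y" "a \<in> A 3" "x \<sim> a" for x y a
  proof -
    have ax: "a \<sim> x" using that adj_sym by blast
    have x: "x \<in> B 0" using A_D2[of a 3 x] that ax by auto
    have "y \<notin> D 0" using A_B2_D2[of a 3 x y] x that ax by auto
    then have y: "y \<in> B 0" using that by auto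
    show ?thesis using mixed_B_edge2[of x 3 y a] x y that ax adj_sym by simp
  qed
  have dc: "c 0 \<sim> d" "d \<sim> c 1" "d \<sim> c 4" "c 1 \<sim> d" "c 4 \<sim> d" using d by (simp_all add: D_adj)
  have dne: "d \<noteq> c j" for j
  proof
    assume "d = c j"
    then have "c j \<sim> c 0" "c j \<sim> c 1" using dc adj_sym by auto
    then show False unfolding adj_c by presburger
  qed
  have dA: "d \<noteq> x" if "x \<in> A i" for x i
  proof
    assume "d = x"
    then have "x \<sim> c 0" "x \<sim> c 1" using dc adj_sym by auto
    then show False unfolding A_adj(1)[OF that] by presburger
  qed
  have A12: "x \<sim> y" if "x \<in> A 1" "y \<in> A 2" for x y using A_A1[of x 1 y] that by simp
  have A23: "x \<sim> y" if "x \<in> A 2" "y \<in> A 3" for x y using A_A1[of x 2 y] that by simp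
  have A34: "x \<sim> y" if "x \<in> A 3" "y \<in> A 4" for x y using A_A1[of x 3 y] that by simp
  have cycle: "c 0 \<sim> c 1" "c 1 \<sim> c 2" "c 2 \<sim> c 3" "c 3 \<sim> c 4" "c 4 \<sim> c 0" by (simp_all add: adj_c)
  have Ac: "x \<sim> c i" if "x \<in> A i" for x i using that by (simp add: A_adj)
  have Bc: "x \<sim> c 1" "x \<sim> c 4" if "x \<in> B 0" for x using that by (simp_all add: B_adj)
  have An: "v \<noteq> c j \<and> c j \<noteq> v \<and> d \<noteq> v \<and> v \<noteq> d" if "v \<in> A i" for v i j
    using A_neq[OF that, of j] dA[OF that] by auto
  have AA: "\<not> 5 dvd (i - j) \<Longrightarrow> v \<noteq> w \<and> w \<noteq> v" if "v \<in> A i" "w \<in> A j" for v w i j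
    using A_disjoint[OF that] by auto
  note distinct_simps = eq_c dne dne[symmetric]
  note sym = adj_sym
  \<comment> \<open>Each case is a diamond that propagates a colour: \<open>e3\<close> between
    \<open>c 3\<close> and a vertex of \<open>A 2\<close>, \<open>e4\<close> between
    \<open>c 4\<close> and \<open>a\<close>, \<open>x3\<close> between \<open>c 1\<close> or
    \<open>c 4\<close> and \<open>a\<close>. Combined with a mirror case, and where necessary with
    the diamond \<open>c 1\<close>, \<open>c 0\<close>, \<open>d\<close>, \<open>c 4\<close>, they
    close up to a K4, an M7 or an M10.\<close>
  consider (e3) a b where "a \<in> A 3" "b \<in> A 3" "a \<sim> b"
    | (e4) a x y where "a \<in> A 3" "x \<in> A 4" "y \<in> A 4" "x \<sim> y"
    | (x3) a x y where "a \<in> A 3" "x \<in> B 0" "y \<in> B 0" "x \<sim> y" "x \<sim> a" "y \<sim> a"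
    using colourable_D_aux[OF d] not_col XA3 unfolding has_edge_def by blast
  note right = this
  have r3: "r.has_edge 3 \<longleftrightarrow> has_edge 2" "r.has_edge 4 \<longleftrightarrow> has_edge 1" "r.A 3 = A 2" "r.B 0 = B 0" "r.D 0 = D 0"
    using r e by simp_all
  have "d \<in> r.D 0" using d by (simp only: r3)
  note aux' = r.colourable_D_aux[OF this, unfolded r3]
  consider (e2) a b where "a \<in> A 2" "b \<in> A 2" "a \<sim> b"
    | (e1) a x y where "a \<in> A 2" "x \<in> A 1" "y \<in> A 1" "x \<sim> y"
    | (x2) a x y where "a \<in> A 2" "x \<in> B 0" "y \<in> B 0" "x \<sim> y" "x \<sim> a" "y \<sim> a"
    using aux' not_col XA2 unfolding has_edge_def by blast
  note left = this
  show False
    using right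
  proof cases
    case (e3 a b)
    note R = this
    show False
      using left
    proof cases
      case (e2 u v)
      then show False using A_A1_edges[of u 2 v a b] R by simp
    next
      case (e1 u x y)
      show False
      proof (rule no_M10[of "c 4" "c 0" d "c 1" x y u a b "c 3"])
        show "distinct [c 4, c 0, d, c 1, x, y, u, a, b, c 3]"
          using adj_neq[OF R(3)] adj_neq[OF e1(4)]
          by (simp add: distinct_simps An[OF R(1)] An[OF R(2)] An[OF e1(1)] An[OF e1(2)] An[OF e1(3)]
              AA[OF R(1) e1(1)] AA[OF R(1) e1(2)] AA[OF R(1) e1(3)] AA[OF R(2) e1(1)] AA[OF R(2) e1(2)] AA[OF R(2) e1(3)] AA[OF e1(1) e1(2)] AA[OF e1(1) e1(3)])
      qed (use R e1 dc cycle A12 A23 Ac sym in blast)+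
    next
      case (x2 u x y)
      show False
        by (rule no_M7[of "c 4" x y u a b "c 3"]) (use R x2 cycle A23 Ac Bc sym in blast)+
    qed
  next
    case (e4 a z w)
    note R = this
    show False
      using left
    proof cases
      case (e2 u v)
      show False
      proof (rule no_M10[of "c 1" "c 0" d "c 4" z w a u v "c 2"])
        show "distinct [c 1, c 0, d, c 4, z, w, a, u, v, c 2]"
          using adj_neq[OF R(4)] adj_neq[OF e2(3)]
          by (simp add: distinct_simps An[OF R(1)] An[OF R(2)] An[OF R(3)] An[OF e2(1)] An[OF e2(2)]
              AA[OF R(1) e2(1)] AA[OF R(1) e2(2)] AA[OF R(2) e2(1)] AA[OF R(2) e2(2)] AA[OF R(3) e2(1)] AA[OF R(3) e2(2)] AA[OF R(1) R(2)] AA[OF R(1) R(3)])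
      qed (use R e2 dc cycle A34 A23 Ac sym in blast)+
    next
      case (e1 u x y)
      show False
      proof (rule no_M10[of u x y "c 1" "c 0" d "c 4" z w a])
        show "distinct [u, x, y, c 1, c 0, d, c 4, z, w, a]"
          using adj_neq[OF R(4)] adj_neq[OF e1(4)]
          by (simp add: distinct_simps An[OF R(1)] An[OF R(2)] An[OF R(3)] An[OF e1(1)] An[OF e1(2)] An[OF e1(3)]
              AA[OF R(1) e1(1)] AA[OF R(1) e1(2)] AA[OF R(1) e1(3)] AA[OF R(2) e1(1)] AA[OF R(2) e1(2)] AA[OF R(2) e1(3)] AA[OF R(3) e1(1)] AA[OF R(3) e1(2)] AA[OF R(3) e1(3)] AA[OF R(1) R(2)] AA[OF R(1) R(3)] AA[OF e1(1) e1(2)] AA[OF e1(1) e1(3)])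
      qed (use R e1 dc cycle A34 A12 A23 Ac sym in blast)+
    next
      case (x2 u x y)
      show False
        by (rule no_M7[of u x y "c 4" z w a]) (use R x2 cycle A34 A23 Ac Bc sym in blast)+
    qed
  next
    case (x3 a z w)
    note R = this
    show False
      using left
    proof cases
      case (e2 u v)
      show False
        by (rule no_M7[of "c 1" z w a u v "c 2"]) (use R e2 cycle A23 Ac Bc sym in blast)+
    next
      case (e1 u x y)
      show False
        by (rule no_M7[of a z w "c 1" x y u]) (use R e1 cycle A12 A23 Ac Bc sym in blast)+
    next
      case (x2 u x y)
      show False
        by (rule no_M7[of u x y "c 1" z w a]) (use R x2 cycle A23 Ac Bc sym in blast)+
    qed
  qed
qed

end

context sparse_pentagon
begin

lemma shift_sparse: "sparse_pentagon V adj (\<lambda>j. c (i + j))"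
proof -
  interpret s: dominating_pentagon V adj "\<lambda>j. c (i + j)" by (rule shift_dominating)
  show ?thesis by unfold_locales (rule no_hat, assumption+, simp add: shift_classes F_empty)
qed

lemma reflect_sparse: "sparse_pentagon V adj (\<lambda>j. c (- j))"
proof -
  interpret s: dominating_pentagon V adj "\<lambda>j. c (- j)" by (rule reflect_dominating)
  show ?thesis by unfold_locales (rule no_hat, assumption+, simp add: reflect_classes F_empty)
qed

lemma colourable_two_edges:
  assumes e: "has_edge 1" "has_edge 4" and A0: "A 0 \<noteq> {}"
  shows "colourable_on 3 V"
proof (cases "A 2 = {}")
  case True
  then show ?thesis using colourable_two_edges_aux assms by blast
next
  case False
  then obtain u where u: "u \<in> A 2" by blast
  obtain x y where xy: "x \<in> A 1" "y \<in> A 1" "x \<sim> y" using e(1) by (auto simp: has_edge_def)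
  obtain z w where zw: "z \<in> A 4" "w \<in> A 4" "z \<sim> w" using e(2) by (auto simp: has_edge_def)
  obtain a where a: "a \<in> A 0" using A0 by blast
  \<comment> \<open>With \<open>A 2\<close> and \<open>A 3\<close> both inhabited, the edge
    \<open>u v\<close> closes the chain of the diamonds over \<open>x y\<close> and
    \<open>z w\<close>. Hence reflection reduces to the case that \<open>A 2\<close> is
    empty.\<close>
  have A3: "A 3 = {}"
  proof (rule ccontr)
    assume "A 3 \<noteq> {}"
    then obtain v where v: "v \<in> A 3" by blast
    have "x \<sim> u" "y \<sim> u" "u \<sim> v" "v \<sim> z" "v \<sim> w" "z \<sim> a" "w \<sim> a" "a \<sim> x" "a \<sim> y"
      using A_A1[of _ 1 u] A_A1[of u 2 v] A_A1[of v 3] A_A1[of _ 4 a] A_A1[of a 0] xy zw a u v by auto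
    then show False using no_M7[of u x y a z w v] xy zw adj_sym by blast
  qed
  interpret r: sparse_pentagon V adj "\<lambda>j. c (- j)" by (rule reflect_sparse)
  have r: "r.A k = A (- k)" for k by (simp add: reflect_classes)
  show ?thesis
    by (rule r.colourable_two_edges_aux) (use e A0 A3 in \<open>simp_all add: r r.has_edge_def has_edge_def\<close>)
qed

text \<open>The indices of the sets \<open>A i\<close> that contain edges are pairwise
  nonconsecutive on the pentagon, so there are at most two. A single one is taken as the centre
  \<open>i\<close>; two are \<open>i + 1\<close> and \<open>i + 4\<close> for a suitable
  \<open>i\<close>, and then it matters whether \<open>A i\<close> is empty.\<close>

lemma colourable: "colourable_on 3 V"
proof -
  have centre: ?thesis
    if "\<not> has_edge (i + 2)" "\<not> has_edge (i + 3)"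
      "A i = {} \<or> \<not> has_edge (i + 1) \<and> \<not> has_edge (i + 4) \<or> has_edge (i + 1) \<and> has_edge (i + 4)" for i
  proof -
    interpret s: sparse_pentagon V adj "\<lambda>j. c (i + j)" by (rule shift_sparse)
    have s: "s.A k = A (i + k)" "s.has_edge k \<longleftrightarrow> has_edge (i + k)" for k
      by (simp_all add: shift_classes s.has_edge_def has_edge_def)
    show ?thesis
      using s.colourable_centre s.colourable_two_edges that unfolding s by auto
  qed
  have wrap_edge: "has_edge 5 \<longleftrightarrow> has_edge 0" "has_edge 6 \<longleftrightarrow> has_edge 1" "has_edge 7 \<longleftrightarrow> has_edge 2"
    "has_edge 8 \<longleftrightarrow> has_edge 3"
    by (simp_all add: has_edge_def)
  show ?thesis
    using centre[of 0] centre[of 1] centre[of 2] centre[of 3] centre[of 4]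
      has_edge_next[of 0] has_edge_next[of 1] has_edge_next[of 2] has_edge_next[of 3] has_edge_next[of 4]
    by (simp add: wrap_edge) blast
qed

end

section \<open>From graphs to digraphs\<close>

context critical_graph
begin

text \<open>Otherwise some edge \<open>x y\<close> leaves the set of vertices that see the pentagon.
  For the types A and B of \<open>x\<close> it completes an E, for D and F a bull with pendant
  \<open>y\<close>.\<close>

lemma pentagon_dominating:
  assumes c: "induced_cycle 5 c" and v: "v \<in> V"
  shows "\<exists>i. v \<sim> c i"
proof -
  interpret p: pentagon V adj c by unfold_locales (rule c)
  define Z where "Z = {v \<in> V. \<exists>i. v \<sim> c i}"
  have "Z = V"
  proof (rule ccontr)
    assume "Z \<noteq> V"
    moreover have "c 0 \<sim> c 1" by (simp add: p.adj_c)
    then have "c 0 \<in> Z" using adj_V by (auto simp: Z_def)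
    moreover have "Z \<subseteq> V" by (auto simp: Z_def)
    ultimately obtain x y where xy: "x \<in> Z" "y \<in> V - Z" "x \<sim> y"
      using edge_leaving[of Z] by blast
    have y: "\<not> y \<sim> c k" "\<not> c k \<sim> y" for k using xy adj_sym by (auto simp: Z_def)
    obtain k where "x \<sim> c k" using xy by (auto simp: Z_def)
    then obtain i where "x \<in> p.A i \<or> x \<in> p.B i \<or> x \<in> p.D i \<or> x \<in> p.F i"
      using p.classes by blast
    then show False
    proof (elim disjE)
      assume x: "x \<in> p.A i"
      show False
        using no_E[of "c i" "c (i + 4)" x y "c (i + 1)" "c (i + 2)"] xy(3) y
        by (simp add: p.adj_c p.A_adj[OF x])
    next
      assume x: "x \<in> p.B i"
      show False
        using no_E[of "c (i + 1)" "c i" x y "c (i + 2)" "c (i + 3)"] xy(3) y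
        by (simp add: p.adj_c p.B_adj[OF x])
    next
      assume x: "x \<in> p.D i"
      show False
        using no_bull[of y x "c i" "c (i + 1)" "c (i + 2)"] xy(3) adj_sym[OF xy(3)] y
        by (simp add: p.adj_c p.D_adj[OF x])
    next
      assume x: "x \<in> p.F i"
      show False
        using no_bull[of y x "c (i + 2)" "c (i + 1)" "c i"] xy(3) adj_sym[OF xy(3)] y
        by (simp add: p.adj_c p.F_adj[OF x])
    qed
  qed
  then show ?thesis using v by (auto simp: Z_def)
qed

lemma dominating_pentagonI: "induced_cycle 5 c \<Longrightarrow> dominating_pentagon V adj c"
  by unfold_locales (auto intro: pentagon_dominating)

text \<open>The facts \<open>F\<close> and \<open>hat\<close> are proved for every pentagon before
  \<open>c\<close> is examined; for \<open>hat\<close> this generality is what \<open>no_hat\<close>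
  demands.\<close>

lemma no_pentagon: "\<not> induced_cycle 5 c"
proof
  assume c: "induced_cycle 5 c"
  have F: "pentagon.F adj c' i = {}" if c': "induced_cycle 5 c'" for c' i
  proof (rule ccontr)
    assume "pentagon.F adj c' i \<noteq> {}"
    then obtain f where f: "f \<in> pentagon.F adj c' i" by blast
    interpret p: dominating_pentagon V adj c' by (rule dominating_pentagonI[OF c'])
    interpret s: dominating_pentagon V adj "\<lambda>j. c' (i + j)" by (rule p.shift_dominating)
    have "f \<in> s.F 0" using f by (simp add: p.shift_classes)
    then show False using s.colourable_F not_colourable by blast
  qed
  have hat: False
    if "a0 \<sim> a1" "a1 \<sim> a2" "a2 \<sim> a3" "a3 \<sim> a4" "a4 \<sim> a0"
      "\<not> a0 \<sim> a2" "\<not> a1 \<sim> a3" "\<not> a2 \<sim> a4" "\<not> a3 \<sim> a0" "\<not> a4 \<sim> a1"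
      and d: "d \<sim> a0" "d \<sim> a1" "d \<sim> a4" "\<not> d \<sim> a2" "\<not> d \<sim> a3" for a0 a1 a2 a3 a4 d
  proof -
    note cyc = that(1-10)
    obtain c' where c': "induced_cycle 5 c'" and a: "c' 0 = a0" "c' 1 = a1" "c' 2 = a2" "c' 3 = a3" "c' 4 = a4"
      using induced_cycle_5I[OF cyc] by blast
    interpret p: dominating_pentagon V adj c' by (rule dominating_pentagonI[OF c'])
    have "d \<in> p.D 0" using d by (simp add: p.class_iff a)
    then show False using p.colourable_D not_colourable by blast
  qed
  interpret p: dominating_pentagon V adj c by (rule dominating_pentagonI[OF c])
  interpret p: sparse_pentagon V adj c
    by unfold_locales (erule (14) hat, rule F[OF c])
  show False using p.colourable not_colourable by blast
qed

lemma contradiction: False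
proof (cases "\<exists>n c. odd n \<and> n \<ge> 5 \<and> induced_cycle n c")
  case True
  then obtain n c where c: "odd n" "n \<ge> 5" "induced_cycle n c" by blast
  then have "n \<noteq> 5" "n \<noteq> 6" using no_pentagon by auto
  then interpret long_hole V adj n c
    by unfold_locales (use c no_pentagon in auto)
  show False by (rule contradiction)
next
  case False
  then interpret critical_no_hole V adj by unfold_locales blast
  show False by (rule contradiction)
qed

end

text \<open>A non-colourable vertex set \<open>W\<close> of least size is critical. Adjacency is
  restricted along with it because \<open>adj_V\<close> ties adjacency to the vertex set; all
  forbidden configurations are inherited.\<close>

lemma (in forbidden_graph) colourable: "colourable_on 3 V"
proof (rule ccontr)
  assume "\<not> ?thesis"
  then have ex: "V \<subseteq> V \<and> \<not> colourable_on 3 V" by simp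
  obtain W where W: "W \<subseteq> V" "\<not> colourable_on 3 W"
    and min: "\<And>W'. W' \<subseteq> V \<Longrightarrow> \<not> colourable_on 3 W' \<Longrightarrow> card W \<le> card W'"
    using ex_has_least_nat[of "\<lambda>W. W \<subseteq> V \<and> \<not> colourable_on 3 W" V card] ex by blast
  have smaller: "colourable_on 3 W'" if "W' \<subset> W" for W'
    using min[of W'] psubset_card_mono[OF finite_subset[OF W(1) finite_V] that] that W(1) by auto
  define adj' where "adj' x y \<longleftrightarrow> x \<in> W \<and> y \<in> W \<and> x \<sim> y" for x y
  interpret W: sgraph W adj'
    by unfold_locales (use finite_subset[OF W(1) finite_V] in \<open>auto simp: adj'_def intro: adj_sym\<close>)
  have col: "W.colourable_on k U \<longleftrightarrow> colourable_on k U" if "U \<subseteq> W" for k U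
    unfolding W.colourable_on_def colourable_on_def using that by (auto simp: adj'_def subset_iff; blast)
  have cyc: "induced_cycle n c \<and> range c \<subseteq> W" if c: "W.induced_cycle n c" for n c
  proof -
    have "adj' (c i) (c (i + 1))" for i using W.induced_cycle_adj[OF c] by simp
    then have "c i \<in> W" for i by (simp add: adj'_def)
    then show ?thesis using c unfolding W.induced_cycle_def induced_cycle_def adj'_def by auto
  qed
  interpret W: forbidden_graph W adj'
  proof unfold_locales
    show False if "adj' a b" "adj' b c" "adj' c d" "adj' d e" "adj' b d"
      "\<not> adj' a c" "\<not> adj' a d" "\<not> adj' a e" "\<not> adj' b e" "\<not> adj' c e" for a b c d e
      using no_bull[of a b c d e] that unfolding adj'_def by blast
    show False if "adj' z a" "adj' z b" "adj' b b'" "adj' z d" "adj' d d'"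
      "\<not> adj' z b'" "\<not> adj' z d'" "\<not> adj' a b" "\<not> adj' a b'" "\<not> adj' a d" "\<not> adj' a d'"
      "\<not> adj' b d" "\<not> adj' b d'" "\<not> adj' b' d" "\<not> adj' b' d'" for z a b b' d d'
      using no_E[of z a b b' d d'] that unfolding adj'_def by blast
    show "\<exists>i. \<not> adj' v (c i)" if "odd n" "3 \<le> n" "W.induced_cycle n c" for n c v
      using no_wheel[of n c v] cyc[OF that(3)] that by (auto simp: adj'_def)
    show False if "1 \<le> p" "inj_on u {..3 * p}" "\<And>k. k < 3 * p \<Longrightarrow> adj' (u k) (u (k + 1))" "adj' (u (3 * p)) (u 0)"
      "\<And>i. i < p \<Longrightarrow> adj' (u (3 * i)) (u (3 * i + 2))" "\<And>i. i < p \<Longrightarrow> adj' (u (3 * i + 1)) (u (3 * i + 3))"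
    for p :: nat and u
      using no_spindle[of p u] that unfolding adj'_def by blast
  qed
  interpret W: critical_graph W adj'
    by unfold_locales (use W(2) smaller col in auto)
  show False by (rule W.contradiction)
qed

section \<open>Copies of the forbidden graphs in pair digraphs\<close>

lemma contains_inducedI:
  assumes G: "pair_wf_digraph G" and H: "parcs H \<subseteq> pverts H \<times> pverts H"
    and f: "inj_on f (pverts H)" "f ` pverts H \<subseteq> pverts G"
    and arcs: "\<And>x y. \<lbrakk>x \<in> pverts H; y \<in> pverts H\<rbrakk> \<Longrightarrow> (f x, f y) \<in> parcs G \<longleftrightarrow> (x, y) \<in> parcs H"
  shows "contains_induced G H"
proof -
  interpret G: pair_wf_digraph G by (rule G)
  define S where "S = f ` pverts H"
  define H' where "H' = \<lparr> pverts = S, parcs = {e \<in> parcs G. fst e \<in> S \<and> snd e \<in> S} \<rparr>"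
  interpret H': pair_wf_digraph H' by unfold_locales (auto simp: H'_def)
  have ind: "induced_subgraph (with_proj H') (with_proj G)"
    unfolding induced_subgraph_def subgraph_def compatible_def
    using f(2) G.wf_digraph_axioms H'.wf_digraph_axioms by (auto simp: H'_def S_def)
  define g where "g = the_inv_into (pverts H) f"
  have gf: "g (f x) = x" if "x \<in> pverts H" for x
    using the_inv_into_f_f[OF f(1) that] by (simp add: g_def)
  define hom where "hom = \<lparr> iso_verts = g, iso_arcs = (\<lambda>(x, y). (g x, g y)), iso_head = snd, iso_tail = fst \<rparr>"
  have injg: "inj_on g S" using gf by (auto simp: S_def inj_on_def)
  have "inj_on (\<lambda>(x, y). (g x, g y)) (S \<times> S)" using injg by (auto simp: inj_on_def)
  then have inja: "inj_on (\<lambda>(x, y). (g x, g y)) (parcs H')"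
    by (rule inj_on_subset) (auto simp: H'_def)
  have "pre_digraph.digraph_isomorphism (with_proj H') hom"
    unfolding pre_digraph.digraph_isomorphism_def
    using H'.wf_digraph_axioms injg inja by (auto simp: hom_def H'_def)
  moreover have "with_proj H = app_iso hom (with_proj H')"
  proof -
    have "g ` S = pverts H" using gf by (force simp: S_def)
    moreover have "(\<lambda>(x, y). (g x, g y)) ` parcs H' = parcs H"
    proof
      show "(\<lambda>(x, y). (g x, g y)) ` parcs H' \<subseteq> parcs H"
        using gf arcs by (auto simp: H'_def S_def)
      show "parcs H \<subseteq> (\<lambda>(x, y). (g x, g y)) ` parcs H'"
      proof
        fix e assume e: "e \<in> parcs H"
        obtain x y where xy: "e = (x, y)" by (cases e)
        then have "x \<in> pverts H" "y \<in> pverts H" using e H by auto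
        then show "e \<in> (\<lambda>(x, y). (g x, g y)) ` parcs H'"
          using e xy gf arcs by (intro image_eqI[of _ _ "(f x, f y)"]) (auto simp: H'_def S_def)
      qed
    qed
    ultimately show ?thesis by (simp add: app_iso_def hom_def with_proj_def H'_def)
  qed
  ultimately have "digraph_iso (with_proj H') (with_proj H)" unfolding digraph_iso_def by blast
  then show ?thesis using ind unfolding contains_induced_def by blast
qed

text \<open>The copy gets only the images of the arcs of the standard spindle. Its neighbourhoods
  are therefore exactly those that \<open>spindle\<close> prescribes, even if \<open>G\<close> has
  further edges among its vertices.\<close>

lemma contains_spindle:
  assumes G: "pair_graph G" and p: "p \<ge> 1" and u: "inj_on u {..3 * p}" "u ` {..3 * p} \<subseteq> pverts G"
    and arcs: "\<And>x y. (x, y) \<in> parcs (standard_spindle p) \<Longrightarrow> (u x, u y) \<in> parcs G"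
  shows "\<exists>H. spindle p H \<and> subgraph (with_proj H) (with_proj G)"
proof -
  interpret G: pair_graph G by (rule G)
  define M where "M = standard_spindle p"
  have M: "spindle p M" unfolding M_def by (rule spindle_standard_spindle[OF p])
  then interpret M: pair_graph M by (simp add: spindle_def)
  have verts: "pverts M = {..3 * p}" by (simp add: M_def standard_spindle_def undirected_def)
  define H where "H = \<lparr> pverts = u ` pverts M, parcs = (\<lambda>(x, y). (u x, u y)) ` parcs M \<rparr>"
  have inj: "inj_on u (pverts M)" using u by (simp add: verts)
  have MV: "x \<in> pverts M \<and> y \<in> pverts M" if "(x, y) \<in> parcs M" for x y
    using that M.in_arcsD1 M.in_arcsD2 by blast
  have nbh_H: "nbh H (u x) = u ` nbh M x" if x: "x \<in> pverts M" for x
  proof (intro set_eqI iffI)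
    fix y assume "y \<in> nbh H (u x)"
    then obtain a b where ab: "(a, b) \<in> parcs M" "u a = u x" "y = u b"
      by (auto simp: nbh_def H_def)
    then have "a = x" using inj_onD[OF inj] MV x by blast
    then show "y \<in> u ` nbh M x" using ab by (auto simp: nbh_def)
  next
    fix y assume "y \<in> u ` nbh M x"
    then show "y \<in> nbh H (u x)" by (force simp: nbh_def H_def)
  qed
  interpret H: pair_graph H
  proof unfold_locales
    show "fst e \<in> pverts H" "snd e \<in> pverts H" if "e \<in> parcs H" for e
      using that MV by (auto simp: H_def)
    show "finite (pverts H)" "finite (parcs H)" by (auto simp: H_def M.pair_finite_verts M.pair_finite_arcs)
    show "fst e \<noteq> snd e" if "e \<in> parcs H" for e
      using that MV inj M.pair_no_loops by (fastforce simp: H_def inj_on_def)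
    have "sym (parcs M)" using M.pair_sym_arcs by (simp add: symmetric_def)
    then have "sym (parcs H)" by (auto simp: H_def sym_def)
    then show "symmetric (with_proj H)" by (simp add: symmetric_def)
  qed
  obtain v where v: "bij_betw v {..3 * p} (pverts M)"
    and cyc: "\<forall>k \<le> 3 * p. (v k, v ((k + 1) mod (3 * p + 1))) \<in> parcs M"
    and nb: "\<forall>i \<in> {1..<p}. nbh M (v (3 * i)) =
          {v (3 * i - 2), v (3 * i - 1), v (3 * i + 1), v (3 * i + 2)}"
    and dia: "\<forall>i \<in> {1..p}. nbh M (v (3 * i - 1)) \<inter> nbh M (v (3 * i - 2)) = {v (3 * i - 3), v (3 * i)}"
    using M unfolding spindle_def by blast
  have vM: "v k \<in> pverts M" if "k \<le> 3 * p" for k using v that by (auto simp: bij_betw_def)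
  have nbM: "nbh M x \<subseteq> pverts M" for x using MV by (auto simp: nbh_def)
  have "spindle p H"
    unfolding spindle_def
  proof (intro conjI exI[of _ "u \<circ> v"] allI impI ballI)
    show "pair_graph H" by unfold_locales
    show "bij_betw (u \<circ> v) {..3 * p} (pverts H)"
      using bij_betw_trans[OF v, of u "pverts H"] inj by (simp add: H_def bij_betw_def)
    show "((u \<circ> v) k, (u \<circ> v) ((k + 1) mod (3 * p + 1))) \<in> parcs H" if "k \<le> 3 * p" for k
      using cyc that by (force simp: H_def)
    show "nbh H ((u \<circ> v) (3 * i)) = {(u \<circ> v) (3 * i - 2), (u \<circ> v) (3 * i - 1), (u \<circ> v) (3 * i + 1), (u \<circ> v) (3 * i + 2)}"
      if "i \<in> {1..<p}" for i
      using nb that nbh_H[OF vM, of "3 * i"] by simp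
    show "nbh H ((u \<circ> v) (3 * i - 1)) \<inter> nbh H ((u \<circ> v) (3 * i - 2)) = {(u \<circ> v) (3 * i - 3), (u \<circ> v) (3 * i)}"
      if i: "i \<in> {1..p}" for i
    proof -
      have "nbh H ((u \<circ> v) (3 * i - 1)) \<inter> nbh H ((u \<circ> v) (3 * i - 2))
          = u ` (nbh M (v (3 * i - 1)) \<inter> nbh M (v (3 * i - 2)))"
      proof -
        have "3 * i - 1 \<le> 3 * p" "3 * i - 2 \<le> 3 * p" using i by auto
        then show ?thesis
          unfolding o_apply by (simp only: nbh_H[OF vM] inj_on_image_Int[OF inj nbM nbM])
      qed
      then show ?thesis using dia i by simp
    qed
  qed
  moreover have "subgraph (with_proj H) (with_proj G)"
    unfolding subgraph_def compatible_def
    using u(2) arcs G.wf_digraph_axioms H.wf_digraph_axioms by (auto simp: H_def verts M_def[symmetric])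
  ultimately show ?thesis by blast
qed

theorem theorem3:
  fixes G :: "'a pair_pre_digraph"
  assumes "pair_graph G"
    and "connected (with_proj G)"
    and "\<not> contains_induced G bull"
    and "\<not> contains_induced G (S_graph 1 2 2)"
  shows "(\<exists>t \<ge> 1. contains_induced G (wheel (2 * t + 1))) \<or>
    (\<exists>i \<ge> 1. \<exists>H. spindle i H \<and> subgraph (with_proj H) (with_proj G)) \<or>
    colourable 3 G"
proof (rule ccontr)
  assume neg: "\<not> ?thesis"
  interpret G: pair_graph G by fact
  have wf: "pair_wf_digraph G" by unfold_locales
  define adj where "adj x y \<longleftrightarrow> (x, y) \<in> parcs G" for x y
  have symG: "(y, x) \<in> parcs G" if "(x, y) \<in> parcs G" for x y
    using that G.pair_sym_arcs by (auto simp: symmetric_def dest: symD)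
  have VG: "x \<in> pverts G \<and> y \<in> pverts G" if "(x, y) \<in> parcs G" for x y
    using that G.in_arcsD1 G.in_arcsD2 by blast
  have no_loop: "(x, x) \<notin> parcs G" for x
    using G.pair_no_loops[of "(x, x)"] by auto
  interpret sgraph "pverts G" adj
    by unfold_locales (use symG VG G.pair_finite_verts no_loop in \<open>auto simp: adj_def\<close>)
  have "colourable_on 3 (pverts G) \<longleftrightarrow> colourable 3 G"
    unfolding colourable_on_def colourable_def using VG by (auto simp: adj_def; blast)
  then have not_col: "\<not> colourable_on 3 (pverts G)" using neg by blast
  interpret forbidden_graph "pverts G" adj
  proof unfold_locales
    fix a b c d e
    assume adj: "adj a b" "adj b c" "adj c d" "adj d e" "adj b d"
      "\<not> adj a c" "\<not> adj a d" "\<not> adj a e" "\<not> adj b e" "\<not> adj c e"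
    define f where "f k = [a, b, c, d, e] ! (k - 1)" for k :: nat
    have verts: "pverts bull = {1, 2, 3, 4, 5}" by (auto simp: bull_def undirected_def)
    have ne: "distinct [a, b, c, d, e]" using adj adj_sym by auto
    have "contains_induced G bull"
    proof (rule contains_inducedI[OF wf])
      show "parcs bull \<subseteq> pverts bull \<times> pverts bull" by (auto simp: bull_def undirected_def)
      show "inj_on f (pverts bull)" using ne by (auto simp: verts f_def inj_on_def)
      show "f ` pverts bull \<subseteq> pverts G" using adj VG by (auto simp: verts f_def adj_def)
      show "(f x, f y) \<in> parcs G \<longleftrightarrow> (x, y) \<in> parcs bull" if "x \<in> pverts bull" "y \<in> pverts bull" for x y
        using that adj adj(1-5)[THEN adj_sym] adj(6-10)[THEN contrapos_nn, OF adj_sym]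
        unfolding verts adj_def[symmetric]
        by (elim insertE emptyE) (simp_all add: f_def bull_def undirected_def)
    qed
    then show False using assms(3) by simp
  next
    fix z a b b' d d'
    assume adj: "adj z a" "adj z b" "adj b b'" "adj z d" "adj d d'"
      "\<not> adj z b'" "\<not> adj z d'" "\<not> adj a b" "\<not> adj a b'" "\<not> adj a d" "\<not> adj a d'"
      "\<not> adj b d" "\<not> adj b d'" "\<not> adj b' d" "\<not> adj b' d'"
    define f :: "nat \<times> nat \<Rightarrow> 'a" where "f = (\<lambda>(l, m). if m = 0 then z else if l = 0 then a
      else if l = 1 then (if m = 1 then b else b') else (if m = 1 then d else d'))"
    have lt: "l < 3 \<longleftrightarrow> l = 0 \<or> l = 1 \<or> l = 2" for l :: nat by auto
    have verts_iff: "l < 3 \<and> 1 \<le> m \<and> m \<le> [1, 2, 2] ! l \<longleftrightarrow>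
        (l, m) \<in> {(0, 1), (1, 1), (1, 2), (2, 1), (2, 2)}" for l m :: nat
      unfolding lt by auto
    have verts: "pverts (S_graph 1 2 2) = {(0, 0), (0, 1), (1, 1), (1, 2), (2, 1), (2, 2)}"
      unfolding S_graph_def undirected_def verts_iff by auto
    have arcs_iff: "l < 3 \<and> 1 \<le> m \<and> m < [1, 2, 2] ! l \<longleftrightarrow> (l = 1 \<or> l = 2) \<and> m = 1" for l m :: nat
      unfolding lt by auto
    have outer: "{((l, m), (l, m + 1)) | l m. l < 3 \<and> 1 \<le> m \<and> m < [1, 2, 2] ! l} =
        {((1, 1), (1, 2)), ((2, 1), (2, 2 :: nat))}"
      unfolding arcs_iff by auto
    have inner: "{((0, 0), (l, 1)) | l. l < 3} = {((0, 0), (0, 1)), ((0, 0), (1, 1)), ((0, 0), (2 :: nat, 1))}"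
      unfolding lt by auto
    have arcs: "parcs (S_graph 1 2 2) = (let E = {((0, 0), (0, 1)), ((0, 0), (1, 1)), ((0, 0), (2, 1)),
        ((1, 1), (1, 2)), ((2, 1), (2, 2))} in E \<union> E\<inverse>)"
      unfolding S_graph_def undirected_def inner outer Let_def by (simp add: insert_commute)
    note sym = adj(1-5)[THEN adj_sym] adj(6-15)[THEN contrapos_nn, OF adj_sym]
    have ne: "distinct [z, a, b, b', d, d']" using adj sym by auto
    have "contains_induced G (S_graph 1 2 2)"
    proof (rule contains_inducedI[OF wf])
      show "parcs (S_graph 1 2 2) \<subseteq> pverts (S_graph 1 2 2) \<times> pverts (S_graph 1 2 2)"
      proof -
        let ?V = "{(0, 0), (0, 1), (1, 1), (1, 2), (2, 1), (2, 2)} :: (nat \<times> nat) set"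
        have "{((0, 0), (0, 1)), ((0, 0), (1, 1)), ((0, 0), (2, 1)), ((1, 1), (1, 2)), ((2, 1), (2, 2))} \<subseteq> ?V \<times> ?V"
          by simp
        from this converse_mono[THEN iffD2, OF this] show ?thesis
          unfolding verts arcs Let_def converse_Times by (rule Un_least)
      qed
      show "inj_on f (pverts (S_graph 1 2 2))" unfolding verts using ne by (auto simp: f_def inj_on_def)
      show "f ` pverts (S_graph 1 2 2) \<subseteq> pverts G" unfolding verts using adj VG by (auto simp: f_def adj_def)
      show "(f x, f y) \<in> parcs G \<longleftrightarrow> (x, y) \<in> parcs (S_graph 1 2 2)"
        if "x \<in> pverts (S_graph 1 2 2)" "y \<in> pverts (S_graph 1 2 2)" for x y
        using that adj sym unfolding verts adj_def[symmetric] arcs Let_def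
        by (elim insertE emptyE) (simp_all add: f_def)
    qed
    then show False using assms(4) by simp
  next
    fix n c v
    assume n: "odd n" "3 \<le> n" and c: "induced_cycle n c"
    show "\<exists>i. \<not> adj v (c i)"
    proof (rule ccontr)
      assume "\<not> ?thesis"
      then have v: "adj v (c i)" for i by blast
      note v = v v[THEN adj_sym]
      define N where "N = nat n"
      have N: "int N = n" using n by (simp add: N_def)
      have "odd N" using n N by (simp add: N_def even_nat_iff)
      then obtain t where t: "N = 2 * t + 1" by (rule oddE)
      then have t1: "t \<ge> 1" using n N by auto
      define f where "f k = (if k = N then v else c (int k))" for k
      have verts: "pverts (wheel N) = {..N}" by (simp add: wheel_def undirected_def)
      have arcs: "(x, y) \<in> parcs (wheel N) \<longleftrightarrow> x < N \<and> y = (x + 1) mod N \<or> y < N \<and> x = (y + 1) mod N \<or>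
          x = N \<and> y < N \<or> y = N \<and> x < N" for x y
        unfolding wheel_def undirected_def pair_pre_digraph.simps Un_iff converse_iff mem_Collect_eq prod.inject
        by blast
      \<comment> \<open>Turns successors modulo \<open>N\<close> on the rim into the divisibility
        form of \<open>induced_cycle_adj\<close>.\<close>
      have next_iff: "y = (x + 1) mod N \<longleftrightarrow> n dvd (int x - int y + 1)" if "y < N" for x y
      proof -
        have "int ((x + 1) mod N) = (int x + 1) mod n" by (simp add: of_nat_mod N add.commute)
        then have "y = (x + 1) mod N \<longleftrightarrow> int y = (int x + 1) mod n" by linarith
        also have "\<dots> \<longleftrightarrow> (int x + 1) mod n = int y mod n"
          using mod_pos_pos_trivial[of "int y" n] that N by (simp add: eq_commute)
        also have "\<dots> \<longleftrightarrow> n dvd (int x - int y + 1)" by (simp add: mod_eq_dvd_iff algebra_simps)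
        finally show ?thesis .
      qed
      have prev_iff: "n dvd (int x - int y - 1) \<longleftrightarrow> n dvd (int y - int x + 1)" for x y
        using dvd_minus_iff[of n "int y - int x + 1"] by (simp add: algebra_simps)
      have "contains_induced G (wheel N)"
      proof (rule contains_inducedI[OF wf])
        show "parcs (wheel N) \<subseteq> pverts (wheel N) \<times> pverts (wheel N)"
          using n N by (auto simp: arcs verts)
        have "inj_on (\<lambda>k. c (int k)) {..<N}"
          using N by (auto simp: inj_on_def induced_cycle_eq[OF c] dvd_small_int abs_less_iff)
        moreover have "v \<noteq> c i" for i using v(1)[of i] by auto
        ultimately show "inj_on f (pverts (wheel N))"
          by (auto simp: verts f_def inj_on_def le_less)
        show "f ` pverts (wheel N) \<subseteq> pverts G" using v VG by (auto simp: f_def adj_def)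
        show "(f x, f y) \<in> parcs G \<longleftrightarrow> (x, y) \<in> parcs (wheel N)"
          if "x \<in> pverts (wheel N)" "y \<in> pverts (wheel N)" for x y
        proof (cases "x = N \<or> y = N")
          case True
          have "z mod N \<noteq> N" for z using mod_less_divisor[of N z] n N by linarith
          then have "N \<noteq> z mod N" for z by metis
          then show ?thesis
            using True that v unfolding arcs adj_def[symmetric] verts f_def by auto
        next
          case False
          then have xy: "x < N" "y < N" using that by (auto simp: verts)
          then show ?thesis
            unfolding arcs adj_def[symmetric] f_def next_iff[OF xy(1)] next_iff[OF xy(2)]
            by (auto simp: induced_cycle_adj[OF c] prev_iff)
        qed
      qed
      then show False using neg t t1 by auto
    qed
  next
    fix p :: nat and u
    assume p: "1 \<le> p" "inj_on u {..3 * p}" "\<And>k. k < 3 * p \<Longrightarrow> adj (u k) (u (k + 1))" "adj (u (3 * p)) (u 0)"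
      "\<And>i. i < p \<Longrightarrow> adj (u (3 * i)) (u (3 * i + 2))" "\<And>i. i < p \<Longrightarrow> adj (u (3 * i + 1)) (u (3 * i + 3))"
    have step: "adj (u k) (u ((k + 1) mod (3 * p + 1)))" if "k \<le> 3 * p" for k
      using p(3)[of k] p(4) that by (cases "k = 3 * p") auto
    have "\<exists>H. spindle p H \<and> subgraph (with_proj H) (with_proj G)"
    proof (rule contains_spindle[OF \<open>pair_graph G\<close> p(1,2)])
      show "u ` {..3 * p} \<subseteq> pverts G" using step VG by (auto simp: adj_def)
      have "(u x, u y) \<in> parcs G"
        if "(x, y) \<in> {(k, (k + 1) mod (3 * p + 1)) | k. k \<le> 3 * p} \<union>
          {(3 * i, 3 * i + 2) | i. i < p} \<union> {(3 * i + 1, 3 * i + 3) | i. i < p}" for x y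
        using that step p(5,6) unfolding adj_def by blast
      then show "(u x, u y) \<in> parcs G" if "(x, y) \<in> parcs (standard_spindle p)" for x y
        using that symG unfolding standard_spindle_def undirected_def by (simp only: pair_pre_digraph.simps) blast
    qed
    then show False using neg p(1) by blast
  qed
  show False using colourable not_col by blast
qed

end
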